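(* Let $M^{16}$ be a Riemannian manifold equipped with a $\mathrm{Spin}(9)$-structure $V^9\to M^{16}$. The $8$-form $\Phi_{\mathrm{Spin}(9)}$ associated with the $\mathrm{Spin}(9)$-structure coincides, up to a constant, with the coefficient $\tau_4(\psi)$ of $t^5$ in the characteristic polynomial $$\det(tI-\psi)=t^9+\tau_4(\psi)t^5+\tau_8(\psi)t,$$ where $\psi$ is any local Kähler matrix of $M$. The proportionality factor is given by $$360\,\Phi_{\mathrm{Spin}(9)}=\tau_4(\psi).$$
   Context: A $\mathrm{Spin}(9)$-structure on a Riemannian manifold $M^{16}$ is a rank $9$ vector subbundle $V^9\subset\mathrm{End}(TM)$ locally spanned by nine endomorphisms $\mathcal I_1,\dots,\mathcal I_9$ with $\mathcal I_\alpha^2=\mathrm{Id}$, $\mathcal I_\alpha^*=\mathcal I_\alpha$ (adjoint), $\mathcal I_\alpha\mathcal I_\beta=-\mathcal I_\beta\mathcal I_\alpha$ for $\alpha\neq\beta$. For such a local frame, $J_{\alpha\beta}=\mathcal I_\alpha\mathcal I_\beta$ ($\alpha\ne\beta$) are local almost complex structures with Kähler forms $\psi_{\alpha\beta}(X,Y)=\langle X,J_{\alpha\beta}Y\rangle$, and $\psi_{\alpha\alpha}=0$; the skew-symmetric matrix $\psi=(\psi_{\alpha\beta})_{1\le\alpha,\beta\le9}$ is a local Kähler matrix of $M$. Local Kähler matrices for different frames are related by $\psi'=A^{-1}\psi A$ with $A$ taking values in $\mathrm{SO}(9)$, so $\det(tI-\psi)$ (computed in the commutative algebra of even-degree forms with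 wedge product) is globally defined. The $8$-form $\Phi_{\mathrm{Spin}(9)}$ on $M$ is the one locally written as the following $\mathrm{Spin}(9)$-invariant model form on $\mathbb{R}^{16}=\mathbb{O}^2$: $$\Phi_{\mathrm{Spin}(9)}=\frac{110880}{\pi^4}\int_{\mathbb{O}P^1}p_l^*\nu_l\,dl,$$ whose coefficients are integers with greatest common divisor $1$. Here the integral is over the octonionic lines $l=l_m=\{(x,mx):x\in\mathbb{O}\}$, $m\in\mathbb{O}$, and $l=\{(0,y)\}$, parametrized by $\mathbb{O}P^1=S^8$; $p_l:\mathbb{O}^2\to l$ is the projection; $\nu_l$ is the volume form on $l$; $dl$ is the invariant measure on $\mathbb{O}P^1$, equal to $(1+|m|^2)^{-8}dm_1\cdots dm_8$ in the chart $m\in\mathbb{O}\cong\mathbb{R}^8$. The octonions are $\mathbb{O}=\mathbb{H}\oplus\mathbb{H}e$ with product $(h_1+h_2e)(h_1'+h_2'e)=(h_1h_1'-\overline{h_2'}h_2)+(h_2\overline{h_1'}+h_2'h_1)e$ and real basis $1,i,j,k,e,f=ie,g=je,h=ke$. The standard $\mathrm{Spin}(9)$-structure on $\mathbb{O}^2$ is spanned by $\mathcal I_1=\begin{pmatrix}0&\mathrm{Id}\\ \mathrm{Id}&0\end{pmatrix}$, $\mathcal I_{2},\dots,\mathcal I_8=\begin{pmatrix}0&-R_u\\ R_u&0\end{pmatrix}$ for $u=i,j,k,e,f,g,h$ ($R_u$ is right multiplication $x\mapsto xu$), $\mathcal I_9=\begin{pmatrix}\mathrm{Id}&0\\0&-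\mathrm{Id}\end{pmatrix}$.
   Formalization: The model form over the lines (x, mx) is not invariant under the Spin(9) of the structure built from R_u (whose lines are (x, xm)); the two are matched by octonion conjugation (x,y)→(x*,y* ), with each line oriented by x in the basis 1,i,j,k,e,f,g,h. *)

theory Defs
  imports "HOL-Analysis.Analysis" "Jordan_Normal_Form.Char_Poly"
begin

section \<open>The commutative algebra of even-degree forms\<close>

text \<open>An inhomogeneous exterior form on \<open>'v\<close> is a function on lists of vectors; its degree \<open>n\<close> part
  is its restriction to the lists of length \<open>n\<close>.\<close>

definition exterior_form :: "('v::real_vector list \<Rightarrow> real) \<Rightarrow> bool" where
  "exterior_form f \<longleftrightarrow>
     (\<forall>xs ys. linear (\<lambda>v. f (xs @ v # ys))) \<and> (\<forall>xs. \<not> distinct xs \<longrightarrow> f xs = 0)"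

text \<open>For an index set \<open>S\<close>, the number of inversions of the shuffle that lists \<open>S\<close> in increasing order,
  followed by the complement of \<open>S\<close> in increasing order.\<close>

definition inversions :: "nat set \<Rightarrow> nat" where
  "inversions S = card {(i, j). i \<in> S \<and> j < i \<and> j \<notin> S}"

text \<open>The wedge product as a signed sum over shuffles, without factorials: for covectors
  \<open>(a \<and> b)(v, w) = a(v) b(w) - a(w) b(v)\<close>.\<close>

definition wedge :: "('v list \<Rightarrow> real) \<Rightarrow> ('v list \<Rightarrow> real) \<Rightarrow> 'v list \<Rightarrow> real" where
  "wedge f g xs =
     (\<Sum>S\<in>Pow {..<length xs}. (- 1) ^ inversions S * f (nths xs S) * g (nths xs (- S)))"

definition contract :: "'v \<Rightarrow> ('v list \<Rightarrow> real) \<Rightarrow> 'v list \<Rightarrow> real" where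
  "contract v f ys = f (v # ys)"

definition twist :: "('v list \<Rightarrow> real) \<Rightarrow> 'v list \<Rightarrow> real" where
  "twist f ys = (- 1) ^ length ys * f ys"

lemma inversions_insert_0: "inversions (insert 0 (Suc ` T)) = inversions T"
proof -
  have "{(i, j). i \<in> insert 0 (Suc ` T) \<and> j < i \<and> j \<notin> insert 0 (Suc ` T)} =
      map_prod Suc Suc ` {(i, j). i \<in> T \<and> j < i \<and> j \<notin> T}" (is "?L = ?R")
  proof
    show "?L \<subseteq> ?R"
    proof
      fix z assume "z \<in> ?L"
      then obtain i j where a: "z = (i, j)" "i \<in> insert 0 (Suc ` T)" "j < i" "j \<notin> insert 0 (Suc ` T)"
        by blast
      then obtain i' j' where "i = Suc i'" "j = Suc j'" "i' \<in> T" by (cases j) auto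
      with a show "z \<in> ?R" by (intro image_eqI[of _ _ "(i', j')"]) auto
    qed
  qed auto
  then show ?thesis
    unfolding inversions_def by (simp add: card_image inj_on_def)
qed

lemma finite_inversions: "finite T \<Longrightarrow> finite {(i, j). i \<in> T \<and> j < i \<and> j \<notin> (T :: nat set)}"
  by (rule finite_subset[of _ "SIGMA i : T. {..<i}"]) auto

lemma inversions_Suc:
  assumes "finite T"
  shows "inversions (Suc ` T) = inversions T + card T"
proof -
  let ?A = "{(i, j). i \<in> T \<and> j < i \<and> j \<notin> T}"
  have "{(i, j). i \<in> Suc ` T \<and> j < i \<and> j \<notin> Suc ` T} =
      map_prod Suc Suc ` ?A \<union> (\<lambda>i. (Suc i, 0)) ` T" (is "?L = ?R")
  proof
    show "?L \<subseteq> ?R"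
    proof
      fix z assume "z \<in> ?L"
      then obtain i j where a: "z = (Suc i, j)" "i \<in> T" "j < Suc i" "j \<notin> Suc ` T"
        by blast
      show "z \<in> ?R"
      proof (cases j)
        case 0
        with a show ?thesis by blast
      next
        case (Suc j')
        with a have "z \<in> map_prod Suc Suc ` ?A" by (intro image_eqI[of _ _ "(i, j')"]) auto
        then show ?thesis ..
      qed
    qed
  qed auto
  moreover have "card (map_prod Suc Suc ` ?A \<union> (\<lambda>i. (Suc i, 0)) ` T)
      = card (map_prod Suc Suc ` ?A) + card ((\<lambda>i. (Suc i, 0 :: nat)) ` T)"
    using finite_inversions[OF assms] assms by (intro card_Un_disjoint) auto
  ultimately show ?thesis
    unfolding inversions_def by (simp add: card_image inj_on_def)
qed

lemma wedge_Nil: "wedge f g [] = f [] * g []"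
  by (simp add: wedge_def inversions_def)

lemma wedge_Cons:
  "wedge f g (v # xs) = wedge (contract v f) g xs + wedge (twist f) (contract v g) xs"
proof -
  let ?n = "length xs"
  let ?F = "\<lambda>S. (- 1) ^ inversions S * f (nths (v # xs) S) * g (nths (v # xs) (- S))"
  have P: "Pow {..<Suc ?n} = (\<lambda>T. insert 0 (Suc ` T)) ` Pow {..<?n} \<union> image Suc ` Pow {..<?n}"
    (is "_ = ?A \<union> ?B")
  proof
    show "Pow {..<Suc ?n} \<subseteq> ?A \<union> ?B"
    proof
      fix S assume S: "S \<in> Pow {..<Suc ?n}"
      define T where "T = {j. Suc j \<in> S}"
      have T: "T \<in> Pow {..<?n}" using S by (auto simp: T_def)
      have "S = insert 0 (Suc ` T) \<or> S = Suc ` T"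
      proof (cases "0 \<in> S")
        case True
        have "x \<in> S \<longleftrightarrow> x \<in> insert 0 (Suc ` T)" for x
          using True by (cases x) (auto simp: T_def)
        then show ?thesis by blast
      next
        case False
        have "x \<in> S \<longleftrightarrow> x \<in> Suc ` T" for x
          using False by (cases x) (auto simp: T_def)
        then show ?thesis by blast
      qed
      with T show "S \<in> ?A \<union> ?B" by blast
    qed
  qed auto
  have i1: "inj_on (\<lambda>T. insert 0 (Suc ` T)) (Pow {..<?n})"
  proof (rule inj_onI)
    fix S T :: "nat set" assume "insert 0 (Suc ` S) = insert 0 (Suc ` T)"
    then have "Suc ` S = Suc ` T" by (metis Diff_insert_absorb imageE nat.distinct(1))
    then show "S = T" by (simp add: inj_image_eq_iff)
  qed
  have i2: "inj_on (image Suc) (Pow {..<?n})"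
    by (simp add: inj_on_def inj_image_eq_iff)
  have d: "?A \<inter> ?B = {}" by auto
  have c: "{j. Suc j \<notin> Suc ` T} = - T" "{j. Suc j \<in> - insert 0 (Suc ` T)} = - T"
    "{j. Suc j \<in> insert 0 (Suc ` T)} = T" "{j. Suc j \<in> Suc ` T} = T" for T
    by auto
  have s1: "?F (insert 0 (Suc ` T)) =
      (- 1) ^ inversions T * contract v f (nths xs T) * g (nths xs (- T))" for T
    by (simp add: nths_Cons inversions_insert_0 contract_def c del: image_insert)
  have s2: "?F (Suc ` T) =
      (- 1) ^ inversions T * twist f (nths xs T) * contract v g (nths xs (- T))"
    if "T \<in> Pow {..<?n}" for T
  proof -
    have "{i. i < ?n \<and> i \<in> T} = T" using that by auto
    moreover have "finite T" using that finite_subset by auto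
    ultimately show ?thesis
      by (simp add: nths_Cons inversions_Suc contract_def twist_def c length_nths power_add)
  qed
  have "wedge f g (v # xs) = sum ?F (?A \<union> ?B)"
    unfolding wedge_def by (simp add: P)
  also have "\<dots> = sum ?F ?A + sum ?F ?B"
    by (rule sum.union_disjoint) (use d in auto)
  also have "sum ?F ?A = wedge (contract v f) g xs"
    unfolding wedge_def sum.reindex[OF i1] o_def by (intro sum.cong refl s1)
  also have "sum ?F ?B = wedge (twist f) (contract v g) xs"
    unfolding wedge_def sum.reindex[OF i2] o_def by (intro sum.cong refl s2)
  finally show ?thesis .
qed

lemma wedge_add_left: "wedge (\<lambda>x. f x + g x) h xs = wedge f h xs + wedge g h xs"
  by (simp add: wedge_def algebra_simps sum.distrib)

lemma wedge_add_right: "wedge h (\<lambda>x. f x + g x) xs = wedge h f xs + wedge h g xs"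
  by (simp add: wedge_def algebra_simps sum.distrib)

lemma wedge_mult_left: "wedge (\<lambda>x. c * f x) h xs = c * wedge f h xs"
  by (simp add: wedge_def algebra_simps sum_distrib_left)

lemma wedge_mult_right: "wedge h (\<lambda>x. c * f x) xs = c * wedge h f xs"
  by (simp add: wedge_def algebra_simps sum_distrib_left)

lemma contract_twist: "contract v (twist f) = (\<lambda>x. - 1 * twist (contract v f) x)"
  by (auto simp: contract_def twist_def)

lemma contract_wedge:
  "contract v (wedge f g) = (\<lambda>x. wedge (contract v f) g x + wedge (twist f) (contract v g) x)"
  by (rule ext) (simp add: contract_def[of v "wedge f g"] wedge_Cons)

lemma wedge_twist: "wedge (twist f) (twist g) xs = twist (wedge f g) xs"
proof (induction xs arbitrary: f g)
  case Nil
  show ?case by (simp add: wedge_Nil twist_def)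
next
  case (Cons v xs)
  show ?case
    unfolding wedge_Cons contract_twist wedge_mult_left wedge_mult_right Cons.IH
    by (simp add: twist_def wedge_Cons algebra_simps)
qed

lemma wedge_assoc: "wedge (wedge f g) h xs = wedge f (wedge g h) xs"
proof (induction xs arbitrary: f g h)
  case Nil
  show ?case by (simp add: wedge_Nil)
next
  case (Cons v xs)
  have t: "twist (wedge f g) = wedge (twist f) (twist g)"
    by (rule ext) (simp add: wedge_twist)
  show ?case
    unfolding wedge_Cons contract_wedge wedge_add_left wedge_add_right t Cons.IH by simp
qed

lemma wedge_graded_commute:
  assumes "\<And>ys. odd (length ys + a) \<Longrightarrow> f ys = 0" "\<And>ys. odd (length ys + b) \<Longrightarrow> g ys = 0"
  shows "wedge f g xs = (- 1) ^ (a * b) * wedge g f xs"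
  using assms
proof (induction xs arbitrary: f g a b)
  case Nil
  show ?case
    using Nil(1)[of "[]"] Nil(2)[of "[]"] by (cases "even a"; cases "even b") (simp_all add: wedge_Nil)
next
  case (Cons v xs)
  have tf: "twist f = (\<lambda>x. (- 1) ^ a * f x)"
  proof
    fix x show "twist f x = (- 1) ^ a * f x"
      using Cons.prems(1)[of x]
      by (cases "even a"; cases "even (length x)") (simp_all add: twist_def)
  qed
  have tg: "twist g = (\<lambda>x. (- 1) ^ b * g x)"
  proof
    fix x show "twist g x = (- 1) ^ b * g x"
      using Cons.prems(2)[of x]
      by (cases "even b"; cases "even (length x)") (simp_all add: twist_def)
  qed
  have cf: "odd (length ys + Suc a) \<Longrightarrow> contract v f ys = 0" for ys
    using Cons.prems(1)[of "v # ys"] by (simp add: contract_def)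
  have cg: "odd (length ys + Suc b) \<Longrightarrow> contract v g ys = 0" for ys
    using Cons.prems(2)[of "v # ys"] by (simp add: contract_def)
  show ?case
    unfolding wedge_Cons tf tg wedge_mult_left
    using Cons.IH[of "Suc a" "contract v f" b g, OF cf Cons.prems(2)]
      Cons.IH[of a f "Suc b" "contract v g", OF Cons.prems(1) cg]
    by (cases "even a"; cases "even b") simp_all
qed

lemma exterior_formD:
  assumes "exterior_form f"
  shows "linear (\<lambda>v. f (xs @ v # ys))" "\<not> distinct xs \<Longrightarrow> f xs = 0"
  using assms by (auto simp: exterior_form_def)

lemma linear_wedge:
  assumes "\<And>xs ys. linear (\<lambda>v. f (xs @ v # ys))" "\<And>xs ys. linear (\<lambda>v. g (xs @ v # ys))"
  shows "linear (\<lambda>v. wedge f g (xs @ v # ys))"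
  using assms
proof (induction xs arbitrary: f g)
  case Nil
  have *: "linear (\<lambda>v. h (v # zs))" if "\<And>xs ys. linear (\<lambda>v. h (xs @ v # ys))"
    for h :: "'a list \<Rightarrow> real" and zs
    using that[of "[]" zs] by simp
  have l: "linear (\<lambda>v. a * h v * b)" if "linear h" for a b :: real and h :: "'a \<Rightarrow> real"
    using linear_compose_scale_right[OF that, of "a * b"] by (simp add: mult_ac)
  have r: "linear (\<lambda>v. a * h v)" if "linear h" for a :: real and h :: "'a \<Rightarrow> real"
    using linear_compose_scale_right[OF that, of a] by simp
  have "linear (\<lambda>v. wedge (contract v f) g ys)"
    unfolding wedge_def contract_def by (rule linear_compose_sum, rule ballI, rule l, rule *, rule Nil)
  moreover have "linear (\<lambda>v. wedge (twist f) (contract v g) ys)"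
    unfolding wedge_def contract_def by (rule linear_compose_sum, rule ballI, rule r, rule *, rule Nil)
  ultimately show ?case
    unfolding wedge_Cons append_Nil by (rule linear_compose_add)
next
  case (Cons x xs)
  have 1: "linear (\<lambda>v. contract x h (xs @ v # ys))" if "\<And>xs ys. linear (\<lambda>v. h (xs @ v # ys))"
    for h :: "'a list \<Rightarrow> real" and xs ys
    using that[of "x # xs" ys] by (simp add: contract_def)
  have 2: "linear (\<lambda>v. twist h (xs @ v # ys))" if "\<And>xs ys. linear (\<lambda>v. h (xs @ v # ys))"
    for h :: "'a list \<Rightarrow> real" and xs ys
    using linear_compose_scale_right[OF that[of xs ys], of "(- 1) ^ Suc (length xs + length ys)"]
    by (simp add: twist_def)
  show ?case
    unfolding append_Cons wedge_Cons
    using Cons.IH[OF 1[OF Cons.prems(1)] Cons.prems(2)]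
      Cons.IH[OF 2[OF Cons.prems(1)] 1[OF Cons.prems(2)]]
    by (rule linear_compose_add)
qed

lemma wedge_adjacent:
  assumes "\<And>xs ys v. f (xs @ v # v # ys) = 0" "\<And>xs ys v. g (xs @ v # v # ys) = 0"
  shows "wedge f g (xs @ v # v # ys) = 0"
  using assms
proof (induction xs arbitrary: f g)
  case Nil
  have "contract v (contract v f) = (\<lambda>x. 0 * f x)" "contract v (contract v g) = (\<lambda>x. 0 * g x)"
    using Nil(1)[of "[]"] Nil(2)[of "[]"] by (auto simp: contract_def)
  then show ?case
    by (simp only: append_Nil wedge_Cons contract_twist wedge_mult_left wedge_mult_right)
next
  case (Cons x xs)
  have 1: "contract x h (xs @ v # v # ys) = 0" if "\<And>xs ys v. h (xs @ v # v # ys) = 0"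
    for h :: "'a list \<Rightarrow> real" and xs ys v
    using that[of "x # xs"] by (simp add: contract_def)
  have 2: "twist h (xs @ v # v # ys) = 0" if "\<And>xs ys v. h (xs @ v # v # ys) = 0"
    for h :: "'a list \<Rightarrow> real" and xs ys v
    using that by (simp add: twist_def)
  have "wedge (contract x f) g (xs @ v # v # ys) = 0"
    by (rule Cons.IH, rule 1, rule Cons.prems(1), rule Cons.prems(2))
  moreover have "wedge (twist f) (contract x g) (xs @ v # v # ys) = 0"
    by (rule Cons.IH, rule 2, rule Cons.prems(1), rule 1, rule Cons.prems(2))
  ultimately show ?case
    unfolding append_Cons wedge_Cons by simp
qed

lemma exterior_form_adjacentI:
  assumes lin: "\<And>xs ys. linear (\<lambda>v. f (xs @ v # ys))"
    and adj: "\<And>xs ys v. f (xs @ v # v # ys) = 0"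
  shows "exterior_form f"
  unfolding exterior_form_def
proof (intro conjI allI impI lin)
  have swap: "f (xs @ a # b # ys) = - f (xs @ b # a # ys)" for xs a b ys
  proof -
    have "f (xs @ (a + b) # (a + b) # ys) =
        f (xs @ a # (a + b) # ys) + f (xs @ b # (a + b) # ys)"
      using linear_add[OF lin[of xs "(a + b) # ys"]] .
    moreover have "f (xs @ c # (a + b) # ys) = f (xs @ c # a # ys) + f (xs @ c # b # ys)" for c
      using linear_add[OF lin[of "xs @ [c]" ys]] by simp
    ultimately show ?thesis using adj by simp
  qed
  have sep: "f (xs @ y # ys @ y # zs) = 0" for xs y ys zs
  proof (induction ys arbitrary: xs)
    case Nil
    show ?case using adj by simp
  next
    case (Cons x ys)
    show ?case using swap[of xs y x "ys @ y # zs"] Cons.IH[of "xs @ [x]"] by simp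
  qed
  fix xs :: "'a list" assume "\<not> distinct xs"
  then obtain ps y qs rs where "xs = ps @ [y] @ qs @ [y] @ rs"
    using not_distinct_decomp by blast
  then show "f xs = 0" using sep by simp
qed

lemma exterior_form_wedge:
  assumes "exterior_form f" "exterior_form g"
  shows "exterior_form (wedge f g)"
  by (intro exterior_form_adjacentI linear_wedge wedge_adjacent)
    (simp_all add: exterior_formD[OF assms(1)] exterior_formD[OF assms(2)])

text \<open>Even-degree forms; the ring multiplication is the wedge product, so that
  \<^const>\<open>char_poly\<close> applies to matrices of even-degree forms.\<close>

typedef (overloaded) ('v::real_vector) even_form =
  "{f :: 'v list \<Rightarrow> real. exterior_form f \<and> (\<forall>xs. odd (length xs) \<longrightarrow> f xs = 0)}"
  by (rule exI[of _ "\<lambda>_. 0"]) (simp add: exterior_form_def linear_zero)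

setup_lifting type_definition_even_form

instantiation even_form :: (real_vector) comm_ring_1
begin

lift_definition zero_even_form :: "'a even_form" is "\<lambda>_. 0"
  by (simp add: exterior_form_def linear_zero)

lift_definition one_even_form :: "'a even_form" is "\<lambda>xs. if xs = [] then 1 else 0"
  by (auto simp: exterior_form_def linear_zero)

lift_definition plus_even_form :: "'a even_form \<Rightarrow> 'a even_form \<Rightarrow> 'a even_form"
  is "\<lambda>f g xs. f xs + g xs"
  by (auto simp: exterior_form_def intro!: linear_compose_add)

lift_definition uminus_even_form :: "'a even_form \<Rightarrow> 'a even_form" is "\<lambda>f xs. - f xs"
  by (auto simp: exterior_form_def intro!: linear_compose_neg)

lift_definition minus_even_form :: "'a even_form \<Rightarrow> 'a even_form \<Rightarrow> 'a even_form"
  is "\<lambda>f g xs. f xs - g xs"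
  by (auto simp: exterior_form_def intro!: linear_compose_sub)

lift_definition times_even_form :: "'a even_form \<Rightarrow> 'a even_form \<Rightarrow> 'a even_form" is wedge
proof (intro conjI allI impI)
  fix f g :: "'a list \<Rightarrow> real" and xs :: "'a list"
  assume f: "exterior_form f \<and> (\<forall>xs. odd (length xs) \<longrightarrow> f xs = 0)"
    and g: "exterior_form g \<and> (\<forall>xs. odd (length xs) \<longrightarrow> g xs = 0)"
  show "exterior_form (wedge f g)" using f g exterior_form_wedge by blast
  assume "odd (length xs)"
  moreover have "twist f = f" "twist g = g"
    using f g by (auto simp: twist_def fun_eq_iff uminus_power_if)
  ultimately show "wedge f g xs = 0"
    using wedge_twist[of f g xs] by (simp add: twist_def)
qed

instance
proof
  fix a b c :: "'a even_form"
  show "a * b * c = a * (b * c)" by transfer (rule ext, rule wedge_assoc)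
  show "a * b = b * a"
    by transfer (rule ext, rule wedge_graded_commute[of 0 _ 0, simplified], auto)
  show "1 * a = a"
  proof (transfer, rule ext)
    fix f :: "'a list \<Rightarrow> real" and xs :: "'a list"
    have "wedge (\<lambda>xs. if xs = [] then 1 else 0) f xs = f xs" for f :: "'a list \<Rightarrow> real"
    proof (induction xs arbitrary: f)
      case Nil
      show ?case by (simp add: wedge_Nil)
    next
      case (Cons v xs)
      have e: "contract v (\<lambda>xs. if xs = [] then 1 else 0) = (\<lambda>x. 0 * f x)"
        "twist (\<lambda>xs. if xs = [] then 1 else 0) = (\<lambda>xs :: 'a list. if xs = [] then 1 else 0)"
        by (auto simp: contract_def twist_def)
      show ?case
        unfolding wedge_Cons e wedge_mult_left Cons.IH by (simp add: contract_def)
    qed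
    then show "wedge (\<lambda>xs. if xs = [] then 1 else 0) f xs = f xs" .
  qed
  show "(a + b) * c = a * c + b * c" by transfer (rule ext, rule wedge_add_left)
  show "a + b + c = a + (b + c)" "a + b = b + a" "0 + a = a" "- a + a = 0" "a - b = a + - b"
    by (transfer; simp add: algebra_simps)+
  show "(0 :: 'a even_form) \<noteq> 1" by transfer (auto dest: fun_cong[of _ _ "[]"])
qed

end

definition pullback_form ::
    "('v::real_normed_vector \<Rightarrow>\<^sub>L 'w::real_normed_vector) \<Rightarrow> 'w even_form \<Rightarrow> 'v even_form" where
  "pullback_form L \<omega> = Abs_even_form (\<lambda>vs. Rep_even_form \<omega> (map (blinfun_apply L) vs))"


section \<open>Octonions and the model 8-form\<close>

type_synonym quat = "real \<times> real \<times> real \<times> real"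
type_synonym oct = "quat \<times> quat"

fun qmul :: "quat \<Rightarrow> quat \<Rightarrow> quat" where
  "qmul (a0, a1, a2, a3) (b0, b1, b2, b3) =
     (a0 * b0 - a1 * b1 - a2 * b2 - a3 * b3, a0 * b1 + a1 * b0 + a2 * b3 - a3 * b2,
      a0 * b2 - a1 * b3 + a2 * b0 + a3 * b1, a0 * b3 + a1 * b2 - a2 * b1 + a3 * b0)"

fun qcnj :: "quat \<Rightarrow> quat" where
  "qcnj (a0, a1, a2, a3) = (a0, - a1, - a2, - a3)"

text \<open>The pair \<open>(h1, h2)\<close> is \<open>h1 + h2 e\<close>.\<close>

fun omul :: "oct \<Rightarrow> oct \<Rightarrow> oct" where
  "omul (h1, h2) (k1, k2) = (qmul h1 k1 - qmul (qcnj k2) h2, qmul h2 (qcnj k1) + qmul k2 h1)"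

fun ocnj :: "oct \<Rightarrow> oct" where
  "ocnj (h1, h2) = (qcnj h1, - h2)"

text \<open>\<open>1, i, j, k, e, f = ie, g = je, h = ke\<close>\<close>

definition oct_basis :: "oct list" where
  "oct_basis =
     [((1, 0, 0, 0), 0), ((0, 1, 0, 0), 0), ((0, 0, 1, 0), 0), ((0, 0, 0, 1), 0),
      (0, (1, 0, 0, 0)), (0, (0, 1, 0, 0)), (0, (0, 0, 1, 0)), (0, (0, 0, 0, 1))]"

definition std_I :: "nat \<Rightarrow> oct \<times> oct \<Rightarrow> oct \<times> oct" where
  "std_I \<alpha> = (\<lambda>(x, y).
     if \<alpha> = 1 then (y, x)
     else if \<alpha> = 9 then (x, - y)
     else (- omul y (oct_basis ! (\<alpha> - 1)), omul x (oct_basis ! (\<alpha> - 1))))"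

definition std_spin9 :: "((oct \<times> oct) \<Rightarrow>\<^sub>L (oct \<times> oct)) set" where
  "std_spin9 = span ((\<lambda>\<alpha>. Blinfun (std_I \<alpha>)) ` {1..9})"

definition oct_line :: "oct \<Rightarrow> (oct \<times> oct) set" where
  "oct_line m = range (\<lambda>x. (x, omul m x))"

text \<open>Since \<open>|m u| = |m| |u|\<close>, this is an orthonormal basis of the line \<open>l\<^sub>m\<close>. The lines are oriented
  by the coordinate \<open>x\<close> and the ordered basis \<open>1, i, \<dots>, h\<close>.\<close>

definition line_frame :: "oct \<Rightarrow> (oct \<times> oct) list" where
  "line_frame m = map (\<lambda>u. (u, omul m u) /\<^sub>R sqrt (1 + (norm m)\<^sup>2)) oct_basis"

definition line_volume :: "oct \<Rightarrow> (oct \<times> oct) list \<Rightarrow> real" where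
  "line_volume m ws = Determinant.det (Matrix.mat 8 8 (\<lambda>(i, j). inner (line_frame m ! i) (ws ! j)))"

text \<open>The integral over the octonionic projective line is taken in the chart \<open>m\<close>, which misses only
  the line \<open>{(0, y)}\<close>, a null set; \<^const>\<open>closest_point\<close> is the orthogonal projection to a line.\<close>

definition spin9_model_form :: "(oct \<times> oct) even_form" where
  "spin9_model_form = Abs_even_form (\<lambda>ws.
     if length ws = 8 then
       110880 / pi ^ 4 *
         (LINT m|lborel. line_volume m (map (closest_point (oct_line m)) ws) / (1 + (norm m)\<^sup>2) ^ 8)
     else 0)"


section \<open>Riemannian 16-manifolds\<close>

primrec Ck_on :: "nat \<Rightarrow> 'a::real_normed_vector set \<Rightarrow> ('a \<Rightarrow> 'b::real_normed_vector) \<Rightarrow> bool" where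
  "Ck_on 0 S f \<longleftrightarrow> continuous_on S f"
| "Ck_on (Suc k) S f \<longleftrightarrow>
     (\<forall>x\<in>S. f differentiable (at x)) \<and> (\<forall>v. Ck_on k S (\<lambda>x. frechet_derivative f (at x) v))"

text \<open>Only used for open \<open>S\<close>.\<close>

definition smooth_on :: "'a::real_normed_vector set \<Rightarrow> ('a \<Rightarrow> 'b::real_normed_vector) \<Rightarrow> bool" where
  "smooth_on S f \<longleftrightarrow> (\<forall>k. Ck_on k S f)"

type_synonym R16 = "real ^ 16"
type_synonym 'm chart = "'m set \<times> ('m \<Rightarrow> R16)"

definition chart_on :: "'m topology \<Rightarrow> 'm chart \<Rightarrow> bool" where
  "chart_on X c \<longleftrightarrow> openin X (fst c) \<and> open (snd c ` fst c) \<and>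
     homeomorphic_map (subtopology X (fst c)) (top_of_set (snd c ` fst c)) (snd c)"

definition chart_inv :: "'m chart \<Rightarrow> R16 \<Rightarrow> 'm" where
  "chart_inv c = inv_into (fst c) (snd c)"

definition smooth_manifold :: "'m topology \<Rightarrow> 'm chart set \<Rightarrow> bool" where
  "smooth_manifold X A \<longleftrightarrow>
     Hausdorff_space X \<and> second_countable X \<and> (\<forall>c\<in>A. chart_on X c) \<and> (\<Union>c\<in>A. fst c) = topspace X \<and>
     (\<forall>c\<in>A. \<forall>d\<in>A. smooth_on (snd c ` (fst c \<inter> fst d)) (snd d \<circ> chart_inv c))"

text \<open>Tensors on the manifold are families of tensors on \<open>\<real>\<^sup>1\<^sup>6\<close>, one for each chart \<open>c\<close> and each point
  \<open>p\<close> in its domain: the expression of the tensor in the coordinate identification of the tangent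
  space at \<open>p\<close> with \<open>\<real>\<^sup>1\<^sup>6\<close>. The expressions in two charts correspond under the differential of the
  change of coordinates.\<close>

type_synonym 'm bilinear_field = "'m chart \<Rightarrow> 'm \<Rightarrow> R16 \<Rightarrow> R16 \<Rightarrow> real"
type_synonym 'm endo_field = "'m chart \<Rightarrow> 'm \<Rightarrow> R16 \<Rightarrow>\<^sub>L R16"
type_synonym 'm endo_set_field = "'m chart \<Rightarrow> 'm \<Rightarrow> (R16 \<Rightarrow>\<^sub>L R16) set"

definition change_coords :: "'m chart \<Rightarrow> 'm chart \<Rightarrow> 'm \<Rightarrow> R16 \<Rightarrow> R16" where
  "change_coords c d p = frechet_derivative (snd d \<circ> chart_inv c) (at (snd c p))"

definition riemannian_metric :: "'m chart set \<Rightarrow> 'm bilinear_field \<Rightarrow> bool" where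
  "riemannian_metric A g \<longleftrightarrow>
     (\<forall>c\<in>A. (\<forall>p\<in>fst c. bilinear (g c p) \<and> (\<forall>v w. g c p v w = g c p w v) \<and>
                         (\<forall>v. v \<noteq> 0 \<longrightarrow> g c p v v > 0)) \<and>
            (\<forall>v w. smooth_on (snd c ` fst c) (\<lambda>x. g c (chart_inv c x) v w))) \<and>
     (\<forall>c\<in>A. \<forall>d\<in>A. \<forall>p\<in>fst c \<inter> fst d. \<forall>v w.
        g d p (change_coords c d p v) (change_coords c d p w) = g c p v w)"

definition riemannian_manifold ::
    "'m topology \<Rightarrow> 'm chart set \<Rightarrow> 'm bilinear_field \<Rightarrow> bool" where
  "riemannian_manifold X A g \<longleftrightarrow> smooth_manifold X A \<and> riemannian_metric A g"

definition smooth_endomorphism_on :: "'m chart set \<Rightarrow> 'm set \<Rightarrow> 'm endo_field \<Rightarrow> bool" where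
  "smooth_endomorphism_on A W T \<longleftrightarrow>
     (\<forall>c\<in>A. smooth_on (snd c ` (fst c \<inter> W)) (T c \<circ> chart_inv c)) \<and>
     (\<forall>c\<in>A. \<forall>d\<in>A. \<forall>p\<in>fst c \<inter> fst d \<inter> W. \<forall>v.
        T d p (change_coords c d p v) = change_coords c d p (T c p v))"


section \<open>Spin(9)-structures\<close>

definition spin9_system :: "('v::real_normed_vector \<Rightarrow> 'v \<Rightarrow> real) \<Rightarrow> (nat \<Rightarrow> 'v \<Rightarrow>\<^sub>L 'v) \<Rightarrow> bool" where
  "spin9_system G J \<longleftrightarrow>
     (\<forall>\<alpha>\<in>{1..9}. J \<alpha> o\<^sub>L J \<alpha> = id_blinfun \<and> (\<forall>v w. G (J \<alpha> v) w = G v (J \<alpha> w)) \<and>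
        (\<forall>\<beta>\<in>{1..9}. \<alpha> \<noteq> \<beta> \<longrightarrow> J \<alpha> o\<^sub>L J \<beta> = - (J \<beta> o\<^sub>L J \<alpha>)))"

definition spin9_frame_on ::
    "'m topology \<Rightarrow> 'm chart set \<Rightarrow> 'm bilinear_field \<Rightarrow> 'm endo_set_field \<Rightarrow>
     'm set \<Rightarrow> (nat \<Rightarrow> 'm endo_field) \<Rightarrow> bool" where
  "spin9_frame_on X A g V W I \<longleftrightarrow>
     openin X W \<and> (\<forall>\<alpha>\<in>{1..9}. smooth_endomorphism_on A W (I \<alpha>)) \<and>
     (\<forall>c\<in>A. \<forall>p\<in>fst c \<inter> W. spin9_system (g c p) (\<lambda>\<alpha>. I \<alpha> c p) \<and>
        V c p = span ((\<lambda>\<alpha>. I \<alpha> c p) ` {1..9}))"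

definition spin9_structure ::
    "'m topology \<Rightarrow> 'm chart set \<Rightarrow> 'm bilinear_field \<Rightarrow> 'm endo_set_field \<Rightarrow> bool" where
  "spin9_structure X A g V \<longleftrightarrow>
     (\<forall>c\<in>A. \<forall>p\<in>fst c. dim (V c p) = 9) \<and>
     (\<forall>p\<in>topspace X. \<exists>W I. p \<in> W \<and> spin9_frame_on X A g V W I)"

definition kaehler_form ::
    "('v::real_normed_vector \<Rightarrow> 'v \<Rightarrow> real) \<Rightarrow> (nat \<Rightarrow> 'v \<Rightarrow>\<^sub>L 'v) \<Rightarrow> nat \<Rightarrow> nat \<Rightarrow> 'v even_form" where
  "kaehler_form G J \<alpha> \<beta> =
     (if \<alpha> = \<beta> then 0
      else Abs_even_form (\<lambda>vs. if length vs = 2 then G (vs ! 0) ((J \<alpha> o\<^sub>L J \<beta>) (vs ! 1)) else 0))"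

text \<open>Matrix entries are indexed from 0, frames from 1.\<close>

definition kaehler_matrix ::
    "('v::real_normed_vector \<Rightarrow> 'v \<Rightarrow> real) \<Rightarrow> (nat \<Rightarrow> 'v \<Rightarrow>\<^sub>L 'v) \<Rightarrow> 'v even_form Matrix.mat" where
  "kaehler_matrix G J = Matrix.mat 9 9 (\<lambda>(i, j). kaehler_form G J (i + 1) (j + 1))"

definition tau :: "nat \<Rightarrow> 'v::real_vector even_form Matrix.mat \<Rightarrow> 'v even_form" where
  "tau k \<psi> = coeff (char_poly \<psi>) (9 - k)"

text \<open>An adapted frame at a point is an isometry \<open>L\<close> to the octonionic plane under which the fibre
  \<open>V\<close> becomes the structure belonging to the lines \<open>l\<^sub>m = {(x, m x)}\<close>, that is, the one whose unit
  vectors are the involutions with a line as \<open>1\<close>-eigenspace. The involutions in \<^const>\<open>std_spin9\<close>,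
  built from right multiplications, have as \<open>1\<close>-eigenspaces the lines \<open>{(x, x m)}\<close> and \<open>{(0, y)}\<close>; the
  conjugation \<open>(x, y) \<mapsto> (x\<^sup>*, y\<^sup>*)\<close> takes the lines \<open>l\<^sub>m\<close> to these, as \<open>(m x)\<^sup>* = x\<^sup>* m\<^sup>*\<close>. Hence \<open>V\<close> is
  matched with \<^const>\<open>std_spin9\<close> in the conjugate coordinates. Without the conjugation the pullback of
  the model form would depend on \<open>L\<close>: the stabilizer of \<^const>\<open>std_spin9\<close> in \<open>O(16)\<close>, a copy of
  \<open>Spin(9)\<close>, does not preserve the family of the lines \<open>l\<^sub>m\<close>.\<close>

definition adapted_frame ::
    "('v::real_normed_vector \<Rightarrow> 'v \<Rightarrow> real) \<Rightarrow> ('v \<Rightarrow>\<^sub>L 'v) set \<Rightarrow> ('v \<Rightarrow>\<^sub>L (oct \<times> oct)) \<Rightarrow> bool" where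
  "adapted_frame G V L \<longleftrightarrow>
     (\<forall>v w. inner (L v) (L w) = G v w) \<and>
     V = {T :: 'v \<Rightarrow>\<^sub>L 'v. \<exists>S\<in>std_spin9. \<forall>v. map_prod ocnj ocnj (L (T v)) = S (map_prod ocnj ocnj (L v))}"

text \<open>The value of the 8-form of the manifold at one point, where \<open>G\<close> is the metric and \<open>V\<close> the fibre of
  the structure: the form which is the model form in every adapted frame at that point.\<close>

definition Phi_spin9 ::
    "('v::real_normed_vector \<Rightarrow> 'v \<Rightarrow> real) \<Rightarrow> ('v \<Rightarrow>\<^sub>L 'v) set \<Rightarrow> 'v even_form" where
  "Phi_spin9 G V =
     (THE \<Phi>. (\<exists>L. adapted_frame G V L) \<and>
              (\<forall>L. adapted_frame G V L \<longrightarrow> \<Phi> = pullback_form L spin9_model_form))"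

end

theory Submission
  imports Defs "HOL-Probability.Distributions"
begin

text \<open>Let \<open>f\<close> be an \<open>8\<close>-form on the octonionic plane and let \<open>v\<close> be a list of eight vectors, each in one of
  the eigenspaces of \<open>I\<^sub>9\<close>, with \<open>q\<close> of them in the \<open>-1\<close>-eigenspace. Consider the sum over \<open>\<alpha> \<le> 8\<close> and over
  ordered pairs of distinct vectors of the latter kind of the values of \<open>f\<close> after \<open>I\<^sub>\<alpha>\<close> is applied to both
  vectors of the pair. For both forms of the theorem this sum is \<open>q (16 - q) f(v)\<close>. For \<open>\<tau>\<^sub>4\<close> this
  expresses, by an identity for a Casimir operator on \<open>2\<close>-forms, that the rotations generated by the
  \<open>I\<^sub>\<alpha> I\<^sub>\<beta>\<close> preserve the form; for the integral over the lines it is integration by parts against a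
  power of \<open>1 + |m|\<^sup>2\<close>. As \<open>q (16 - q) \<noteq> 0\<close> for \<open>0 < q \<le> 8\<close> and the sum involves only lists with \<open>q - 2\<close>
  vectors in the \<open>-1\<close>-eigenspace, either form is determined by its value on a basis of the
  \<open>1\<close>-eigenspace. These values are \<open>-5040\<close> for \<open>\<tau>\<^sub>4\<close>, where \<open>4 \<tau>\<^sub>4 = - tr \<psi>\<^sup>4\<close>, and \<open>-14\<close> for the model form in
  conjugate coordinates. In degrees \<open>4\<close> and \<open>12\<close> the corresponding factor never vanishes, so that
  \<open>\<tau>\<^sub>2 = \<tau>\<^sub>6 = 0\<close>; the other missing coefficients vanish because \<open>\<psi>\<close> is skew.

  At a point of the manifold, a common eigenvector of \<open>I\<^sub>9\<close> and of commuting products of the \<open>I\<^sub>\<alpha>\<close> satisfies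
  the relations of the first standard basis vector, which yields an adapted frame. Passing to it
  conjugates the Kaehler matrix by a constant orthogonal matrix.\<close>

subsection \<open>Exterior forms on lists\<close>

text \<open>The exponent 12 of the density explains why both recursions carry the factor
  \<open>q (16 - q)\<close>: eight comes from the invariant measure and four from normalising the
  eight vectors of a line frame. Integration by parts in dimension 8 then gives
  \<open>2 * 11 - 8 - (q - 2) = 16 - q\<close>. The values on the first line have these sources.
  Eight vectors split into four ordered pairs in \<open>8! / 2^4 = 2520\<close> ways, each
  contributing the trace 8 of the identity of the octonions to \<open>tr \<psi>^4\<close>, whence
  \<open>- 8 * 2520 / 4 = - 5040\<close>. The integral of \<open>(1 + |m|^2)^(-12)\<close> is
  \<open>pi^4 * 7! / 11! = pi^4 / 7920\<close>, and conjugation of the octonions has determinant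
  \<open>-1\<close>, whence \<open>- 110880 / 7920 = - 14\<close>; and
  \<open>5040 / 14 = 360\<close>. Two obstacles shape the proof. Even forms are a ring with zero
  divisors, so Newton's identity is drawn from the adjugate of \<open>t I - \<psi>\<close>. And the
  product of the nine generators is a central involution whose sign distinguishes two kinds of
  frames; reversing one generator changes the kind and keeps the fibre.\<close>

lemma exterior_form_linear_update:
  assumes "exterior_form f" "i < length v"
  shows "linear (\<lambda>x. f (v[i := x]))"
  using exterior_formD(1)[OF assms(1), of "take i v" "drop (Suc i) v"] assms(2)
  by (simp add: upd_conv_take_nth_drop)

lemma exterior_form_repeat:
  assumes "exterior_form f" "i < length v" "j < length v" "i \<noteq> j" "v ! i = v ! j"
  shows "f v = 0"
  using exterior_formD(2)[OF assms(1)] assms(2-) by (metis nth_eq_iff_index_eq)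

lemma exterior_form_swap:
  assumes "exterior_form f"
  shows "f (xs @ a # b # ys) = - f (xs @ b # a # ys)"
proof -
  have z: "f (xs @ v # v # ys) = 0" for v
    by (rule exterior_formD(2)[OF assms]) simp
  have l: "f (xs @ (u + v) # ws) = f (xs @ u # ws) + f (xs @ v # ws)" for xs u v ws
    using linear_add[OF exterior_formD(1)[OF assms, of xs ws]] .
  have "f (xs @ (a + b) # (a + b) # ys) = 0" by (rule z)
  then have "f (xs @ a # (a + b) # ys) + f (xs @ b # (a + b) # ys) = 0" by (simp only: l)
  then show ?thesis
    using l[of "xs @ [a]" a b ys] l[of "xs @ [b]" a b ys] z by simp
qed

lemma exterior_form_move:
  assumes "exterior_form f"
  shows "f (ps @ xs @ a # ys) = (- 1) ^ length xs * f (ps @ a # xs @ ys)"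
proof (induction xs arbitrary: ps)
  case (Cons x xs)
  have "f (ps @ (x # xs) @ a # ys) = f ((ps @ [x]) @ xs @ a # ys)" by simp
  also have "\<dots> = (- 1) ^ length xs * f (ps @ x # a # xs @ ys)"
    by (simp only: Cons.IH) simp
  also have "\<dots> = (- 1) ^ length (x # xs) * f (ps @ a # (x # xs) @ ys)"
    by (simp add: exterior_form_swap[OF assms, of ps x a])
  finally show ?case .
qed simp

text \<open>Only vanishing is transported along a rearrangement, so the sign of the permutation
  never has to be computed.\<close>

lemma exterior_form_mset_zero:
  assumes "exterior_form f" "mset xs = mset ys" "f (ps @ xs) = 0"
  shows "f (ps @ ys) = 0"
  using assms(2,3)
proof (induction xs arbitrary: ps ys)
  case (Cons x xs)
  from Cons.prems(1) have "x \<in> set ys" by (metis list.set_intros(1) mset_eq_setD)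
  then obtain as bs where ys: "ys = as @ x # bs" by (meson split_list)
  with Cons.prems have "mset xs = mset (as @ bs)" by simp
  then have "f ((ps @ [x]) @ as @ bs) = 0"
    using Cons.IH[of "as @ bs" "ps @ [x]"] Cons.prems(2) by simp
  then show ?case
    unfolding ys exterior_form_move[OF assms(1)] by simp
qed simp

lemma exterior_form_zero_span:
  assumes f: "exterior_form f" and B: "span B = UNIV"
    and z: "\<And>xs. set xs \<subseteq> B \<Longrightarrow> length xs = n \<Longrightarrow> f xs = 0"
    and "length xs = n"
  shows "f xs = 0"
proof -
  \<comment> \<open>Invariant: the entries of \<open>ys\<close> are arbitrary, those of
    \<open>zs\<close> lie in \<open>B\<close>. Linearity in the last entry of \<open>ys\<close> lets
    it pass from \<open>B\<close> to the span.\<close>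
  have "f (ys @ zs) = 0" if "set zs \<subseteq> B" "length (ys @ zs) = n" for ys zs
    using that
  proof (induction ys arbitrary: zs rule: rev_induct)
    case Nil
    then show ?case using z by simp
  next
    case (snoc y ys)
    have "f (ys @ b # zs) = 0" if "b \<in> B" for b
      using snoc.IH[of "b # zs"] snoc.prems that by simp
    then have "f (ys @ b # zs) = 0" if "b \<in> span B" for b
      using linear_eq_0_on_span[OF exterior_formD(1)[OF f, of ys zs], of B b] that by blast
    then show ?case using B by simp
  qed
  from this[of "[]" xs] assms(4) show ?thesis by simp
qed

text \<open>In top degree a list of basis vectors either repeats one of them or rearranges
  \<open>bs\<close>.\<close>

lemma exterior_form_top_zero:
  assumes f: "exterior_form f" and B: "span (set bs) = UNIV" "distinct bs" and z: "f bs = 0"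
    and "length xs = length bs"
  shows "f xs = 0"
proof (rule exterior_form_zero_span[OF f B(1) _ assms(5)])
  fix ys assume ys: "set ys \<subseteq> set bs" "length ys = length bs"
  show "f ys = 0"
  proof (cases "distinct ys")
    case True
    with ys have "set ys = set bs"
      by (metis B(2) card_subset_eq distinct_card List.finite_set)
    then have "mset bs = mset ys" using True B(2) by (simp add: set_eq_iff_mset_eq_distinct)
    then show ?thesis using exterior_form_mset_zero[OF f, of bs ys "[]"] z by simp
  next
    case False
    then show ?thesis by (rule exterior_formD(2)[OF f])
  qed
qed

subsection \<open>Constants and pullbacks in the ring of even forms\<close>

lemma Rep_even_form_exterior: "exterior_form (Rep_even_form \<omega>)"
  using Rep_even_form[of \<omega>] by simp

lemma Rep_even_form_odd: "odd (length xs) \<Longrightarrow> Rep_even_form \<omega> xs = 0"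
  using Rep_even_form[of \<omega>] by simp

lemma Rep_even_form_eqI: "(\<And>xs. Rep_even_form a xs = Rep_even_form b xs) \<Longrightarrow> a = b"
  by (metis Rep_even_form_inject ext)

lemma Rep_Abs_even_form:
  assumes "exterior_form f" "\<And>xs. odd (length xs) \<Longrightarrow> f xs = 0"
  shows "Rep_even_form (Abs_even_form f) = f"
  using assms by (intro Abs_even_form_inverse) auto

lemma Rep_even_form_sum: "Rep_even_form (sum f A) xs = (\<Sum>i\<in>A. Rep_even_form (f i) xs)"
  by (induction A rule: infinite_finite_induct)
    (simp_all add: plus_even_form.rep_eq zero_even_form.rep_eq)

text \<open>The reals inside the ring of even forms. Through them a real orthogonal matrix
  conjugates a matrix of forms.\<close>

lift_definition const_form :: "real \<Rightarrow> 'v::real_vector even_form" is "\<lambda>c xs. if xs = [] then c else 0"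
  by (auto simp: exterior_form_def linear_zero)

lemma Rep_const_form_mult: "Rep_even_form (const_form c * f) xs = c * Rep_even_form f xs"
proof -
  have "wedge (Rep_even_form (const_form c)) (Rep_even_form f) xs
      = wedge (\<lambda>x. c * Rep_even_form (1 :: 'a even_form) x) (Rep_even_form f) xs"
    by (rule arg_cong[of _ _ "\<lambda>g. wedge g _ _"]) (auto simp: const_form.rep_eq one_even_form.rep_eq)
  also have "\<dots> = c * Rep_even_form (1 * f) xs"
    by (simp only: wedge_mult_left times_even_form.rep_eq)
  finally show ?thesis by (simp add: times_even_form.rep_eq)
qed

interpretation const_form: comm_ring_hom const_form
proof
  show "const_form (x * y) = const_form x * const_form y" for x y
    by (rule Rep_even_form_eqI) (simp add: Rep_const_form_mult, simp add: const_form.rep_eq)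
qed (transfer; auto)+

lemma Rep_numeral_mult: "Rep_even_form (numeral k * f) xs = numeral k * Rep_even_form f xs"
proof -
  have "Rep_even_form (of_nat n * f) xs = real n * Rep_even_form f xs" for n
    by (induction n) (simp_all add: plus_even_form.rep_eq zero_even_form.rep_eq algebra_simps)
  from this[of "numeral k"] show ?thesis by simp
qed

text \<open>The ring has zero divisors in general, but a numeral cancels because the values of a
  form are real numbers.\<close>

lemma numeral_mult_even_form_cancel:
  fixes a b :: "'v::real_vector even_form"
  assumes "numeral k * a = numeral k * b"
  shows "a = b"
proof (rule Rep_even_form_eqI)
  fix xs
  have "numeral k * Rep_even_form a xs = (numeral k :: real) * Rep_even_form b xs"
    by (metis assms Rep_numeral_mult)
  then show "Rep_even_form a xs = Rep_even_form b xs" by simp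
qed

lemma Rep_pullback_form: "Rep_even_form (pullback_form L \<omega>) vs = Rep_even_form \<omega> (map (blinfun_apply L) vs)"
proof -
  have "exterior_form (\<lambda>vs. Rep_even_form \<omega> (map (blinfun_apply L) vs))"
    unfolding exterior_form_def
  proof (intro conjI allI impI)
    fix xs ys
    show "linear (\<lambda>v. Rep_even_form \<omega> (map (blinfun_apply L) (xs @ v # ys)))"
      using linear_compose[OF bounded_linear.linear[OF blinfun.bounded_linear_right, of L]
          exterior_formD(1)[OF Rep_even_form_exterior, of \<omega> "map L xs" "map L ys"]]
      by (simp add: o_def)
  next
    fix xs :: "'a list" assume "\<not> distinct xs"
    then show "Rep_even_form \<omega> (map (blinfun_apply L) xs) = 0"
      by (intro exterior_formD(2)[OF Rep_even_form_exterior]) (auto simp: distinct_map)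
  qed
  then show ?thesis
    unfolding pullback_form_def by (subst Rep_Abs_even_form) (auto simp: Rep_even_form_odd)
qed

lemma pullback_form_hom: "comm_ring_hom (pullback_form L)"
proof
  fix x y
  show "pullback_form L (x * y) = pullback_form L x * pullback_form L y"
    by (rule Rep_even_form_eqI)
      (simp add: Rep_pullback_form times_even_form.rep_eq wedge_def nths_map)
qed (rule Rep_even_form_eqI, simp add: Rep_pullback_form plus_even_form.rep_eq
     zero_even_form.rep_eq one_even_form.rep_eq)+

subsection \<open>Octonions\<close>

lemma oct_cases:
  obtains a0 a1 a2 a3 b0 b1 b2 b3 where "x = (((a0, a1, a2, a3), (b0, b1, b2, b3)) :: oct)"
  by (metis surj_pair)

lemma linear_omul_left: "linear (\<lambda>x. omul x y)"
proof (rule linearI)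
  fix x z and r
  show "omul (x + z) y = omul x y + omul z y"
    by (cases x rule: oct_cases; cases y rule: oct_cases; cases z rule: oct_cases)
      (simp add: algebra_simps)
  show "omul (r *\<^sub>R x) y = r *\<^sub>R omul x y"
    by (cases x rule: oct_cases; cases y rule: oct_cases) (simp add: algebra_simps)
qed

lemma linear_omul_right: "linear (omul x)"
proof (rule linearI)
  fix y z and r
  show "omul x (y + z) = omul x y + omul x z"
    by (cases x rule: oct_cases; cases y rule: oct_cases; cases z rule: oct_cases)
      (simp add: algebra_simps)
  show "omul x (r *\<^sub>R y) = r *\<^sub>R omul x y"
    by (cases x rule: oct_cases; cases y rule: oct_cases) (simp add: algebra_simps)
qed

subsection \<open>The standard system\<close>

lemma std_I_9: "std_I 9 = (\<lambda>(x, y). (x, - y))"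
  by (simp add: std_I_def)

lemma linear_std_I: "linear (std_I \<alpha>)"
  by (rule linearI)
    (simp_all add: std_I_def case_prod_beta linear_add[OF linear_omul_left] linear_cmul[OF linear_omul_left])

definition bas :: "int \<Rightarrow> oct \<times> oct" where
  "bas i = (if i < 8 then (oct_basis ! nat i, 0) else (0, oct_basis ! nat (i - 8)))"

text \<open>Each \<open>std_I \<alpha>\<close> permutes the standard basis up to sign. Linear
  identities between words in these maps become rewriting with this table on sixteen
  vectors.\<close>

lemma std_I_bas:
  shows
  "std_I 1 (bas 0) = bas 8" "std_I 1 (bas 1) = bas 9" "std_I 1 (bas 2) = bas 10"
  "std_I 1 (bas 3) = bas 11" "std_I 1 (bas 4) = bas 12" "std_I 1 (bas 5) = bas 13"
  "std_I 1 (bas 6) = bas 14" "std_I 1 (bas 7) = bas 15" "std_I 1 (bas 8) = bas 0"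
  "std_I 1 (bas 9) = bas 1" "std_I 1 (bas 10) = bas 2" "std_I 1 (bas 11) = bas 3"
  "std_I 1 (bas 12) = bas 4" "std_I 1 (bas 13) = bas 5" "std_I 1 (bas 14) = bas 6"
  "std_I 1 (bas 15) = bas 7" "std_I 2 (bas 0) = bas 9" "std_I 2 (bas 1) = - bas 8"
  "std_I 2 (bas 2) = - bas 11" "std_I 2 (bas 3) = bas 10" "std_I 2 (bas 4) = - bas 13"
  "std_I 2 (bas 5) = bas 12" "std_I 2 (bas 6) = bas 15" "std_I 2 (bas 7) = - bas 14"
  "std_I 2 (bas 8) = - bas 1" "std_I 2 (bas 9) = bas 0" "std_I 2 (bas 10) = bas 3"
  "std_I 2 (bas 11) = - bas 2" "std_I 2 (bas 12) = bas 5" "std_I 2 (bas 13) = - bas 4"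
  "std_I 2 (bas 14) = - bas 7" "std_I 2 (bas 15) = bas 6" "std_I 3 (bas 0) = bas 10"
  "std_I 3 (bas 1) = bas 11" "std_I 3 (bas 2) = - bas 8" "std_I 3 (bas 3) = - bas 9"
  "std_I 3 (bas 4) = - bas 14" "std_I 3 (bas 5) = - bas 15" "std_I 3 (bas 6) = bas 12"
  "std_I 3 (bas 7) = bas 13" "std_I 3 (bas 8) = - bas 2" "std_I 3 (bas 9) = - bas 3"
  "std_I 3 (bas 10) = bas 0" "std_I 3 (bas 11) = bas 1" "std_I 3 (bas 12) = bas 6"
  "std_I 3 (bas 13) = bas 7" "std_I 3 (bas 14) = - bas 4" "std_I 3 (bas 15) = - bas 5"
  "std_I 4 (bas 0) = bas 11" "std_I 4 (bas 1) = - bas 10" "std_I 4 (bas 2) = bas 9"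
  "std_I 4 (bas 3) = - bas 8" "std_I 4 (bas 4) = - bas 15" "std_I 4 (bas 5) = bas 14"
  "std_I 4 (bas 6) = - bas 13" "std_I 4 (bas 7) = bas 12" "std_I 4 (bas 8) = - bas 3"
  "std_I 4 (bas 9) = bas 2" "std_I 4 (bas 10) = - bas 1" "std_I 4 (bas 11) = bas 0"
  "std_I 4 (bas 12) = bas 7" "std_I 4 (bas 13) = - bas 6" "std_I 4 (bas 14) = bas 5"
  "std_I 4 (bas 15) = - bas 4" "std_I 5 (bas 0) = bas 12" "std_I 5 (bas 1) = bas 13"
  "std_I 5 (bas 2) = bas 14" "std_I 5 (bas 3) = bas 15" "std_I 5 (bas 4) = - bas 8"
  "std_I 5 (bas 5) = - bas 9" "std_I 5 (bas 6) = - bas 10" "std_I 5 (bas 7) = - bas 11"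
  "std_I 5 (bas 8) = - bas 4" "std_I 5 (bas 9) = - bas 5" "std_I 5 (bas 10) = - bas 6"
  "std_I 5 (bas 11) = - bas 7" "std_I 5 (bas 12) = bas 0" "std_I 5 (bas 13) = bas 1"
  "std_I 5 (bas 14) = bas 2" "std_I 5 (bas 15) = bas 3" "std_I 6 (bas 0) = bas 13"
  "std_I 6 (bas 1) = - bas 12" "std_I 6 (bas 2) = bas 15" "std_I 6 (bas 3) = - bas 14"
  "std_I 6 (bas 4) = bas 9" "std_I 6 (bas 5) = - bas 8" "std_I 6 (bas 6) = bas 11"
  "std_I 6 (bas 7) = - bas 10" "std_I 6 (bas 8) = - bas 5" "std_I 6 (bas 9) = bas 4"
  "std_I 6 (bas 10) = - bas 7" "std_I 6 (bas 11) = bas 6" "std_I 6 (bas 12) = - bas 1"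
  "std_I 6 (bas 13) = bas 0" "std_I 6 (bas 14) = - bas 3" "std_I 6 (bas 15) = bas 2"
  "std_I 7 (bas 0) = bas 14" "std_I 7 (bas 1) = - bas 15" "std_I 7 (bas 2) = - bas 12"
  "std_I 7 (bas 3) = bas 13" "std_I 7 (bas 4) = bas 10" "std_I 7 (bas 5) = - bas 11"
  "std_I 7 (bas 6) = - bas 8" "std_I 7 (bas 7) = bas 9" "std_I 7 (bas 8) = - bas 6"
  "std_I 7 (bas 9) = bas 7" "std_I 7 (bas 10) = bas 4" "std_I 7 (bas 11) = - bas 5"
  "std_I 7 (bas 12) = - bas 2" "std_I 7 (bas 13) = bas 3" "std_I 7 (bas 14) = bas 0"
  "std_I 7 (bas 15) = - bas 1" "std_I 8 (bas 0) = bas 15" "std_I 8 (bas 1) = bas 14"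
  "std_I 8 (bas 2) = - bas 13" "std_I 8 (bas 3) = - bas 12" "std_I 8 (bas 4) = bas 11"
  "std_I 8 (bas 5) = bas 10" "std_I 8 (bas 6) = - bas 9" "std_I 8 (bas 7) = - bas 8"
  "std_I 8 (bas 8) = - bas 7" "std_I 8 (bas 9) = - bas 6" "std_I 8 (bas 10) = bas 5"
  "std_I 8 (bas 11) = bas 4" "std_I 8 (bas 12) = - bas 3" "std_I 8 (bas 13) = - bas 2"
  "std_I 8 (bas 14) = bas 1" "std_I 8 (bas 15) = bas 0" "std_I 9 (bas 0) = bas 0"
  "std_I 9 (bas 1) = bas 1" "std_I 9 (bas 2) = bas 2" "std_I 9 (bas 3) = bas 3"
  "std_I 9 (bas 4) = bas 4" "std_I 9 (bas 5) = bas 5" "std_I 9 (bas 6) = bas 6"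
  "std_I 9 (bas 7) = bas 7" "std_I 9 (bas 8) = - bas 8" "std_I 9 (bas 9) = - bas 9"
  "std_I 9 (bas 10) = - bas 10" "std_I 9 (bas 11) = - bas 11" "std_I 9 (bas 12) = - bas 12"
  "std_I 9 (bas 13) = - bas 13" "std_I 9 (bas 14) = - bas 14" "std_I 9 (bas 15) = - bas 15"
  by (simp_all add: std_I_def bas_def oct_basis_def zero_prod_def)

lemma indices_16: "{0..15} = {0,1,2,3,4,5,6,7,8,9,10,11,12,13,14,15 :: int}"
  by (auto; presburger)

lemma bas_eq_Basis: "bas ` {0..15} = Basis"
  unfolding indices_16
  by (auto simp: bas_def oct_basis_def Basis_prod_def zero_prod_def)

lemma indices_9: "{1..9} = {1,2,3,4,5,6,7,8,9 :: nat}"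
  by (auto; presburger)

lemma std_I_sq:
  assumes "\<alpha> \<in> {1..9}"
  shows "std_I \<alpha> (std_I \<alpha> x) = x"
proof -
  have "std_I \<alpha> \<circ> std_I \<alpha> = id"
  proof (rule linear_eq_stdbasis)
    show "(std_I \<alpha> \<circ> std_I \<alpha>) v = id v" if "v \<in> Basis" for v
      using assms that unfolding bas_eq_Basis[symmetric] indices_16 indices_9
      by (elim insertE emptyE imageE; simp only: o_apply id_apply std_I_bas linear_neg[OF linear_std_I] minus_minus)
  qed (simp_all add: linear_compose linear_std_I linear_id)
  from fun_cong[OF this, of x] show ?thesis by (simp only: o_apply id_apply)
qed

lemma std_I_anticommute:
  assumes "\<alpha> \<in> {1..9}" "\<beta> \<in> {1..9}" "\<alpha> \<noteq> \<beta>"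
  shows "std_I \<alpha> (std_I \<beta> x) = - std_I \<beta> (std_I \<alpha> x)"
proof -
  have "std_I \<alpha> \<circ> std_I \<beta> = (\<lambda>x. - (std_I \<beta> \<circ> std_I \<alpha>) x)"
  proof (rule linear_eq_stdbasis)
    show "(std_I \<alpha> \<circ> std_I \<beta>) v = - (std_I \<beta> \<circ> std_I \<alpha>) v" if "v \<in> Basis" for v
      using assms that unfolding bas_eq_Basis[symmetric] indices_16 indices_9
      by (elim insertE emptyE imageE; simp only: o_apply std_I_bas linear_neg[OF linear_std_I] minus_minus simp_thms)
  qed (intro linear_compose linear_std_I linear_compose_neg)+
  from fun_cong[OF this, of x] show ?thesis by (simp only: o_apply)
qed

section \<open>Clifford relations and the Casimir identity on 2-forms\<close>

lemma alternating_flip: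
  fixes b :: "'v::real_vector \<Rightarrow> 'v \<Rightarrow> real"
  assumes "bilinear b" "\<And>x. b x x = 0"
  shows "b y x = - b x y"
  using assms(2)[of "x + y"] assms(2)[of x] assms(2)[of y]
  by (simp add: bilinear_ladd[OF assms(1)] bilinear_radd[OF assms(1)])

locale clifford_system =
  fixes S :: "nat \<Rightarrow> 'v::euclidean_space \<Rightarrow> 'v"
  assumes linear_S: "linear (S \<alpha>)"
    and S_sq: "\<alpha> \<in> {1..9} \<Longrightarrow> S \<alpha> (S \<alpha> x) = x"
    and S_anticommute: "\<alpha> \<in> {1..9} \<Longrightarrow> \<beta> \<in> {1..9} \<Longrightarrow> \<alpha> \<noteq> \<beta> \<Longrightarrow> S \<alpha> (S \<beta> x) = - S \<beta> (S \<alpha> x)"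
begin

lemma S_neg: "S \<alpha> (- x) = - S \<alpha> x"
  by (rule linear_neg[OF linear_S])

text \<open>Writing \<open>C b\<close> for the sum of \<open>b (S \<alpha> _) (S \<alpha> _)\<close>
  over the nine indices, this is \<open>C^2 = 2 C + 15\<close> on alternating \<open>b\<close>. The
  first argument is held at \<open>x\<close> so that the relation can be carried from vector to
  vector.\<close>

definition casimir_at :: "'v \<Rightarrow> bool" where
  "casimir_at x \<longleftrightarrow> (\<forall>b y. bilinear b \<longrightarrow> (\<forall>z. b z z = (0 :: real)) \<longrightarrow>
     (\<Sum>\<alpha>\<in>{1..9}. \<Sum>\<beta>\<in>{1..9}. b (S \<alpha> (S \<beta> x)) (S \<alpha> (S \<beta> y)))
     = 2 * (\<Sum>\<alpha>\<in>{1..9}. b (S \<alpha> x) (S \<alpha> y)) + 15 * b x y)"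

lemma linear_comp:
  assumes "linear f"
  shows "linear (\<lambda>x. f (S \<alpha> x))" "linear (\<lambda>x. f (S \<alpha> (S \<beta> x)))"
  using linear_compose[OF linear_S assms] linear_compose[OF linear_compose[OF linear_S linear_S] assms]
  by (simp_all add: o_def)

lemma bilinear_casimir:
  fixes b :: "'v \<Rightarrow> 'v \<Rightarrow> real"
  assumes "bilinear b"
  shows "bilinear (\<lambda>x y. \<Sum>\<alpha>\<in>{1..9 :: nat}. \<Sum>\<beta>\<in>{1..9 :: nat}. b (S \<alpha> (S \<beta> x)) (S \<alpha> (S \<beta> y)))"
    "bilinear (\<lambda>x y. 2 * (\<Sum>\<alpha>\<in>{1..9 :: nat}. b (S \<alpha> x) (S \<alpha> y)) + 15 * b x y)"
proof -
  have s: "linear (\<lambda>x. c * f x)" if "linear f" for f :: "'v \<Rightarrow> real" and c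
    using linear_compose_scale_right[OF that, of c] by simp
  show "bilinear (\<lambda>x y. \<Sum>\<alpha>\<in>{1..9 :: nat}. \<Sum>\<beta>\<in>{1..9 :: nat}. b (S \<alpha> (S \<beta> x)) (S \<alpha> (S \<beta> y)))"
    "bilinear (\<lambda>x y. 2 * (\<Sum>\<alpha>\<in>{1..9 :: nat}. b (S \<alpha> x) (S \<alpha> y)) + 15 * b x y)"
    using assms unfolding bilinear_def
    by (auto intro!: linear_compose_sum linear_compose_add s linear_comp)
qed

text \<open>Pull \<open>b\<close> back along \<open>S \<gamma>\<close>. Moving
  \<open>S \<gamma>\<close> past another generator costs at most a sign, and the same sign occurs in
  both arguments.\<close>

lemma casimir_at_S:
  assumes \<gamma>: "\<gamma> \<in> {1..9}" and x: "casimir_at x"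
  shows "casimir_at (S \<gamma> x)"
  unfolding casimir_at_def
proof (intro allI impI)
  fix b :: "'v \<Rightarrow> 'v \<Rightarrow> real" and y
  assume b: "bilinear b" "\<forall>z. b z z = 0"
  define b' where "b' x y = b (S \<gamma> x) (S \<gamma> y)" for x y
  have b': "bilinear b'" "\<forall>z. b' z z = 0"
    using b unfolding b'_def bilinear_def by (auto intro!: linear_comp)
  have 1: "b (S \<alpha> (S \<gamma> x)) (S \<alpha> (S \<gamma> y)) = b' (S \<alpha> x) (S \<alpha> y)" if "\<alpha> \<in> {1..9}" for \<alpha> x y
    unfolding b'_def
    by (cases "\<alpha> = \<gamma>") (simp_all add: S_anticommute[OF that \<gamma>] bilinear_lneg[OF b(1)] bilinear_rneg[OF b(1)])
  have 2: "b (S \<alpha> (S \<beta> (S \<gamma> x))) (S \<alpha> (S \<beta> (S \<gamma> y))) = b' (S \<alpha> (S \<beta> x)) (S \<alpha> (S \<beta> y))"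
    if "\<alpha> \<in> {1..9}" "\<beta> \<in> {1..9}" for \<alpha> \<beta> x y
    using 1[OF that(1)]
    by (cases "\<beta> = \<gamma>")
      (simp_all add: S_anticommute[OF that(2) \<gamma>] S_neg bilinear_lneg[OF b(1)] bilinear_rneg[OF b(1)])
  \<comment> \<open>The second argument is written as \<open>S \<gamma> (S \<gamma> y)\<close>, so
    that both arguments carry the factor absorbed in \<open>b'\<close>.\<close>
  have "(\<Sum>\<alpha>\<in>{1..9}. \<Sum>\<beta>\<in>{1..9}. b (S \<alpha> (S \<beta> (S \<gamma> x))) (S \<alpha> (S \<beta> (S \<gamma> (S \<gamma> y)))))
      = (\<Sum>\<alpha>\<in>{1..9}. \<Sum>\<beta>\<in>{1..9}. b' (S \<alpha> (S \<beta> x)) (S \<alpha> (S \<beta> (S \<gamma> y))))"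
    by (intro sum.cong refl 2)
  also have "\<dots> = 2 * (\<Sum>\<alpha>\<in>{1..9}. b' (S \<alpha> x) (S \<alpha> (S \<gamma> y))) + 15 * b' x (S \<gamma> y)"
    using x b' unfolding casimir_at_def by blast
  also have "(\<Sum>\<alpha>\<in>{1..9}. b' (S \<alpha> x) (S \<alpha> (S \<gamma> y))) = (\<Sum>\<alpha>\<in>{1..9}. b (S \<alpha> (S \<gamma> x)) (S \<alpha> (S \<gamma> (S \<gamma> y))))"
    by (intro sum.cong refl 1[symmetric])
  finally show "(\<Sum>\<alpha>\<in>{1..9}. \<Sum>\<beta>\<in>{1..9}. b (S \<alpha> (S \<beta> (S \<gamma> x))) (S \<alpha> (S \<beta> y)))
      = 2 * (\<Sum>\<alpha>\<in>{1..9}. b (S \<alpha> (S \<gamma> x)) (S \<alpha> y)) + 15 * b (S \<gamma> x) y"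
    by (simp only: S_sq[OF \<gamma>] b'_def)
qed

lemma casimir_at_all:
  assumes "\<And>v. v \<in> Basis \<Longrightarrow> casimir_at v"
  shows "casimir_at x"
  unfolding casimir_at_def
proof (intro allI impI)
  fix b :: "'v \<Rightarrow> 'v \<Rightarrow> real" and y
  assume b: "bilinear b" "\<forall>z. b z z = 0"
  show "(\<Sum>\<alpha>\<in>{1..9}. \<Sum>\<beta>\<in>{1..9}. b (S \<alpha> (S \<beta> x)) (S \<alpha> (S \<beta> y)))
      = 2 * (\<Sum>\<alpha>\<in>{1..9}. b (S \<alpha> x) (S \<alpha> y)) + 15 * b x y"
    using bilinear_eq_stdbasis[OF bilinear_casimir[OF b(1)]] assms b
    unfolding casimir_at_def fun_eq_iff by blast
qed

end

interpretation std: clifford_system std_I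
  by (rule clifford_system.intro) (rule linear_std_I std_I_sq std_I_anticommute; assumption)+

text \<open>On \<open>\<Lambda>\<^sup>2\<close> the operator \<open>b \<mapsto> (\<Sum>\<^sub>\<alpha> b(I\<^sub>\<alpha> _, I\<^sub>\<alpha> _))\<close> has the eigenvalues \<open>5\<close> and \<open>-3\<close>. It commutes with
  the action of each \<open>I\<^sub>\<gamma>\<close>, so that only the first basis vector has to be inspected.\<close>

lemma casimir_at_base: "std.casimir_at (bas 0)"
  unfolding std.casimir_at_def
proof (intro allI impI)
  fix b :: "oct \<times> oct \<Rightarrow> oct \<times> oct \<Rightarrow> real" and y
  assume b: "bilinear b" "\<forall>z. b z z = 0"
  let ?L = "\<lambda>x y. \<Sum>\<alpha>\<in>{1..9}. \<Sum>\<beta>\<in>{1..9}. b (std_I \<alpha> (std_I \<beta> x)) (std_I \<alpha> (std_I \<beta> y))"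
  let ?R = "\<lambda>x y. 2 * (\<Sum>\<alpha>\<in>{1..9}. b (std_I \<alpha> x) (std_I \<alpha> y)) + 15 * b x y"
  have bneg: "b (- x) y = - b x y" "b x (- y) = - b x y" for x y
    using b(1) by (simp_all add: bilinear_lneg bilinear_rneg)
  have z: "b z z = 0" for z using b(2) by blast
  have f: "b (bas k) (bas l) = - b (bas l) (bas k)" if "l < k" for k l
    using alternating_flip[OF b(1) z] by blast
  have s9: "sum F {1..9 :: nat} = F 1 + F 2 + F 3 + F 4 + F 5 + F 6 + F 7 + F 8 + F 9" for F :: "nat \<Rightarrow> real"
    by (simp add: eval_nat_numeral)
  have "?L (bas 0) = ?R (bas 0)"
  proof (rule linear_eq_stdbasis)
    show "?L (bas 0) v = ?R (bas 0) v" if "v \<in> Basis" for v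
      using that unfolding bas_eq_Basis[symmetric] indices_16
      by (elim insertE emptyE imageE; simp only: s9 std_I_bas std.S_neg bneg z minus_minus; simp add: f)
  qed (use std.bilinear_casimir[OF b(1)] in \<open>simp_all only: bilinear_def\<close>)
  then show "?L (bas 0) y = ?R (bas 0) y" by (rule fun_cong)
qed

text \<open>The Casimir relation travels from \<open>bas 0\<close> along these words. Later they
  prescribe the images of the basis at an arbitrary point.\<close>

lemma bas_reach:
  "bas 1 = std_I 1 (std_I 2 (bas 0))" "bas 2 = std_I 1 (std_I 3 (bas 0))"
  "bas 3 = std_I 1 (std_I 4 (bas 0))" "bas 4 = std_I 1 (std_I 5 (bas 0))"
  "bas 5 = std_I 1 (std_I 6 (bas 0))" "bas 6 = std_I 1 (std_I 7 (bas 0))"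
  "bas 7 = std_I 1 (std_I 8 (bas 0))" "bas 8 = std_I 1 (bas 0)" "bas 9 = std_I 2 (bas 0)"
  "bas 10 = std_I 3 (bas 0)" "bas 11 = std_I 4 (bas 0)" "bas 12 = std_I 5 (bas 0)"
  "bas 13 = std_I 6 (bas 0)" "bas 14 = std_I 7 (bas 0)" "bas 15 = std_I 8 (bas 0)"
  by (simp_all only: std_I_bas)

lemma casimir_std: "std.casimir_at x"
proof (rule std.casimir_at_all)
  fix v :: "oct \<times> oct" assume "v \<in> Basis"
  then show "std.casimir_at v"
    unfolding bas_eq_Basis[symmetric] indices_16
    by (elim insertE emptyE imageE)
      (simp_all only: bas_reach, (intro std.casimir_at_S casimir_at_base; simp)+)
qed

subsection \<open>Forms annihilated by the derivations\<close>

definition derivation :: "('v \<Rightarrow> 'v) \<Rightarrow> ('v list \<Rightarrow> real) \<Rightarrow> 'v list \<Rightarrow> real" where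
  "derivation T f v = (\<Sum>i<length v. f (v[i := T (v ! i)]))"

definition pair_sum :: "('v \<Rightarrow> 'v) \<Rightarrow> nat set \<Rightarrow> ('v list \<Rightarrow> real) \<Rightarrow> 'v list \<Rightarrow> real" where
  "pair_sum T K f v = (\<Sum>i\<in>K. \<Sum>j\<in>K - {i}. f (v[i := T (v ! i), j := T (v ! j)]))"

lemma bilinear_form_update:
  assumes f: "exterior_form f" and ij: "i < length v" "j < length v" "i \<noteq> j"
  shows "bilinear (\<lambda>x y. f (v[i := x, j := y]))" "f (v[i := x, j := x]) = 0"
proof -
  show "bilinear (\<lambda>x y. f (v[i := x, j := y]))"
    unfolding bilinear_def
  proof (intro conjI allI)
    fix y
    show "linear (\<lambda>x. f (v[i := x, j := y]))"
      using exterior_form_linear_update[OF f, of i "v[j := y]"] ij by (simp add: list_update_swap)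
  qed (use exterior_form_linear_update[OF f, of j] ij in simp)
  show "f (v[i := x, j := x]) = 0"
    using ij by (intro exterior_form_repeat[OF f, of i _ j]) auto
qed

lemma derivation_update:
  assumes "i < length v"
  shows "derivation T f (v[i := x]) = f (v[i := T x]) + (\<Sum>j\<in>{..<length v} - {i}. f (v[i := x, j := T (v ! j)]))"
  using assms by (simp add: derivation_def sum.remove[of _ i])

context clifford_system
begin

text \<open>The products of two different generators span the Lie algebra
  \<open>spin(9)\<close>.\<close>

definition spin_invariant :: "('v list \<Rightarrow> real) \<Rightarrow> bool" where
  "spin_invariant f \<longleftrightarrow> (\<forall>\<alpha>\<in>{1..9}. \<forall>\<beta>\<in>{1..9}. \<alpha> \<noteq> \<beta> \<longrightarrow> (\<forall>v. derivation (\<lambda>x. S \<alpha> (S \<beta> x)) f v = 0))"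

lemma spin_invariantD:
  "spin_invariant f \<Longrightarrow> \<alpha> \<in> {1..9} \<Longrightarrow> \<beta> \<in> {1..9} \<Longrightarrow> \<alpha> \<noteq> \<beta> \<Longrightarrow> derivation (\<lambda>x. S \<alpha> (S \<beta> x)) f v = 0"
  by (simp add: spin_invariant_def)

text \<open>Put \<open>J v_i\<close> for \<open>v_i\<close> in the equation
  \<open>derivation J f v = 0\<close>. The term at \<open>i\<close> becomes \<open>- f v\<close>, as
  \<open>J\<close> squares to \<open>-1\<close>, and the other terms form the row of the pair sum at
  \<open>i\<close>. Hence each row equals \<open>f v\<close>.\<close>

lemma pair_sum_rotation:
  fixes f :: "'v list \<Rightarrow> real"
  assumes f: "exterior_form f" "spin_invariant f"
    and ab: "\<alpha> \<in> {1..9}" "\<beta> \<in> {1..9}" "\<alpha> \<noteq> \<beta>"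
  shows "pair_sum (\<lambda>x. S \<alpha> (S \<beta> x)) {..<length v} f v = length v * f v"
proof -
  let ?J = "\<lambda>x. S \<alpha> (S \<beta> x)"
  have J: "?J (?J x) = - x" for x
    using S_anticommute[OF ab, of "S \<alpha> (S \<beta> x)"] ab by (simp add: S_sq S_neg)
  have "(\<Sum>j\<in>{..<length v} - {i}. f (v[i := ?J (v ! i), j := ?J (v ! j)])) = f v" if "i < length v" for i
    using derivation_update[OF that, of ?J f "?J (v ! i)"] spin_invariantD[OF f(2) ab]
      linear_neg[OF exterior_form_linear_update[OF f(1) that], of "v ! i"] that
    by (simp add: J)
  then show ?thesis by (simp add: pair_sum_def)
qed

text \<open>In any two fixed positions the form is bilinear and alternating, so the Casimir relation
  applies to it. The constant 15 is counted once for each ordered pair of positions.\<close>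

lemma pair_sum_casimir:
  assumes f: "exterior_form f" and c: "\<And>x. casimir_at x"
  shows "(\<Sum>\<alpha>\<in>{1..9}. \<Sum>\<beta>\<in>{1..9}. pair_sum (\<lambda>x. S \<alpha> (S \<beta> x)) {..<length v} f v)
    = 2 * (\<Sum>\<alpha>\<in>{1..9}. pair_sum (S \<alpha>) {..<length v} f v)
      + 15 * (real (length v) * (real (length v) - 1)) * f v"
proof -
  let ?K = "{..<length v}"
  let ?b = "\<lambda>i j x y. f (v[i := x, j := y])"
  have b: "(\<Sum>\<alpha>\<in>{1..9}. \<Sum>\<beta>\<in>{1..9}. ?b i j (S \<alpha> (S \<beta> (v ! i))) (S \<alpha> (S \<beta> (v ! j))))
      = 2 * (\<Sum>\<alpha>\<in>{1..9}. ?b i j (S \<alpha> (v ! i)) (S \<alpha> (v ! j))) + 15 * f v"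
    if "i \<in> ?K" "j \<in> ?K - {i}" for i j
    using c[of "v ! i"] bilinear_form_update[OF f, of i v j] that unfolding casimir_at_def
    by (auto dest!: spec[of _ "?b i j"])
  have "(\<Sum>\<alpha>\<in>{1..9}. \<Sum>\<beta>\<in>{1..9}. pair_sum (\<lambda>x. S \<alpha> (S \<beta> x)) ?K f v)
      = (\<Sum>i\<in>?K. \<Sum>j\<in>?K - {i}. \<Sum>\<alpha>\<in>{1..9}. \<Sum>\<beta>\<in>{1..9}. ?b i j (S \<alpha> (S \<beta> (v ! i))) (S \<alpha> (S \<beta> (v ! j))))"
    unfolding pair_sum_def
    by (simp only: sum.swap[of _ ?K "{1..9}"] sum.swap[of _ "?K - {_}" "{1..9}"])
  also have "\<dots> = (\<Sum>i\<in>?K. \<Sum>j\<in>?K - {i}. 2 * (\<Sum>\<alpha>\<in>{1..9}. ?b i j (S \<alpha> (v ! i)) (S \<alpha> (v ! j))) + 15 * f v)"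
    by (intro sum.cong refl b)
  also have "\<dots> = 2 * (\<Sum>i\<in>?K. \<Sum>j\<in>?K - {i}. \<Sum>\<alpha>\<in>{1..9}. ?b i j (S \<alpha> (v ! i)) (S \<alpha> (v ! j)))
      + (\<Sum>i\<in>?K. \<Sum>j\<in>?K - {i}. 15 * f v)"
    by (simp only: sum.distrib sum_distrib_left)
  also have "(\<Sum>i\<in>?K. \<Sum>j\<in>?K - {i}. \<Sum>\<alpha>\<in>{1..9}. ?b i j (S \<alpha> (v ! i)) (S \<alpha> (v ! j)))
      = (\<Sum>\<alpha>\<in>{1..9}. pair_sum (S \<alpha>) ?K f v)"
    unfolding pair_sum_def
    by (simp only: sum.swap[of _ ?K "{1..9}"] sum.swap[of _ "?K - {_}" "{1..9}"])
  also have "(\<Sum>i\<in>?K. \<Sum>j\<in>?K - {i}. 15 * f v) = 15 * (real (length v) * (real (length v) - 1)) * f v"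
    by (cases v) (simp_all add: algebra_simps)
  finally show ?thesis .
qed

text \<open>Invariance under \<open>S \<alpha> S 9\<close>, evaluated with
  \<open>S \<alpha> v_i\<close> in position \<open>i\<close>, gives the row sums of
  \<open>s j * a i j\<close>. The sum over positions of sign \<open>-1\<close> is expanded with the
  indicator \<open>(1 - s i) / 2\<close>.\<close>

lemma pair_sum_graded:
  assumes f: "exterior_form f" "spin_invariant f"
    and s: "\<And>i. i < length v \<Longrightarrow> S 9 (v ! i) = s i *\<^sub>R v ! i" "\<And>i. s i = 1 \<or> s i = (- 1 :: real)"
    and \<alpha>: "\<alpha> \<in> {1..8}"
  shows "pair_sum (S \<alpha>) {..<length v} f v = 4 * pair_sum (S \<alpha>) {i. i < length v \<and> s i = - 1} f v
    + (real (length v) - 4 * real (card {i. i < length v \<and> s i = - 1})) * f v"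
proof -
  let ?n = "length v"
  let ?K = "{..<?n}" and ?M = "{i. i < ?n \<and> s i = - 1}"
  define a where "a i j = f (v[i := S \<alpha> (v ! i), j := S \<alpha> (v ! j)])" for i j
  have a9: "\<alpha> \<in> {1..9}" "(9::nat) \<in> {1..9}" "\<alpha> \<noteq> 9" using \<alpha> by auto
  have row: "(\<Sum>j\<in>?K - {i}. s j * a i j) = s i * f v" if i: "i < ?n" for i
  proof -
    have "(\<Sum>j\<in>?K - {i}. f (v[i := S \<alpha> (v ! i), j := S \<alpha> (S 9 (v ! j))])) = (\<Sum>j\<in>?K - {i}. s j * a i j)"
    proof (intro sum.cong refl)
      fix j assume j: "j \<in> ?K - {i}"
      have "S \<alpha> (S 9 (v ! j)) = s j *\<^sub>R S \<alpha> (v ! j)"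
        using s(1)[of j] j linear_cmul[OF linear_S] by simp
      moreover have "f (v[i := S \<alpha> (v ! i), j := c *\<^sub>R x]) = c * f (v[i := S \<alpha> (v ! i), j := x])" for c x
        using linear_cmul[OF exterior_form_linear_update[OF f(1), of j "v[i := S \<alpha> (v ! i)]"], of c x] j by simp
      ultimately show "f (v[i := S \<alpha> (v ! i), j := S \<alpha> (S 9 (v ! j))]) = s j * a i j"
        by (simp add: a_def)
    qed
    moreover have "f (v[i := S \<alpha> (S 9 (S \<alpha> (v ! i)))]) = - s i * f v"
    proof -
      have "S \<alpha> (S 9 (S \<alpha> (v ! i))) = - S 9 (S \<alpha> (S \<alpha> (v ! i)))"
        by (rule S_anticommute[OF a9])
      also have "\<dots> = (- s i) *\<^sub>R v ! i" using S_sq[OF a9(1)] s(1)[OF i] by simp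
      finally show ?thesis
        using linear_cmul[OF exterior_form_linear_update[OF f(1) i], of "- s i" "v ! i"] i by simp
    qed
    ultimately show ?thesis
      using derivation_update[OF i, of "\<lambda>x. S \<alpha> (S 9 x)" f "S \<alpha> (v ! i)"] spin_invariantD[OF f(2) a9]
      by simp
  qed
  have sym: "a i j = a j i" if "j \<noteq> i" for i j
    using that by (simp add: a_def list_update_swap)
  have ss: "s i * s i = 1" for i using s(2)[of i] by auto
  have 1: "(\<Sum>i\<in>?K. \<Sum>j\<in>?K - {i}. s j * a i j) = (\<Sum>i\<in>?K. s i) * f v"
    by (simp add: row sum_distrib_right)
  have sw: "(\<Sum>i\<in>?K. \<Sum>j\<in>?K - {i}. F i j) = (\<Sum>i\<in>?K. \<Sum>j\<in>?K - {i}. F j i)" for F :: "nat \<Rightarrow> nat \<Rightarrow> real"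
  proof -
    have "(\<Sum>i\<in>?K. \<Sum>j\<in>?K - {i}. G i j) = (\<Sum>i\<in>?K. \<Sum>j\<in>?K. if i = j then 0 else G i j)"
      for G :: "nat \<Rightarrow> nat \<Rightarrow> real"
      by (intro sum.cong refl sum.mono_neutral_cong_left) auto
    then show ?thesis using sum.swap[of "\<lambda>i j. if i = j then 0 else F i j" ?K ?K]
      by (simp add: eq_commute)
  qed
  have 2: "(\<Sum>i\<in>?K. \<Sum>j\<in>?K - {i}. s i * a i j) = (\<Sum>i\<in>?K. s i) * f v"
    unfolding 1[symmetric] by (subst sw) (intro sum.cong refl, simp add: sym)
  have 3: "(\<Sum>i\<in>?K. \<Sum>j\<in>?K - {i}. s i * s j * a i j) = ?n * f v"
    by (simp add: row sum_distrib_left[symmetric] mult.assoc) (simp add: ss mult.assoc[symmetric])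
  have M: "?M \<subseteq> ?K" by auto
  have ind: "(1 - s i) = (if i \<in> ?M then 2 else 0)" if "i \<in> ?K" for i
    using s(2)[of i] that by auto
  have "pair_sum (S \<alpha>) ?M f v = (\<Sum>i\<in>?K. \<Sum>j\<in>?K - {i}. (1 - s i) / 2 * ((1 - s j) / 2) * a i j)"
    unfolding pair_sum_def a_def[symmetric]
    by (intro sum.mono_neutral_cong_left) (use M ind in \<open>auto intro!: sum.neutral sum.mono_neutral_cong_left\<close>)
  also have "\<dots> = (\<Sum>i\<in>?K. \<Sum>j\<in>?K - {i}. (a i j - s i * a i j - s j * a i j + s i * s j * a i j) / 4)"
    by (intro sum.cong refl) (simp add: field_simps)
  also have "4 * \<dots> = pair_sum (S \<alpha>) ?K f v - 2 * (\<Sum>i\<in>?K. s i) * f v + ?n * f v"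
    unfolding pair_sum_def a_def[symmetric]
    by (simp only: sum_divide_distrib[symmetric] sum.distrib sum_subtractf 1 2 3) simp
  finally have "4 * pair_sum (S \<alpha>) ?M f v = pair_sum (S \<alpha>) ?K f v - 2 * (\<Sum>i\<in>?K. s i) * f v + ?n * f v" .
  moreover have "(\<Sum>i\<in>?K. s i) = ?n - 2 * real (card ?M)"
  proof -
    have "(\<Sum>i\<in>?K. 1 - s i) = (\<Sum>i\<in>?M. 2)"
      using ind by (intro sum.mono_neutral_cong_right) auto
    then show ?thesis by (simp add: sum_subtractf)
  qed
  ultimately show ?thesis by (simp add: algebra_simps)
qed

text \<open>The double sum over \<open>\<alpha>\<close> and \<open>\<beta>\<close> is known: the 9
  diagonal pairs contribute \<open>n (n - 1) f v\<close> each, the 72 others \<open>n f v\<close>.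
  The Casimir relation expresses it by the pair sums of single generators, among which
  \<open>S 9\<close> gives \<open>((n - 2 q)^2 - n) f v\<close>; solving for the rest yields the
  factor. For \<open>n = 8\<close> it is \<open>q (16 - q)\<close>.\<close>

lemma graded_recursion:
  assumes f: "exterior_form f" "spin_invariant f" and c: "\<And>x. casimir_at x"
    and s: "\<And>i. i < length v \<Longrightarrow> S 9 (v ! i) = s i *\<^sub>R v ! i" "\<And>i. s i = 1 \<or> s i = (- 1 :: real)"
    and n: "n = real (length v)" and q: "q = real (card {i. i < length v \<and> s i = - 1})"
  shows "(\<Sum>\<alpha>\<in>{1..8}. pair_sum (S \<alpha>) {i. i < length v \<and> s i = - 1} f v)
    = (8 * n - n\<^sup>2 + 8 * q + n * q - q\<^sup>2) * f v"
proof -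
  let ?K = "{..<length v}" and ?M = "{i. i < length v \<and> s i = - 1}"
  have nn: "(\<Sum>i\<in>?K. \<Sum>j\<in>?K - {i}. c) = n * (n - 1) * c" for c
    unfolding n by (cases v) (simp_all add: algebra_simps)
  have d: "pair_sum (\<lambda>x. S \<alpha> (S \<beta> x)) ?K f v = (if \<alpha> = \<beta> then n * (n - 1) * f v else n * f v)"
    if "\<alpha> \<in> {1..9}" "\<beta> \<in> {1..9}" for \<alpha> \<beta>
    using that pair_sum_rotation[OF f that, of v] n
    by (auto simp: pair_sum_def S_sq nn simp del: sum_constant)
  have "(\<Sum>\<alpha>\<in>{1..9}. \<Sum>\<beta>\<in>{1..9}. pair_sum (\<lambda>x. S \<alpha> (S \<beta> x)) ?K f v)
      = (\<Sum>\<alpha>\<in>{1..9 :: nat}. \<Sum>\<beta>\<in>{1..9 :: nat}. n * f v + (if \<alpha> = \<beta> then n * (n - 2) * f v else 0))"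
    by (intro sum.cong refl) (simp add: d algebra_simps)
  also have "\<dots> = 81 * n * f v + 9 * (n * (n - 2) * f v)"
    by (simp add: sum.distrib)
  finally have A: "(\<Sum>\<alpha>\<in>{1..9}. \<Sum>\<beta>\<in>{1..9}. pair_sum (\<lambda>x. S \<alpha> (S \<beta> x)) ?K f v) = \<dots>" .
  have ss: "s i * s i = 1" for i using s(2)[of i] by auto
  have sums: "(\<Sum>i\<in>?K. s i) = n - 2 * q"
  proof -
    have "(\<Sum>i\<in>?K. 1 - s i) = (\<Sum>i\<in>?M. 2)"
      using s(2) by (intro sum.mono_neutral_cong_right) force+
    then show ?thesis by (simp add: sum_subtractf n q)
  qed
  have "pair_sum (S 9) ?K f v = (\<Sum>i\<in>?K. \<Sum>j\<in>?K - {i}. s i * s j * f v)"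
    unfolding pair_sum_def
  proof (intro sum.cong refl)
    fix i j assume i: "i \<in> ?K" and j: "j \<in> ?K - {i}"
    have "f (v[i := S 9 (v ! i), j := S 9 (v ! j)]) = s j * f (v[i := s i *\<^sub>R v ! i, j := v ! j])"
      using linear_cmul[OF exterior_form_linear_update[OF f(1), of j "v[i := s i *\<^sub>R v ! i]"], of "s j" "v ! j"]
        i j s(1) by simp
    also have "v[i := s i *\<^sub>R v ! i, j := v ! j] = v[i := s i *\<^sub>R v ! i]"
      using j by (metis DiffD2 insertI1 list_update_id list_update_swap)
    also have "f \<dots> = s i * f v"
      using linear_cmul[OF exterior_form_linear_update[OF f(1), of i v], of "s i" "v ! i"] i by simp
    finally show "f (v[i := S 9 (v ! i), j := S 9 (v ! j)]) = s i * s j * f v" by simp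
  qed
  also have "\<dots> = (\<Sum>i\<in>?K. s i * ((n - 2 * q) - s i) * f v)"
    by (intro sum.cong refl) (simp add: sum_distrib_left[symmetric] sum_distrib_right[symmetric] sum_diff1 sums)
  also have "\<dots> = ((n - 2 * q)\<^sup>2 - n) * f v"
    by (simp add: right_diff_distrib ss sum_subtractf sum_distrib_right[symmetric] sums n power2_eq_square)
  finally have B: "pair_sum (S 9) ?K f v = ((n - 2 * q)\<^sup>2 - n) * f v" .
  have "{1..9} = insert 9 {1..8 :: nat}" by auto
  then have "(\<Sum>\<alpha>\<in>{1..9}. pair_sum (S \<alpha>) ?K f v) = ((n - 2 * q)\<^sup>2 - n) * f v
      + (\<Sum>\<alpha>\<in>{1..8}. 4 * pair_sum (S \<alpha>) ?M f v + (n - 4 * q) * f v)"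
    using pair_sum_graded[OF f s] B by (simp add: n q)
  also have "\<dots> = ((n - 2 * q)\<^sup>2 - n) * f v + 4 * (\<Sum>\<alpha>\<in>{1..8}. pair_sum (S \<alpha>) ?M f v) + 8 * (n - 4 * q) * f v"
    by (simp add: sum.distrib sum_distrib_left)
  finally show ?thesis
    using pair_sum_casimir[OF f(1) c, of v] A by (simp add: n[symmetric] algebra_simps power2_eq_square)
qed

end

subsection \<open>Coefficients of characteristic polynomials\<close>

text \<open>Substituting \<open>c t\<close> for \<open>t\<close> in \<open>det (t I - c A)\<close>
  pulls \<open>c\<close> out of all \<open>n\<close> rows. Powers of \<open>c\<close> stay on both
  sides because the ring may not allow division by them.\<close>

lemma coeff_char_poly_smult:
  fixes A :: "'a :: comm_ring_1 mat"
  assumes A: "A \<in> carrier_mat n n"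
  shows "c ^ k * coeff (char_poly (c \<cdot>\<^sub>m A)) k = c ^ n * coeff (char_poly A) k"
proof -
  have h: "comm_ring_hom (\<lambda>p. pcompose p [:0, c:])"
    by unfold_locales (auto simp: pcompose_add pcompose_mult)
  have "map_mat (\<lambda>p. pcompose p [:0, c:]) (char_poly_matrix (c \<cdot>\<^sub>m A)) = [:c:] \<cdot>\<^sub>m char_poly_matrix A"
    using A by (intro eq_matI) (auto simp: char_poly_matrix_def pcompose_pCons)
  then have "pcompose (char_poly (c \<cdot>\<^sub>m A)) [:0, c:] = Determinant.det ([:c:] \<cdot>\<^sub>m char_poly_matrix A)"
    unfolding char_poly_def comm_ring_hom.hom_det[OF h, symmetric] by simp
  also have "\<dots> = [:c:] ^ n * char_poly A"
    using char_poly_matrix_closed[OF A] by (simp only: det_smult char_poly_def carrier_matD)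
  finally have "coeff (pcompose (char_poly (c \<cdot>\<^sub>m A)) [:0, c:]) k = coeff ([:c ^ n:] * char_poly A) k"
    by (simp add: poly_const_pow)
  then show ?thesis by (simp add: coeff_pcompose_linear)
qed

definition euler :: "'a::comm_ring_1 poly \<Rightarrow> 'a poly" where
  "euler p = (\<Sum>i\<le>degree p. monom (of_nat i * coeff p i) i)"

lemma coeff_euler: "coeff (euler p) n = of_nat n * coeff p n"
proof -
  have "coeff (euler p) n = (\<Sum>i\<le>degree p. if i = n then of_nat i * coeff p i else 0)"
    unfolding euler_def coeff_sum by (intro sum.cong) (auto simp: coeff_monom)
  also have "\<dots> = of_nat n * coeff p n"
    by (auto simp: coeff_eq_0)
  finally show ?thesis .
qed

lemma euler_mult: "euler (p * q) = euler p * q + p * euler q"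
proof (rule poly_eqI)
  fix n
  have "coeff (euler (p * q)) n = (\<Sum>i\<le>n. of_nat (i + (n - i)) * (coeff p i * coeff q (n - i)))"
    unfolding coeff_euler coeff_mult sum_distrib_left by (intro sum.cong) auto
  also have "\<dots> = coeff (euler p * q + p * euler q) n"
    unfolding coeff_add coeff_mult coeff_euler sum.distrib[symmetric]
    by (intro sum.cong) (auto simp: algebra_simps simp del: le_add_diff_inverse le_add_diff_inverse2)
  finally show "coeff (euler (p * q)) n = coeff (euler p * q + p * euler q) n" .
qed

lemma euler_add: "euler (p + q) = euler p + euler q"
  by (rule poly_eqI) (simp add: coeff_euler algebra_simps)

lemma euler_minus: "euler (- p) = - euler p"
  by (rule poly_eqI) (simp add: coeff_euler)

lemma euler_0: "euler 0 = 0" and euler_1: "euler 1 = 0"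
  by (rule poly_eqI; simp add: coeff_euler)+

lemma euler_sum: "euler (sum f S) = (\<Sum>i\<in>S. euler (f i))"
  by (induction S rule: infinite_finite_induct) (simp_all add: euler_add euler_0)

lemma euler_prod: "finite S \<Longrightarrow> euler (prod f S) = (\<Sum>a\<in>S. euler (f a) * prod f (S - {a}))"
proof (induction S rule: finite_induct)
  case (insert x S)
  have "(\<Sum>a\<in>S. euler (f a) * prod f (insert x S - {a})) = (\<Sum>a\<in>S. f x * (euler (f a) * prod f (S - {a})))"
  proof (intro sum.cong refl)
    fix a assume a: "a \<in> S"
    then have "insert x S - {a} = insert x (S - {a})" using insert.hyps by auto
    then show "euler (f a) * prod f (insert x S - {a}) = f x * (euler (f a) * prod f (S - {a}))"
      using insert.hyps by (simp add: algebra_simps)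
  qed
  then show ?case
    using insert by (simp add: euler_mult sum_distrib_left)
qed (simp add: euler_1)

text \<open>Euler's operator \<open>t d/dt\<close> differentiates \<open>det(tI - A)\<close> row by row; this is the polynomial identity
  \<open>p' = tr adj(tI - A)\<close>, over a ring that may have zero divisors.\<close>

lemma euler_char_poly:
  fixes A :: "'a :: comm_ring_1 mat"
  assumes A: "A \<in> carrier_mat n n"
  shows "euler (char_poly A) = (\<Sum>a<n. [:0, 1:] * adj_mat (char_poly_matrix A) $$ (a, a))"
proof -
  define M where "M = char_poly_matrix A"
  have M: "M \<in> carrier_mat n n" using A by (simp add: M_def)
  \<comment> \<open>Row \<open>a\<close> is differentiated: \<open>t d/dt\<close> leaves only
    \<open>t\<close> on the diagonal, so expansion along this row gives \<open>t\<close> times a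
    cofactor.\<close>
  define N where "N a = Matrix.mat n n (\<lambda>(i, j). if i = a then euler (M $$ (a, j)) else M $$ (i, j))" for a
  have N: "N a \<in> carrier_mat n n" for a by (simp add: N_def)
  have E: "euler (M $$ (a, j)) = (if a = j then [:0, 1:] else 0)" if "a < n" "j < n" for a j
    using A that by (intro poly_eqI)
      (auto simp: M_def char_poly_matrix_def coeff_euler coeff_pCons split: nat.splits)
  have sgn: "euler (of_int (sign p) * q) = of_int (sign p) * euler q" for p :: "nat \<Rightarrow> nat" and q :: "'a poly"
    by (cases p rule: sign_cases) (simp_all add: euler_minus)
  have row: "(\<Sum>p | p permutes {0..<n}. of_int (sign p) * (euler (M $$ (a, p a)) * (\<Prod>i\<in>{0..<n} - {a}. M $$ (i, p i))))
      = [:0, 1:] * cofactor M a a" if a: "a < n" for a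
  proof -
    have "(\<Sum>p | p permutes {0..<n}. of_int (sign p) * (euler (M $$ (a, p a)) * (\<Prod>i\<in>{0..<n} - {a}. M $$ (i, p i))))
        = Determinant.det (N a)"
      unfolding det_def'[OF N]
    proof (intro sum.cong refl arg_cong2[of _ _ _ _ "(*)"])
      fix p assume "p \<in> {p. p permutes {0..<n}}"
      then have p: "p i < n" if "i < n" for i
        using that permutes_in_image[of p "{0..<n}" i] by auto
      have "(\<Prod>i = 0..<n. N a $$ (i, p i)) = N a $$ (a, p a) * (\<Prod>i\<in>{0..<n} - {a}. N a $$ (i, p i))"
        using a by (simp add: prod.remove[of _ a])
      also have "(\<Prod>i\<in>{0..<n} - {a}. N a $$ (i, p i)) = (\<Prod>i\<in>{0..<n} - {a}. M $$ (i, p i))"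
        using p by (intro prod.cong) (auto simp: N_def)
      finally show "euler (M $$ (a, p a)) * (\<Prod>i\<in>{0..<n} - {a}. M $$ (i, p i)) = (\<Prod>i = 0..<n. N a $$ (i, p i))"
        using a p by (simp add: N_def)
    qed
    also have "\<dots> = (\<Sum>j<n. if j = a then [:0, 1:] * cofactor (N a) a j else 0)"
      unfolding laplace_expansion_row[OF N a] using a by (intro sum.cong) (auto simp: N_def E)
    also have "\<dots> = [:0, 1:] * cofactor (N a) a a" using a by simp
    also have "mat_delete (N a) a a = mat_delete M a a"
      using M by (intro eq_matI) (auto simp: N_def mat_delete_def)
    then have "cofactor (N a) a a = cofactor M a a" by (simp add: cofactor_def)
    finally show ?thesis .
  qed
  have "euler (char_poly A) = (\<Sum>p | p permutes {0..<n}. \<Sum>a\<in>{0..<n}.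
      of_int (sign p) * (euler (M $$ (a, p a)) * (\<Prod>i\<in>{0..<n} - {a}. M $$ (i, p i))))"
    unfolding char_poly_def M_def[symmetric] det_def'[OF M]
    by (simp add: euler_sum sgn euler_prod sum_distrib_left)
  also have "\<dots> = (\<Sum>a\<in>{0..<n}. [:0, 1:] * cofactor M a a)"
    by (subst sum.swap) (intro sum.cong refl row, simp)
  also have "\<dots> = (\<Sum>a<n. [:0, 1:] * adj_mat M $$ (a, a))"
    using M by (intro sum.cong) (auto simp: adj_mat_def)
  finally show ?thesis by (simp add: M_def)
qed

text \<open>The recursion of Faddeev and LeVerrier: compare coefficients of \<open>t^(k+1)\<close>
  in \<open>(t I - A) adj (t I - A) = det (t I - A) I\<close>.\<close>

lemma adjugate_recursion:
  fixes A :: "'a :: comm_ring_1 mat"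
  assumes A: "A \<in> carrier_mat n n" and ij: "i < n" "j < n"
  defines "B \<equiv> \<lambda>k i j. coeff (adj_mat (char_poly_matrix A) $$ (i, j)) k"
  shows "B k i j = (\<Sum>l<n. A $$ (i, l) * B (Suc k) l j) + (if i = j then coeff (char_poly A) (Suc k) else 0)"
proof -
  let ?M = "char_poly_matrix A"
  have M: "?M \<in> carrier_mat n n" using A by simp
  have "(?M * adj_mat ?M) $$ (i, j) = (\<Sum>l<n. ?M $$ (i, l) * adj_mat ?M $$ (l, j))"
    using M adj_mat(1)[OF M] ij by (auto simp: scalar_prod_def intro!: sum.cong)
  also have "\<dots> = (\<Sum>l<n. (if i = l then [:0, 1:] * adj_mat ?M $$ (l, j) else 0) - [:A $$ (i, l):] * adj_mat ?M $$ (l, j))"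
    using A ij by (intro sum.cong) (auto simp: char_poly_matrix_def algebra_simps)
  also have "\<dots> = [:0, 1:] * adj_mat ?M $$ (i, j) - (\<Sum>l<n. [:A $$ (i, l):] * adj_mat ?M $$ (l, j))"
    using ij by (simp add: sum_subtractf)
  finally have "coeff ((?M * adj_mat ?M) $$ (i, j)) (Suc k) = B k i j - (\<Sum>l<n. A $$ (i, l) * B (Suc k) l j)"
    by (simp add: B_def coeff_sum)
  moreover have "(?M * adj_mat ?M) $$ (i, j) = (if i = j then char_poly A else 0)"
    using ij A by (simp add: adj_mat(2)[OF M] char_poly_def)
  ultimately show ?thesis by (auto simp: algebra_simps)
qed

text \<open>From a common degree bound \<open>K\<close> of all entries the recursion descends to
  \<open>n\<close>, since the characteristic polynomial has no coefficients beyond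
  \<open>n\<close>.\<close>

lemma adjugate_coeff_above:
  fixes A :: "'a :: comm_ring_1 mat"
  assumes A: "A \<in> carrier_mat n n" and ij: "i < n" "j < n" and k: "n \<le> k"
  shows "coeff (adj_mat (char_poly_matrix A) $$ (i, j)) k = 0"
proof -
  define B where "B = (\<lambda>k i j. coeff (adj_mat (char_poly_matrix A) $$ (i, j)) k)"
  define K where "K = Suc (Max ((\<lambda>(i, j). degree (adj_mat (char_poly_matrix A) $$ (i, j))) ` ({..<n} \<times> {..<n})))"
  have top: "B l i j = 0" if "i < n" "j < n" "K \<le> l" for l i j
  proof -
    have "degree (adj_mat (char_poly_matrix A) $$ (i, j)) < K"
      unfolding K_def using that by (intro le_imp_less_Suc Max_ge) auto
    with that show ?thesis by (simp add: B_def coeff_eq_0)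
  qed
  have p: "coeff (char_poly A) (Suc l) = 0" if "n \<le> l" for l
    using degree_monic_char_poly[OF A] that by (intro coeff_eq_0) simp
  have "\<forall>i<n. \<forall>j<n. B (K - d) i j = 0" if "n \<le> K - d" for d
    using that
  proof (induction d)
    case (Suc d)
    show ?case
    proof (cases "K - Suc d = K - d")
      case False
      then have e: "Suc (K - Suc d) = K - d" by auto
      have "\<forall>i<n. \<forall>j<n. B (K - d) i j = 0" using Suc.IH Suc.prems by simp
      then show ?thesis
        using adjugate_recursion[OF A, of _ _ "K - Suc d"] p[OF Suc.prems] unfolding e by (auto simp: B_def)
    qed (use Suc in auto)
  qed (use top in auto)
  from this[of "K - k"] top[of i j k] ij k show ?thesis
    unfolding B_def by (cases "K \<le> k") auto
qed

text \<open>Newton's identity without division. The coefficients of the adjugate in degrees 8 to 4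
  are \<open>I\<close>, \<open>A\<close>, \<open>A^2\<close>, \<open>A^3\<close> and
  \<open>A^4 + c I\<close>, with \<open>c\<close> the coefficient of \<open>t^5\<close>. By Euler's
  operator the last has trace \<open>5 c\<close>, so \<open>tr A^4 = 5 c - 9 c\<close>.\<close>

lemma coeff_char_poly_trace:
  fixes A :: "'a :: comm_ring_1 mat"
  assumes A: "A \<in> carrier_mat 9 9"
    and z: "coeff (char_poly A) 8 = 0" "coeff (char_poly A) 7 = 0" "coeff (char_poly A) 6 = 0"
  shows "- 4 * coeff (char_poly A) 5
    = (\<Sum>a<9. \<Sum>b<9. A $$ (a, b) * (\<Sum>c<9. A $$ (b, c) * (\<Sum>d<9. A $$ (c, d) * A $$ (d, a))))"
proof -
  define B where "B = (\<lambda>k i j. coeff (adj_mat (char_poly_matrix A) $$ (i, j)) k)"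
  have rec: "B k i j = (\<Sum>l<9. A $$ (i, l) * B (Suc k) l j) + (if i = j then coeff (char_poly A) (Suc k) else 0)"
    if "i < 9" "j < 9" for i j k
    unfolding B_def by (rule adjugate_recursion[OF A that])
  have B9: "B 9 i j = 0" if "i < 9" "j < 9" for i j
    unfolding B_def by (rule adjugate_coeff_above[OF A that]) simp
  have B8: "B 8 i j = (if i = j then 1 else 0)" if "i < 9" "j < 9" for i j
    using rec[OF that, of 8] degree_monic_char_poly[OF A] that by (simp add: B9)
  have B7: "B 7 i j = A $$ (i, j)" if "i < 9" "j < 9" for i j
    using rec[OF that, of 7] that z by (simp add: B8 if_distrib cong: if_cong)
  have B6: "B 6 i j = (\<Sum>d<9. A $$ (i, d) * A $$ (d, j))" if "i < 9" "j < 9" for i j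
    using rec[OF that, of 6] that z by (simp add: B7)
  have B5: "B 5 i j = (\<Sum>c<9. A $$ (i, c) * (\<Sum>d<9. A $$ (c, d) * A $$ (d, j)))" if "i < 9" "j < 9" for i j
    using rec[OF that, of 5] that z by (simp add: B6)
  have B4: "B 4 i i = (\<Sum>b<9. A $$ (i, b) * (\<Sum>c<9. A $$ (b, c) * (\<Sum>d<9. A $$ (c, d) * A $$ (d, i))))
      + coeff (char_poly A) 5" if "i < 9" for i
    using rec[OF that that, of 4] that by (simp add: B5)
  have "5 * coeff (char_poly A) 5 = (\<Sum>a<9. B 4 a a)"
    using arg_cong[OF euler_char_poly[OF A], of "\<lambda>p. coeff p 5"]
    by (simp add: coeff_euler coeff_sum B_def coeff_pCons eval_nat_numeral)
  then show ?thesis by (simp add: B4 sum.distrib eq_neg_iff_add_eq_0 neg_eq_iff_add_eq_0)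
qed

section \<open>Conjugation, inner products and composition for quaternions and octonions\<close>

lemma quat_cases:
  obtains a0 a1 a2 a3 where "x = ((a0, a1, a2, a3) :: quat)"
  by (metis surj_pair)

lemma qmul_add: "qmul (a + b) c = qmul a c + qmul b c" "qmul a (b + c) = qmul a b + qmul a c"
  by (cases a rule: quat_cases; cases b rule: quat_cases; cases c rule: quat_cases; simp add: algebra_simps)+

lemma qmul_minus: "qmul (- a) b = - qmul a b" "qmul a (- b) = - qmul a b"
  by (cases a rule: quat_cases; cases b rule: quat_cases; simp)+

lemma qmul_diff: "qmul (a - b) c = qmul a c - qmul b c" "qmul a (b - c) = qmul a b - qmul a c"
  using qmul_add(1)[of a "- b" c] qmul_add(2)[of a b "- c"] by (simp_all add: qmul_minus)

lemma qmul_assoc: "qmul (qmul a b) c = qmul a (qmul b c)"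
  by (cases a rule: quat_cases; cases b rule: quat_cases; cases c rule: quat_cases) (simp add: algebra_simps)

lemma qcnj_qmul: "qcnj (qmul a b) = qmul (qcnj b) (qcnj a)"
  by (cases a rule: quat_cases; cases b rule: quat_cases) (simp add: algebra_simps)

lemma qcnj_add: "qcnj (a + b) = qcnj a + qcnj b"
  and qcnj_diff: "qcnj (a - b) = qcnj a - qcnj b"
  by (cases a rule: quat_cases; cases b rule: quat_cases; simp)+

lemma qcnj_qcnj: "qcnj (qcnj a) = a" and qcnj_minus: "qcnj (- a) = - qcnj a"
  by (cases a rule: quat_cases; simp)+

lemma qcnj_inner: "inner (qcnj a) (qcnj b) = inner a b"
  by (cases a rule: quat_cases; cases b rule: quat_cases) (simp add: inner_prod_def)

lemma qmul_qcnj: "qmul (qcnj a) (qmul a b) = inner a a *\<^sub>R b" "qmul a (qmul (qcnj a) b) = inner a a *\<^sub>R b"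
  "qmul b (qmul a (qcnj a)) = inner a a *\<^sub>R b" "qmul b (qmul (qcnj a) a) = inner a a *\<^sub>R b"
  by (cases a rule: quat_cases; cases b rule: quat_cases; simp add: inner_prod_def algebra_simps)+

lemma inner_qmul_left: "inner (qmul a b) c = inner a (qmul c (qcnj b))"
  and inner_qmul_right: "inner (qmul a b) c = inner b (qmul (qcnj a) c)"
  by (cases a rule: quat_cases; cases b rule: quat_cases; cases c rule: quat_cases;
      simp add: inner_prod_def algebra_simps)+

lemma inner_omul_left: "inner (omul x y) z = inner x (omul z (ocnj y))"
proof -
  obtain h1 h2 k1 k2 z1 z2 where e: "x = (h1, h2)" "y = (k1, k2)" "z = (z1, z2)"
    by (metis surj_pair)
  have "inner (qmul (qcnj k2) h2) z1 = inner h2 (qmul k2 z1)"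
    using inner_qmul_right[of "qcnj k2" h2 z1] by (simp add: qcnj_qcnj)
  moreover have "inner (qmul k2 h1) z2 = inner h1 (qmul (qcnj k2) z2)"
    by (rule inner_qmul_right)
  moreover have "inner (qmul h1 k1) z1 = inner h1 (qmul z1 (qcnj k1))" by (rule inner_qmul_left)
  moreover have "inner (qmul h2 (qcnj k1)) z2 = inner h2 (qmul z2 k1)"
    using inner_qmul_left[of h2 "qcnj k1" z2] by (simp add: qcnj_qcnj)
  ultimately show ?thesis
    unfolding e
    by (simp add: inner_Pair inner_diff_left inner_diff_right inner_add_left inner_add_right
        qmul_minus qcnj_qcnj qcnj_minus)
qed

lemma inner_omul_right: "inner (omul x y) z = inner y (omul (ocnj x) z)"
proof -
  obtain h1 h2 k1 k2 z1 z2 where e: "x = (h1, h2)" "y = (k1, k2)" "z = (z1, z2)"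
    by (metis surj_pair)
  have "inner (qmul h1 k1) z1 = inner k1 (qmul (qcnj h1) z1)" by (rule inner_qmul_right)
  moreover have "inner (qmul h2 (qcnj k1)) z2 = inner k1 (qmul (qcnj z2) h2)"
    using inner_qmul_right[of h2 "qcnj k1" z2] qcnj_inner[of k1 "qmul (qcnj z2) h2"]
    by (simp add: qcnj_qmul qcnj_qcnj)
  moreover have "inner (qmul (qcnj k2) h2) z1 = inner k2 (qmul h2 (qcnj z1))"
    using inner_qmul_left[of "qcnj k2" h2 z1] qcnj_inner[of k2 "qmul h2 (qcnj z1)"]
    by (simp add: qcnj_qmul qcnj_qcnj)
  moreover have "inner (qmul k2 h1) z2 = inner k2 (qmul z2 (qcnj h1))" by (rule inner_qmul_left)
  ultimately show ?thesis
    unfolding e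
    by (simp add: inner_Pair inner_diff_left inner_diff_right inner_add_left inner_add_right
        qmul_minus qcnj_qcnj qcnj_minus)
qed

text \<open>Splitting into pairs of quaternions replaces the missing associativity: the components
  associate, and a factor next to its conjugate collapses to a squared norm.\<close>

lemma omul_ocnj_cancel: "omul (ocnj x) (omul x y) = inner x x *\<^sub>R y"
proof -
  obtain h1 h2 k1 k2 where e: "x = (h1, h2)" "y = (k1, k2)"
    by (metis surj_pair)
  show ?thesis
    unfolding e
    by (simp add: inner_Pair qmul_minus qcnj_qcnj qcnj_minus qcnj_add qcnj_diff qcnj_qmul qmul_add
        qmul_diff qmul_qcnj qmul_assoc scaleR_add_left)
qed

lemma ocnj_ocnj: "ocnj (ocnj x) = x"
  by (cases x rule: oct_cases) simp

lemma linear_ocnj: "linear ocnj"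
  by (rule linearI; (cases rule: oct_cases[case_names x])?) (auto simp: prod_eq_iff)

lemma ocnj_inner: "inner (ocnj x) (ocnj y) = inner x y"
  by (cases x rule: oct_cases; cases y rule: oct_cases) (simp add: inner_prod_def)

lemma std_I_self_adjoint:
  assumes "\<alpha> \<in> {1..9}"
  shows "inner (std_I \<alpha> v) w = inner v (std_I \<alpha> w)"
proof -
  obtain x y x' y' where vw: "v = (x, y)" "w = (x', y')" by (metis surj_pair)
  consider "\<alpha> = 1" | "\<alpha> = 9" | "\<alpha> \<in> {2, 3, 4, 5, 6, 7, 8}"
    using assms unfolding indices_9 by blast
  then show ?thesis
  proof cases
    case 3
    let ?u = "oct_basis ! (\<alpha> - 1)"
    \<comment> \<open>Multiplication by an imaginary unit is skew, which matches the opposite signs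
      of the two off-diagonal blocks.\<close>
    have "ocnj ?u = - ?u" using 3 by (auto simp: oct_basis_def zero_prod_def)
    then have "inner (omul a ?u) b = - inner a (omul b ?u)" for a b
      by (simp add: inner_omul_left linear_neg[OF linear_omul_right])
    moreover have "std_I \<alpha> = (\<lambda>(x, y). (- omul y ?u, omul x ?u))" using 3 by (auto simp: std_I_def)
    ultimately show ?thesis by (simp add: vw inner_Pair)
  qed (simp_all add: vw std_I_def inner_Pair add.commute)
qed

subsection \<open>Kaehler matrices and changes of frame\<close>

locale spin9_point =
  fixes G :: "'v::real_normed_vector \<Rightarrow> 'v \<Rightarrow> real" and J :: "nat \<Rightarrow> 'v \<Rightarrow>\<^sub>L 'v"
  assumes bilinear_G: "bilinear G" and G_sym: "G x y = G y x" and system: "spin9_system G J"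
begin

lemma J_sq: "\<alpha> \<in> {1..9} \<Longrightarrow> J \<alpha> (J \<alpha> x) = x"
  using system by (metis blinfun_apply_blinfun_compose blinfun_apply_id_blinfun id_apply spin9_system_def)

lemma J_self_adjoint: "\<alpha> \<in> {1..9} \<Longrightarrow> G (J \<alpha> x) y = G x (J \<alpha> y)"
  using system by (simp add: spin9_system_def)

lemma J_anticommute:
  "\<alpha> \<in> {1..9} \<Longrightarrow> \<beta> \<in> {1..9} \<Longrightarrow> \<alpha> \<noteq> \<beta> \<Longrightarrow> J \<alpha> (J \<beta> x) = - J \<beta> (J \<alpha> x)"
  using system by (metis blinfun_apply_blinfun_compose uminus_blinfun.rep_eq spin9_system_def)

lemma J_skew:
  assumes "\<alpha> \<in> {1..9}" "\<beta> \<in> {1..9}" "\<alpha> \<noteq> \<beta>"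
  shows "G x (J \<alpha> (J \<beta> y)) = - G y (J \<alpha> (J \<beta> x))"
proof -
  have "G x (J \<alpha> (J \<beta> y)) = G (J \<beta> (J \<alpha> x)) y" using assms by (simp add: J_self_adjoint)
  also have "\<dots> = - G (J \<alpha> (J \<beta> x)) y"
    by (simp add: J_anticommute[OF assms] bilinear_lneg[OF bilinear_G])
  finally show ?thesis by (simp add: G_sym)
qed

lemma Rep_kaehler_form:
  assumes "\<alpha> \<in> {1..9}" "\<beta> \<in> {1..9}"
  shows "Rep_even_form (kaehler_form G J \<alpha> \<beta>) vs =
    (if \<alpha> \<noteq> \<beta> \<and> length vs = 2 then G (vs ! 0) (J \<alpha> (J \<beta> (vs ! 1))) else 0)"
proof (cases "\<alpha> = \<beta>")
  case False
  define b where "b x y = G x ((J \<alpha> o\<^sub>L J \<beta>) y)" for x y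
  have lin: "linear (\<lambda>x. b x y)" "linear (\<lambda>y. b x y)" for x y
    using bilinear_G linear_compose[OF bounded_linear.linear[OF blinfun.bounded_linear_right, of "J \<alpha> o\<^sub>L J \<beta>"]]
    by (auto simp: b_def bilinear_def o_def)
  have alt: "b x x = 0" for x using J_skew[OF assms False, of x x] by (simp add: b_def)
  define f where "f = (\<lambda>vs. if length vs = 2 then b (vs ! 0) (vs ! 1) else 0)"
  have "exterior_form f"
    unfolding f_def
  proof (rule exterior_form_adjacentI)
    fix xs ys :: "'v list"
    show "linear (\<lambda>v. if length (xs @ v # ys) = 2 then b ((xs @ v # ys) ! 0) ((xs @ v # ys) ! 1) else 0)"
      by (cases xs; cases ys; cases "tl xs = []"; cases "tl ys = []")
        (auto simp: lin linear_zero cong: if_cong)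
  next
    fix xs ys and v :: 'v
    show "(if length (xs @ v # v # ys) = 2 then b ((xs @ v # v # ys) ! 0) ((xs @ v # v # ys) ! 1) else 0) = 0"
      by (cases xs; cases ys) (auto simp: alt cong: if_cong)
  qed
  then have "Rep_even_form (Abs_even_form f) = f"
    by (rule Rep_Abs_even_form) (auto simp: f_def)
  moreover have "kaehler_form G J \<alpha> \<beta> = Abs_even_form f"
    using False by (simp only: kaehler_form_def f_def b_def if_False)
  ultimately show ?thesis using False by (simp add: f_def b_def)
qed (simp add: kaehler_form_def zero_even_form.rep_eq)

end

lemma kaehler_matrix_carrier: "kaehler_matrix G J \<in> carrier_mat 9 9"
  by (simp add: kaehler_matrix_def)

text \<open>The matrix of the frame change is orthogonal, and over the ring of forms it conjugates
  the pulled back Kaehler matrix into the other one. Its determinant may have either sign, which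
  covers both kinds of frames.\<close>

lemma char_poly_frame_change:
  fixes G :: "'v::real_normed_vector \<Rightarrow> 'v \<Rightarrow> real" and G' :: "'w::real_normed_vector \<Rightarrow> 'w \<Rightarrow> real"
    and M :: "'v \<Rightarrow>\<^sub>L 'w"
  assumes "spin9_point G J" "spin9_point G' J'"
    and iso: "\<And>x y. G' (M x) (M y) = G x y" and nz: "M x0 \<noteq> 0"
    and A: "\<And>\<alpha> x. \<alpha> \<in> {1..9} \<Longrightarrow> M (J \<alpha> x) = (\<Sum>\<beta>\<in>{1..9}. A \<alpha> \<beta> *\<^sub>R J' \<beta> (M x))"
  shows "char_poly (kaehler_matrix G J) = map_poly (pullback_form M) (char_poly (kaehler_matrix G' J'))"
proof -
  interpret J: spin9_point G J by fact
  interpret J': spin9_point G' J' by fact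
  interpret h: comm_ring_hom "pullback_form M" by (rule pullback_form_hom)
  have MJJ: "M (J \<alpha> (J \<beta> x)) = (\<Sum>\<gamma>\<in>{1..9}. \<Sum>\<delta>\<in>{1..9}. (A \<alpha> \<gamma> * A \<beta> \<delta>) *\<^sub>R J' \<gamma> (J' \<delta> (M x)))"
    if "\<alpha> \<in> {1..9}" "\<beta> \<in> {1..9}" for \<alpha> \<beta> x
    using that by (simp add: A blinfun.sum_right blinfun.scaleR_right scaleR_sum_right)
  have diag: "(\<Sum>\<gamma>\<in>{1..9}. \<Sum>\<delta>\<in>{1..9}. if \<gamma> = \<delta> then F \<gamma> \<delta> else 0) = (\<Sum>\<gamma>\<in>{1..9}. F \<gamma> \<gamma>)"
    for F :: "nat \<Rightarrow> nat \<Rightarrow> 'b::real_vector"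
    by simp
  \<comment> \<open>The anticommutator of two generators is twice the inner product of their rows;
    comparing it on the single vector \<open>M x0 \<noteq> 0\<close> suffices.\<close>
  have orth: "(\<Sum>\<gamma>\<in>{1..9}. A \<alpha> \<gamma> * A \<beta> \<gamma>) = (if \<alpha> = \<beta> then 1 else 0)"
    if ab: "\<alpha> \<in> {1..9}" "\<beta> \<in> {1..9}" for \<alpha> \<beta>
  proof -
    let ?a = "\<Sum>\<gamma>\<in>{1..9}. A \<alpha> \<gamma> * A \<beta> \<gamma>"
    have "M (J \<beta> (J \<alpha> x0)) = (\<Sum>\<gamma>\<in>{1..9}. \<Sum>\<delta>\<in>{1..9}. (A \<alpha> \<gamma> * A \<beta> \<delta>) *\<^sub>R J' \<delta> (J' \<gamma> (M x0)))"
      unfolding MJJ[OF ab(2,1)] by (subst sum.swap) (simp add: mult.commute)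
    then have "M (J \<alpha> (J \<beta> x0)) + M (J \<beta> (J \<alpha> x0))
        = (\<Sum>\<gamma>\<in>{1..9}. \<Sum>\<delta>\<in>{1..9}. (A \<alpha> \<gamma> * A \<beta> \<delta>) *\<^sub>R (J' \<gamma> (J' \<delta> (M x0)) + J' \<delta> (J' \<gamma> (M x0))))"
      unfolding MJJ[OF ab] by (simp add: sum.distrib scaleR_add_right)
    also have "\<dots> = (\<Sum>\<gamma>\<in>{1..9}. \<Sum>\<delta>\<in>{1..9}. if \<gamma> = \<delta> then (2 * (A \<alpha> \<gamma> * A \<beta> \<delta>)) *\<^sub>R M x0 else 0)"
    proof (intro sum.cong refl)
      fix \<gamma> \<delta> :: nat assume "\<gamma> \<in> {1..9}" "\<delta> \<in> {1..9}"
      then show "(A \<alpha> \<gamma> * A \<beta> \<delta>) *\<^sub>R (J' \<gamma> (J' \<delta> (M x0)) + J' \<delta> (J' \<gamma> (M x0)))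
          = (if \<gamma> = \<delta> then (2 * (A \<alpha> \<gamma> * A \<beta> \<delta>)) *\<^sub>R M x0 else 0)"
        using J'.J_anticommute[of \<gamma> \<delta> "M x0"] by (simp add: J'.J_sq scaleR_2[symmetric] mult.commute)
    qed
    also have "\<dots> = (2 * ?a) *\<^sub>R M x0"
      unfolding diag by (simp add: scaleR_sum_left[symmetric] sum_distrib_left)
    finally have "M (J \<alpha> (J \<beta> x0)) + M (J \<beta> (J \<alpha> x0)) = (2 * ?a) *\<^sub>R M x0" .
    moreover have "M (J \<alpha> (J \<beta> x0)) + M (J \<beta> (J \<alpha> x0)) = (if \<alpha> = \<beta> then 2 else 0) *\<^sub>R M x0"
      using ab J.J_anticommute[of \<alpha> \<beta> x0] by (simp add: J.J_sq scaleR_2 blinfun.minus_right)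
    ultimately have "(2 * ?a) *\<^sub>R M x0 = (if \<alpha> = \<beta> then 2 else 0) *\<^sub>R M x0" by (simp only:)
    then have "2 * ?a = (if \<alpha> = \<beta> then 2 else 0)" by (simp only: scaleR_cancel_right nz simp_thms)
    then show ?thesis by (cases "\<alpha> = \<beta>") simp_all
  qed
  let ?\<psi> = "kaehler_matrix G J" and ?\<psi>' = "kaehler_matrix G' J'"
  define R where "R = Matrix.mat 9 9 (\<lambda>(i, j). A (i + 1) (j + 1))"
  define P :: "'v even_form Matrix.mat" where "P = map_mat const_form R"
  have R: "R \<in> carrier_mat 9 9" by (simp add: R_def)
  have shift: "(\<Sum>i<9. F (Suc i)) = (\<Sum>\<gamma>\<in>{1..9}. F \<gamma>)" for F :: "nat \<Rightarrow> 'b::comm_monoid_add"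
    by (rule sum.reindex_bij_witness[of _ "\<lambda>i. i - 1" Suc]) auto
  have RR: "R * R\<^sup>T = 1\<^sub>m 9"
  proof (rule eq_matI)
    fix i j assume ij: "i < dim_row (1\<^sub>m 9 :: real Matrix.mat)" "j < dim_col (1\<^sub>m 9 :: real Matrix.mat)"
    have "(R * R\<^sup>T) $$ (i, j) = (\<Sum>k<9. A (i + 1) (Suc k) * A (j + 1) (Suc k))"
      using ij by (auto simp: R_def scalar_prod_def intro!: sum.cong)
    also have "\<dots> = 1\<^sub>m 9 $$ (i, j)"
      using orth[of "Suc i" "Suc j"] ij shift[of "\<lambda>k. A (Suc i) k * A (Suc j) k"] by simp
    finally show "(R * R\<^sup>T) $$ (i, j) = 1\<^sub>m 9 $$ (i, j)" .
  qed (simp_all add: R_def)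
  have RR': "R\<^sup>T * R = 1\<^sub>m 9"
    by (rule mat_mult_left_right_inverse[OF R _ RR]) (simp add: R)
  have P: "P * P\<^sup>T = map_mat const_form (R * R\<^sup>T)" "P\<^sup>T * P = map_mat const_form (R\<^sup>T * R)"
    unfolding P_def map_mat_transpose
    using R by (auto intro!: const_form.mat_hom_mult[symmetric])
  have PP: "P * P\<^sup>T = 1\<^sub>m 9" "P\<^sup>T * P = 1\<^sub>m 9"
    by (simp_all only: P RR RR' const_form.mat_hom_one)
  have C: "?\<psi> \<in> carrier_mat 9 9" "map_mat (pullback_form M) ?\<psi>' \<in> carrier_mat 9 9" "P \<in> carrier_mat 9 9"
    "P\<^sup>T \<in> carrier_mat 9 9"
    using R by (simp_all add: kaehler_matrix_carrier P_def)
  have "?\<psi> = P * map_mat (pullback_form M) ?\<psi>' * P\<^sup>T"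
  proof (rule eq_matI)
    fix i j assume "i < dim_row (P * map_mat (pullback_form M) ?\<psi>' * P\<^sup>T)" "j < dim_col (P * map_mat (pullback_form M) ?\<psi>' * P\<^sup>T)"
    then have ij: "i < 9" "j < 9" by (simp_all add: P_def R_def)
    let ?\<alpha> = "Suc i" and ?\<beta> = "Suc j"
    have ab: "?\<alpha> \<in> {1..9}" "?\<beta> \<in> {1..9}" using ij by auto
    let ?H = "\<lambda>\<gamma> \<delta>. const_form (A ?\<alpha> \<gamma>) * pullback_form M (kaehler_form G' J' \<gamma> \<delta>)"
    let ?c = "\<lambda>\<delta>. const_form (A ?\<beta> \<delta>)"
    have sh2: "(\<Sum>k<9. ?H (Suc k) \<delta>) = (\<Sum>\<gamma>\<in>{1..9}. ?H \<gamma> \<delta>)" for \<delta>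
      by (rule shift[of "\<lambda>k. ?H k \<delta>"])
    have "(P * map_mat (pullback_form M) ?\<psi>' * P\<^sup>T) $$ (i, j)
        = (\<Sum>l<9. (\<Sum>k<9. ?H (Suc k) (Suc l)) * ?c (Suc l))"
      using ij by (auto simp: P_def R_def kaehler_matrix_def scalar_prod_def atLeast0LessThan intro!: sum.cong)
    also have "\<dots> = (\<Sum>l<9. (\<Sum>\<gamma>\<in>{1..9}. ?H \<gamma> (Suc l)) * ?c (Suc l))"
      by (simp only: sh2)
    also have "\<dots> = (\<Sum>\<delta>\<in>{1..9}. (\<Sum>\<gamma>\<in>{1..9}. ?H \<gamma> \<delta>) * ?c \<delta>)"
      by (rule shift[of "\<lambda>\<delta>. (\<Sum>\<gamma>\<in>{1..9}. ?H \<gamma> \<delta>) * ?c \<delta>"])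
    also have "\<dots> = (\<Sum>\<delta>\<in>{1..9}. \<Sum>\<gamma>\<in>{1..9}. const_form (A ?\<alpha> \<gamma> * A ?\<beta> \<delta>) * pullback_form M (kaehler_form G' J' \<gamma> \<delta>))"
      unfolding sum_distrib_right by (intro sum.cong refl) (simp add: const_form.hom_mult mult_ac)
    also have "\<dots> = (\<Sum>\<gamma>\<in>{1..9}. \<Sum>\<delta>\<in>{1..9}. const_form (A ?\<alpha> \<gamma> * A ?\<beta> \<delta>) * pullback_form M (kaehler_form G' J' \<gamma> \<delta>))"
      by (rule sum.swap)
    also have "\<dots> = kaehler_form G J ?\<alpha> ?\<beta>"
    proof (rule Rep_even_form_eqI)
      fix vs
      show "Rep_even_form (\<Sum>\<gamma>\<in>{1..9}. \<Sum>\<delta>\<in>{1..9}. const_form (A ?\<alpha> \<gamma> * A ?\<beta> \<delta>) * pullback_form M (kaehler_form G' J' \<gamma> \<delta>)) vs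
          = Rep_even_form (kaehler_form G J ?\<alpha> ?\<beta>) vs" (is "?L = ?R")
      proof (cases "length vs = 2")
        case True
        let ?x = "vs ! 0" and ?y = "vs ! 1"
        have l: "linear (G' (M ?x))" using J'.bilinear_G by (simp add: bilinear_def)
        let ?F = "\<lambda>\<gamma> \<delta>. A ?\<alpha> \<gamma> * A ?\<beta> \<delta> * G' (M ?x) (J' \<gamma> (J' \<delta> (M ?y)))"
        \<comment> \<open>The diagonal of a Kaehler matrix is zero, although
          \<open>J \<gamma> J \<gamma>\<close> is the identity. The omitted terms sum to an entry of
          \<open>A A^T\<close> times the metric, so they again concern the diagonal only.\<close>
        have "?L = (\<Sum>\<gamma>\<in>{1..9}. \<Sum>\<delta>\<in>{1..9}. ?F \<gamma> \<delta> - (if \<gamma> = \<delta> then ?F \<gamma> \<delta> else 0))"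
          unfolding Rep_even_form_sum Rep_const_form_mult Rep_pullback_form
        proof (rule sum.cong[OF refl], rule sum.cong[OF refl])
          fix \<gamma> \<delta> :: nat assume gd: "\<gamma> \<in> {1..9}" "\<delta> \<in> {1..9}"
          have "map M vs ! 0 = M ?x" "map M vs ! 1 = M ?y" using True by simp_all
          then show "A ?\<alpha> \<gamma> * A ?\<beta> \<delta> * Rep_even_form (kaehler_form G' J' \<gamma> \<delta>) (map M vs)
              = ?F \<gamma> \<delta> - (if \<gamma> = \<delta> then ?F \<gamma> \<delta> else 0)"
            unfolding J'.Rep_kaehler_form[OF gd] length_map True by simp
        qed
        also have "\<dots> = (\<Sum>\<gamma>\<in>{1..9}. \<Sum>\<delta>\<in>{1..9}. ?F \<gamma> \<delta>) - (\<Sum>\<gamma>\<in>{1..9}. ?F \<gamma> \<gamma>)"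
          by (simp only: sum_subtractf diag)
        finally have L: "?L = \<dots>" .
        have "(\<Sum>\<gamma>\<in>{1..9}. \<Sum>\<delta>\<in>{1..9}. ?F \<gamma> \<delta>) = G' (M ?x) (M (J ?\<alpha> (J ?\<beta> ?y)))"
          by (simp only: MJJ[OF ab] linear_sum[OF l] linear_cmul[OF l] real_scaleR_def)
        also have "\<dots> = G ?x (J ?\<alpha> (J ?\<beta> ?y))" by (rule iso)
        finally have 1: "(\<Sum>\<gamma>\<in>{1..9}. \<Sum>\<delta>\<in>{1..9}. ?F \<gamma> \<delta>) = G ?x (J ?\<alpha> (J ?\<beta> ?y))" .
        have "(\<Sum>\<gamma>\<in>{1..9}. ?F \<gamma> \<gamma>) = (\<Sum>\<gamma>\<in>{1..9}. A ?\<alpha> \<gamma> * A ?\<beta> \<gamma>) * G ?x ?y"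
          by (simp add: J'.J_sq iso sum_distrib_right)
        also have "\<dots> = (if i = j then G ?x ?y else 0)" by (simp only: orth[OF ab]) simp
        finally have 2: "(\<Sum>\<gamma>\<in>{1..9}. ?F \<gamma> \<gamma>) = (if i = j then G ?x ?y else 0)" .
        have 3: "J ?\<alpha> (J ?\<alpha> ?y) = ?y" by (rule J.J_sq[OF ab(1)])
        have R: "?R = (if i \<noteq> j then G ?x (J ?\<alpha> (J ?\<beta> ?y)) else 0)"
          by (simp only: J.Rep_kaehler_form[OF ab] True refl simp_thms nat.inject)
        show "?L = ?R"
          apply (rule trans[OF L])
          apply (simp only: 1 2 R)
          using 3 by (cases "i = j") simp_all
      next
        case False
        have "Rep_even_form (const_form (A ?\<alpha> \<gamma> * A ?\<beta> \<delta>) * pullback_form M (kaehler_form G' J' \<gamma> \<delta>)) vs = 0"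
          if "\<gamma> \<in> {1..9}" "\<delta> \<in> {1..9}" for \<gamma> \<delta>
          using that False by (simp add: Rep_const_form_mult Rep_pullback_form J'.Rep_kaehler_form)
        then show ?thesis
          using False by (simp add: Rep_even_form_sum J.Rep_kaehler_form[OF ab])
      qed
    qed
    finally show "?\<psi> $$ (i, j) = (P * map_mat (pullback_form M) ?\<psi>' * P\<^sup>T) $$ (i, j)"
      using ij by (simp add: kaehler_matrix_def)
  next
    show "dim_row ?\<psi> = dim_row (P * map_mat (pullback_form M) ?\<psi>' * P\<^sup>T)"
      by (simp only: index_mult_mat carrier_matD(1)[OF C(1)] carrier_matD(1)[OF C(3)])
    show "dim_col ?\<psi> = dim_col (P * map_mat (pullback_form M) ?\<psi>' * P\<^sup>T)"
      by (simp only: index_mult_mat carrier_matD(2)[OF C(1)] carrier_matD(2)[OF C(4)])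
  qed
  then have "similar_mat ?\<psi> (map_mat (pullback_form M) ?\<psi>')"
    unfolding similar_mat_def using similar_mat_witI[OF PP _ C] by blast
  then show ?thesis
    by (simp add: char_poly_similar h.char_poly_hom[OF kaehler_matrix_carrier])
qed

lemma coeff_char_poly_frame_change:
  fixes M :: "'v::real_normed_vector \<Rightarrow>\<^sub>L 'w::real_normed_vector"
    and \<psi> :: "'v even_form Matrix.mat" and \<psi>' :: "'w even_form Matrix.mat"
  assumes "char_poly \<psi> = map_poly (pullback_form M) (char_poly \<psi>')"
  shows "coeff (char_poly \<psi>) k = pullback_form M (coeff (char_poly \<psi>') k)"
proof -
  interpret h: comm_ring_hom "pullback_form M" by (rule pullback_form_hom)
  show ?thesis by (simp add: assms coeff_map_poly)
qed

subsection \<open>Invariance of the coefficients for the standard system\<close>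

abbreviation std_J :: "nat \<Rightarrow> (oct \<times> oct) \<Rightarrow>\<^sub>L (oct \<times> oct)" where
  "std_J \<alpha> \<equiv> Blinfun (std_I \<alpha>)"

lemma bounded_linear_std_I: "bounded_linear (std_I \<alpha>)"
  using linear_std_I linear_conv_bounded_linear by blast

lemma std_J_apply [simp]: "blinfun_apply (std_J \<alpha>) = std_I \<alpha>"
  by (rule bounded_linear_Blinfun_apply[OF bounded_linear_std_I])

interpretation std_point: spin9_point inner std_J
proof
  show "bilinear (inner :: oct \<times> oct \<Rightarrow> oct \<times> oct \<Rightarrow> real)"
    using bilinear_conv_bounded_bilinear bounded_bilinear_inner by blast
  show "spin9_system inner std_J"
    unfolding spin9_system_def
  proof (intro ballI conjI allI impI)
    fix \<alpha> :: nat assume a: "\<alpha> \<in> {1..9}"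
    show "std_J \<alpha> o\<^sub>L std_J \<alpha> = id_blinfun"
      by (rule blinfun_eqI) (simp add: std_I_sq[OF a])
    show "inner (std_J \<alpha> v) w = inner v (std_J \<alpha> w)" for v w
      by (simp add: std_I_self_adjoint[OF a])
    fix \<beta> :: nat assume "\<beta> \<in> {1..9}" "\<alpha> \<noteq> \<beta>"
    then show "std_J \<alpha> o\<^sub>L std_J \<beta> = - (std_J \<beta> o\<^sub>L std_J \<alpha>)"
      using std_I_anticommute[OF a] by (intro blinfun_eqI) (simp add: uminus_blinfun.rep_eq)
  qed
qed (rule inner_commute)

text \<open>Conjugation with \<open>M\<close> rotates the plane of \<open>std_I \<alpha>\<close> and
  \<open>std_I \<beta>\<close> by twice the angle and fixes the other generators; hence the
  coefficients \<open>c^2 - s^2\<close> and \<open>2 c s\<close>.\<close>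

lemma std_rotation_char_poly:
  assumes ab: "\<alpha> \<in> {1..9}" "\<beta> \<in> {1..9}" "\<alpha> \<noteq> \<beta>" and cs: "c\<^sup>2 + s\<^sup>2 = (1 :: real)"
  defines "M \<equiv> c *\<^sub>R id_blinfun + s *\<^sub>R (std_J \<alpha> o\<^sub>L std_J \<beta>)"
  shows "char_poly (kaehler_matrix inner std_J) = map_poly (pullback_form M) (char_poly (kaehler_matrix inner std_J))"
proof -
  let ?S = std_I
  have M: "M x = c *\<^sub>R x + s *\<^sub>R ?S \<alpha> (?S \<beta> x)" for x
    by (simp add: M_def blinfun.add_left blinfun.scaleR_left)
  have iso: "inner (M x) (M y) = inner x y" for x y
  proof -
    have "inner (?S \<alpha> (?S \<beta> x)) (?S \<alpha> (?S \<beta> y)) = inner x y"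
      using ab by (simp add: std_I_self_adjoint std_I_sq)
    moreover have "inner x (?S \<alpha> (?S \<beta> y)) = - inner (?S \<alpha> (?S \<beta> x)) y"
      using std_point.J_skew[OF ab, of x y] by (simp add: inner_commute)
    ultimately have "inner (M x) (M y) = (c\<^sup>2 + s\<^sup>2) * inner x y"
      by (simp add: M inner_add_left inner_add_right power2_eq_square algebra_simps)
    then show ?thesis by (simp add: cs)
  qed
  let ?A = "\<lambda>\<gamma> \<delta>. if \<gamma> = \<alpha> then (if \<delta> = \<alpha> then c\<^sup>2 - s\<^sup>2 else if \<delta> = \<beta> then - 2 * c * s else 0)
    else if \<gamma> = \<beta> then (if \<delta> = \<alpha> then 2 * c * s else if \<delta> = \<beta> then c\<^sup>2 - s\<^sup>2 else 0)
    else if \<gamma> = \<delta> then 1 else 0"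
  have two: "(\<Sum>\<delta>\<in>{1..9}. (if \<delta> = \<alpha> then a else if \<delta> = \<beta> then b else 0) *\<^sub>R F \<delta>) = a *\<^sub>R F \<alpha> + b *\<^sub>R F \<beta>"
    for a b :: real and F :: "nat \<Rightarrow> oct \<times> oct"
  proof -
    have "(\<Sum>\<delta>\<in>{1..9}. (if \<delta> = \<alpha> then a else if \<delta> = \<beta> then b else 0) *\<^sub>R F \<delta>)
        = (\<Sum>\<delta>\<in>{1..9}. (if \<delta> = \<alpha> then a *\<^sub>R F \<delta> else 0) + (if \<delta> = \<beta> then b *\<^sub>R F \<delta> else 0))"
      using ab(3) by (intro sum.cong refl) auto
    also have "\<dots> = a *\<^sub>R F \<alpha> + b *\<^sub>R F \<beta>"
      using ab unfolding sum.distrib by (simp only: sum.delta finite_atLeastAtMost if_True)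
    finally show ?thesis .
  qed
  have lin: "?S \<gamma> (M x) = c *\<^sub>R ?S \<gamma> x + s *\<^sub>R ?S \<gamma> (?S \<alpha> (?S \<beta> x))" for \<gamma> x
    by (simp add: M linear_add[OF linear_std_I] linear_cmul[OF linear_std_I])
  have A: "M (std_J \<gamma> x) = (\<Sum>\<delta>\<in>{1..9}. ?A \<gamma> \<delta> *\<^sub>R std_J \<delta> (M x))" if g: "\<gamma> \<in> {1..9}" for \<gamma> x
  proof -
    have r: "?S \<alpha> (?S \<beta> (?S \<alpha> x)) = - ?S \<beta> x"
      using std_I_anticommute[OF ab, of "?S \<alpha> x"] ab by (simp add: std_I_sq)
    have r': "?S \<beta> (?S \<alpha> (?S \<beta> x)) = - ?S \<alpha> x"
      using std_I_anticommute[OF ab(2,1) ab(3)[symmetric], of "?S \<beta> x"] ab by (simp add: std_I_sq)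
    have d: "(c * c) *\<^sub>R v + (s * s) *\<^sub>R v = v" for v :: "oct \<times> oct"
      using cs by (simp only: scaleR_add_left[symmetric] power2_eq_square) simp
    have dbl: "(k * (l * (m * 2))) *\<^sub>R v = (k * (l * m)) *\<^sub>R v + (k * (l * m)) *\<^sub>R v"
      for k l m :: real and v :: "oct \<times> oct"
      by (simp flip: scaleR_add_left)
    consider "\<gamma> = \<alpha>" | "\<gamma> = \<beta>" | "\<gamma> \<noteq> \<alpha>" "\<gamma> \<noteq> \<beta>" by blast
    then show ?thesis
    proof cases
      case 1
      have "(\<Sum>\<delta>\<in>{1..9}. ?A \<gamma> \<delta> *\<^sub>R std_J \<delta> (M x)) = (c\<^sup>2 - s\<^sup>2) *\<^sub>R ?S \<alpha> (M x) + (- 2 * c * s) *\<^sub>R ?S \<beta> (M x)"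
        unfolding 1 std_J_apply if_True[of _ _] by (simp only: refl if_True two)
      also have "\<dots> = (c * (c\<^sup>2 + s\<^sup>2)) *\<^sub>R ?S \<alpha> x - (s * (c\<^sup>2 + s\<^sup>2)) *\<^sub>R ?S \<beta> x"
        using ab by (simp add: lin r' std_I_sq algebra_simps power2_eq_square dbl)
      also have "\<dots> = M (std_J \<gamma> x)" by (simp add: cs M 1 r)
      finally show ?thesis by simp
    next
      case 2
      have "(\<Sum>\<delta>\<in>{1..9}. ?A \<gamma> \<delta> *\<^sub>R std_J \<delta> (M x)) = (2 * c * s) *\<^sub>R ?S \<alpha> (M x) + (c\<^sup>2 - s\<^sup>2) *\<^sub>R ?S \<beta> (M x)"
        unfolding 2 by (simp only: std_J_apply refl ab(3)[symmetric] if_True if_False two)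
      also have "\<dots> = (c * (c\<^sup>2 + s\<^sup>2)) *\<^sub>R ?S \<beta> x + (s * (c\<^sup>2 + s\<^sup>2)) *\<^sub>R ?S \<alpha> x"
        using ab by (simp add: lin r' std_I_sq algebra_simps power2_eq_square dbl)
      also have "\<dots> = M (std_J \<gamma> x)" using ab by (simp add: cs M 2 std_I_sq)
      finally show ?thesis by simp
    next
      case 3
      have "(\<Sum>\<delta>\<in>{1..9}. ?A \<gamma> \<delta> *\<^sub>R std_J \<delta> (M x)) = (\<Sum>\<delta>\<in>{1..9}. if \<gamma> = \<delta> then ?S \<delta> (M x) else 0)"
        using 3 by (intro sum.cong refl) auto
      also have "\<dots> = ?S \<gamma> (M x)" using g by simp
      also have "\<dots> = M (std_J \<gamma> x)"
        unfolding std_J_apply M linear_add[OF linear_std_I] linear_cmul[OF linear_std_I]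
        using 3 g ab by (simp add: std_I_anticommute[of \<gamma> \<alpha>] std_I_anticommute[of \<gamma> \<beta>] std.S_neg)
      finally show ?thesis by simp
    qed
  qed
  have "M (bas 0) \<noteq> 0"
    using iso[of "bas 0" "bas 0"] by (auto simp: bas_def oct_basis_def inner_prod_def)
  from char_poly_frame_change[OF std_point.spin9_point_axioms std_point.spin9_point_axioms iso this A]
  show ?thesis .
qed

section \<open>Differentiating the invariance under rotations\<close>

lemma exterior_form_contract:
  assumes "exterior_form f"
  shows "exterior_form (contract v f)"
  unfolding exterior_form_def contract_def
proof (intro conjI allI impI)
  show "linear (\<lambda>x. f (v # xs @ x # ys))" for xs ys
    using exterior_formD(1)[OF assms, of "v # xs" ys] by simp
  show "f (v # xs) = 0" if "\<not> distinct xs" for xs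
    using that by (intro exterior_formD(2)[OF assms]) simp
qed

lemma derivation_Cons: "derivation T f (v # vs) = derivation T (contract v f) vs + contract (T v) f vs"
  unfolding derivation_def contract_def list.size add_Suc_right add_0_right sum.lessThan_Suc_shift by simp

lemma derivation_deriv:
  fixes f :: "'v::real_vector list \<Rightarrow> real"
  assumes "exterior_form f"
  shows "((\<lambda>t. f (map (\<lambda>x. cos t *\<^sub>R x + sin t *\<^sub>R T x) vs)) has_real_derivative derivation T f vs) (at 0)"
  using assms
proof (induction vs arbitrary: f)
  case Nil
  show ?case by (simp add: derivation_def)
next
  case (Cons v vs)
  let ?m = "\<lambda>t. map (\<lambda>x. cos t *\<^sub>R x + sin t *\<^sub>R T x) vs"
  have l: "linear (\<lambda>v. f (v # ys))" for ys
    using exterior_formD(1)[OF Cons.prems, of "[]"] by simp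
  have "f ((cos t *\<^sub>R v + sin t *\<^sub>R T v) # ys) = cos t * f (v # ys) + sin t * f (T v # ys)" for t ys
    using linear_add[OF l[of ys], of "cos t *\<^sub>R v" "sin t *\<^sub>R T v"]
      linear_cmul[OF l[of ys], of "cos t" v] linear_cmul[OF l[of ys], of "sin t" "T v"]
    by (simp only: real_scaleR_def)
  then have "(\<lambda>t. f (map (\<lambda>x. cos t *\<^sub>R x + sin t *\<^sub>R T x) (v # vs)))
      = (\<lambda>t. cos t * contract v f (?m t) + sin t * contract (T v) f (?m t))"
    by (simp only: list.map contract_def)
  moreover have "((\<lambda>t. cos t * contract v f (?m t) + sin t * contract (T v) f (?m t)) has_real_derivative
      derivation T f (v # vs)) (at 0)"
    using DERIV_add[OF DERIV_mult[OF DERIV_cos Cons.IH[OF exterior_form_contract[OF Cons.prems, of v]]]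
        DERIV_mult[OF DERIV_sin Cons.IH[OF exterior_form_contract[OF Cons.prems, of "T v"]]]]
    unfolding derivation_Cons by simp
  ultimately show ?case by (simp only:)
qed

lemma coeff_spin_invariant: "std.spin_invariant (Rep_even_form (coeff (char_poly (kaehler_matrix inner std_J)) k))"
  unfolding std.spin_invariant_def
proof (intro ballI impI allI)
  fix \<alpha> \<beta> :: nat and v assume ab: "\<alpha> \<in> {1..9}" "\<beta> \<in> {1..9}" "\<alpha> \<noteq> \<beta>"
  let ?c = "coeff (char_poly (kaehler_matrix inner std_J)) k"
  have inv: "Rep_even_form ?c (map (\<lambda>x. cos t *\<^sub>R x + sin t *\<^sub>R std_I \<alpha> (std_I \<beta> x)) v) = Rep_even_form ?c v" for t
  proof -
    let ?M = "cos t *\<^sub>R id_blinfun + sin t *\<^sub>R (std_J \<alpha> o\<^sub>L std_J \<beta>)"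
    have e: "?c = pullback_form ?M ?c"
      by (rule coeff_char_poly_frame_change[OF std_rotation_char_poly[OF ab]]) simp
    have "Rep_even_form ?c v = Rep_even_form ?c (map (blinfun_apply ?M) v)"
      using arg_cong[OF e, of "\<lambda>\<omega>. Rep_even_form \<omega> v"] unfolding Rep_pullback_form .
    moreover have "blinfun_apply ?M = (\<lambda>x. cos t *\<^sub>R x + sin t *\<^sub>R std_I \<alpha> (std_I \<beta> x))"
      by (rule ext) (simp only: blinfun.add_left blinfun.scaleR_left blinfun_apply_id_blinfun
          blinfun_apply_blinfun_compose std_J_apply id_apply)
    ultimately show ?thesis by (simp only:)
  qed
  have "((\<lambda>t. Rep_even_form ?c v) has_real_derivative derivation (\<lambda>x. std_I \<alpha> (std_I \<beta> x)) (Rep_even_form ?c) v) (at 0)"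
    using derivation_deriv[OF Rep_even_form_exterior, of ?c "\<lambda>x. std_I \<alpha> (std_I \<beta> x)" v]
    by (simp only: inv)
  then show "derivation (\<lambda>x. std_I \<alpha> (std_I \<beta> x)) (Rep_even_form ?c) v = 0"
    by (rule DERIV_unique[OF _ DERIV_const])
qed

subsection \<open>Vanishing coefficients\<close>

text \<open>The induction runs on the number of entries in the \<open>-1\<close>-eigenspace. The
  factor \<open>\<kappa>\<close> is left open so that one argument serves degree 8 as well as the
  vanishing in degrees 4 and 12.\<close>

lemma (in clifford_system) graded_zero:
  fixes f :: "'v list \<Rightarrow> real" and \<kappa> :: "nat \<Rightarrow> real"
  assumes f: "exterior_form f"
    and rec: "\<And>v s. length v = n \<Longrightarrow> (\<And>i. i < n \<Longrightarrow> S 9 (v ! i) = s i *\<^sub>R v ! i) \<Longrightarrow>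
      (\<And>i. s i = 1 \<or> s i = (- 1 :: real)) \<Longrightarrow>
      (\<Sum>\<alpha>\<in>{1..8}. pair_sum (S \<alpha>) {i. i < n \<and> s i = - 1} f v) = \<kappa> (card {i. i < n \<and> s i = - 1}) * f v"
    and \<kappa>: "\<And>q. 0 < q \<Longrightarrow> q \<le> n \<Longrightarrow> \<kappa> q \<noteq> 0"
    and base: "\<And>v. length v = n \<Longrightarrow> (\<And>i. i < n \<Longrightarrow> S 9 (v ! i) = v ! i) \<Longrightarrow> f v = 0"
    and "length v = n"
  shows "f v = 0"
proof -
  have graded: "f v = 0" if "length v = n" "\<And>i. i < n \<Longrightarrow> S 9 (v ! i) = s i *\<^sub>R v ! i"
    "\<And>i. s i = 1 \<or> s i = (- 1 :: real)" for v and s :: "nat \<Rightarrow> real"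
    using that
  proof (induction "card {i. i < n \<and> s i = - 1}" arbitrary: v s rule: less_induct)
    case less
    let ?M = "{i. i < n \<and> s i = - 1}"
    have fin: "finite ?M" by simp
    show ?case
    proof (cases "?M = {}")
      case True
      then have "s i = 1" if "i < n" for i using less.prems(3)[of i] that by auto
      then show ?thesis using base less.prems by simp
    next
      case False
      have "f (v[i := S \<alpha> (v ! i), j := S \<alpha> (v ! j)]) = 0"
        if ij: "i \<in> ?M" "j \<in> ?M - {i}" and \<alpha>: "\<alpha> \<in> {1..8}" for i j \<alpha>
      proof -
        let ?s = "s(i := 1, j := 1)" and ?v = "v[i := S \<alpha> (v ! i), j := S \<alpha> (v ! j)]"
        have "{k. k < n \<and> ?s k = - 1} \<subset> ?M" using ij by auto
        then have "card {k. k < n \<and> ?s k = - 1} < card ?M" by (rule psubset_card_mono[OF fin])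
        moreover have "S 9 (?v ! k) = ?s k *\<^sub>R ?v ! k" if "k < n" for k
        proof -
          have "S 9 (S \<alpha> (v ! l)) = S \<alpha> (v ! l)" if "l \<in> ?M" for l
            using S_anticommute[of 9 \<alpha> "v ! l"] less.prems(2)[of l] that \<alpha> by (simp add: S_neg)
          then show ?thesis
            using ij that less.prems(1,2) by (auto simp: nth_list_update)
        qed
        moreover have "?s k = 1 \<or> ?s k = - 1" for k using less.prems(3) by auto
        ultimately show ?thesis
          using less.hyps[of ?s ?v] less.prems(1) by simp
      qed
      then have "pair_sum (S \<alpha>) ?M f v = 0" if "\<alpha> \<in> {1..8}" for \<alpha>
        unfolding pair_sum_def using that by (intro sum.neutral ballI) blast
      then have "\<kappa> (card ?M) * f v = 0"
        using rec[OF less.prems] by simp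
      moreover have "\<kappa> (card ?M) \<noteq> 0"
      proof (rule \<kappa>)
        show "0 < card ?M" using False fin by (simp add: card_gt_0_iff)
        show "card ?M \<le> n" using card_mono[of "{..<n}" ?M] by auto
      qed
      ultimately show ?thesis by simp
    qed
  qed
  \<comment> \<open>The half sum and the half difference of \<open>x\<close> and
    \<open>S 9 x\<close> are eigenvectors, so lists of eigenvectors suffice.\<close>
  let ?B = "{x. S 9 x = x} \<union> {x. S 9 x = - x}"
  have "x \<in> span ?B" for x
  proof -
    have l: "S 9 (c *\<^sub>R a + d *\<^sub>R b) = c *\<^sub>R S 9 a + d *\<^sub>R S 9 b" for a b c d
      by (simp add: linear_add[OF linear_S] linear_cmul[OF linear_S])
    have "S 9 ((1/2) *\<^sub>R x + (1/2) *\<^sub>R S 9 x) = (1/2) *\<^sub>R x + (1/2) *\<^sub>R S 9 x"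
      "S 9 ((1/2) *\<^sub>R x + (-1/2) *\<^sub>R S 9 x) = - ((1/2) *\<^sub>R x + (-1/2) *\<^sub>R S 9 x)"
      by (simp_all only: l) (simp_all add: S_sq)
    then have "((1/2) *\<^sub>R x + (1/2) *\<^sub>R S 9 x) + ((1/2) *\<^sub>R x + (-1/2) *\<^sub>R S 9 x) \<in> span ?B"
      by (intro span_add span_base) blast+
    also have "((1/2) *\<^sub>R x + (1/2) *\<^sub>R S 9 x) + ((1/2) *\<^sub>R x + (-1/2) *\<^sub>R S 9 x) = x"
      by (simp add: scaleR_add_left[symmetric])
    finally show ?thesis .
  qed
  then have "span ?B = UNIV" by blast
  then show ?thesis
  proof (rule exterior_form_zero_span[OF f _ _ assms(5)])
    fix xs assume xs: "set xs \<subseteq> ?B" "length xs = n"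
    show "f xs = 0"
    proof (rule graded[OF xs(2)])
      fix i assume "i < n"
      then have "xs ! i \<in> ?B" using xs nth_mem by blast
      then show "S 9 (xs ! i) = (if S 9 (xs ! i) = xs ! i then 1 else - 1) *\<^sub>R xs ! i" by auto
    qed auto
  qed
qed

lemma (in clifford_system) spin_invariant_zero:
  assumes f: "exterior_form f" "spin_invariant f" and c: "\<And>x. casimir_at x" and n: "length v = 4 \<or> length v = 12"
  shows "f v = 0"
proof -
  \<comment> \<open>In degree 4 the factor is \<open>16 + 12 q - q^2\<close>, positive for
    \<open>q \<le> 4\<close>; in degree 12 it is \<open>- 48 + 20 q - q^2\<close>, with irrational
    roots. At \<open>q = 0\<close> the pair sums are empty and the factor is still nonzero, which
    settles the base case.\<close>
  let ?k = "\<lambda>q. 8 * real (length v) - (real (length v))\<^sup>2 + 8 * real q + real (length v) * real q - (real q)\<^sup>2"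
  have nz: "?k q \<noteq> 0" if "q \<le> length v" for q
  proof -
    have "q \<le> 12" "length v = 4 \<Longrightarrow> q \<le> 4" using that n by auto
    moreover from this have "q = 0 \<or> q = 1 \<or> q = 2 \<or> q = 3 \<or> q = 4 \<or> q = 5 \<or> q = 6 \<or> q = 7 \<or> q = 8
      \<or> q = 9 \<or> q = 10 \<or> q = 11 \<or> q = 12" by arith
    ultimately show ?thesis using n by auto
  qed
  have rec: "(\<Sum>\<alpha>\<in>{1..8}. pair_sum (S \<alpha>) {i. i < length v \<and> s i = - 1} f w) = ?k (card {i. i < length v \<and> s i = - 1}) * f w"
    if "length w = length v" "\<And>i. i < length v \<Longrightarrow> S 9 (w ! i) = s i *\<^sub>R w ! i" "\<And>i. s i = 1 \<or> s i = (- 1 :: real)" for w s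
    using graded_recursion[OF f c, of w s "real (length v)" "real (card {i. i < length v \<and> s i = - 1})"] that by simp
  show ?thesis
  proof (rule graded_zero[OF f(1) rec])
    fix w assume w: "length w = length v" "\<And>i. i < length v \<Longrightarrow> S 9 (w ! i) = w ! i"
    have "?k 0 * f w = 0"
      using rec[of w "\<lambda>_. 1"] w by (simp add: pair_sum_def)
    then show "f w = 0" using nz[of 0] by simp
  qed (use nz in auto)
qed

section \<open>Skewness and homogeneity of the coefficients\<close>

lemma exterior_form_scale:
  assumes "exterior_form f"
  shows "f (map (\<lambda>x. c *\<^sub>R x) vs) = c ^ length vs * f vs"
  using assms
proof (induction vs arbitrary: f)
  case (Cons v vs)
  have "f (c *\<^sub>R v # ys) = c * f (v # ys)" for ys
    using linear_cmul[OF exterior_formD(1)[OF Cons.prems, of "[]" ys], of c v] by simp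
  moreover have "f (v # map (\<lambda>x. c *\<^sub>R x) vs) = c ^ length vs * f (v # vs)"
    using Cons.IH[OF exterior_form_contract[OF Cons.prems, of v]] by (simp only: contract_def)
  ultimately show ?case by simp
qed simp

lemma Rep_numeral_power_mult: "Rep_even_form (numeral k ^ n * f) xs = numeral k ^ n * Rep_even_form f xs"
  by (induction n) (simp_all add: mult.assoc Rep_numeral_mult)

context spin9_point
begin

lemma kaehler_form_skew:
  assumes "\<alpha> \<in> {1..9}" "\<beta> \<in> {1..9}"
  shows "kaehler_form G J \<beta> \<alpha> = - kaehler_form G J \<alpha> \<beta>"
proof (rule Rep_even_form_eqI)
  fix vs
  have "G x (J \<beta> (J \<alpha> y)) = - G x (J \<alpha> (J \<beta> y))" if "\<alpha> \<noteq> \<beta>" for x y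
    using J_anticommute[OF assms that] by (simp add: bilinear_rneg[OF bilinear_G])
  then show "Rep_even_form (kaehler_form G J \<beta> \<alpha>) vs = Rep_even_form (- kaehler_form G J \<alpha> \<beta>) vs"
    unfolding uminus_even_form.rep_eq Rep_kaehler_form[OF assms] Rep_kaehler_form[OF assms(2,1)] by auto
qed

text \<open>Transposition turns \<open>\<psi>\<close> into \<open>- \<psi>\<close> and keeps the
  characteristic polynomial; as the size 9 is odd, an even coefficient is its own negative.\<close>

lemma coeff_char_poly_even:
  assumes "even k"
  shows "coeff (char_poly (kaehler_matrix G J)) k = 0"
proof -
  let ?\<psi> = "kaehler_matrix G J" and ?c = "coeff (char_poly (kaehler_matrix G J)) k"
  have "?\<psi>\<^sup>T = - 1 \<cdot>\<^sub>m ?\<psi>"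
    by (rule eq_matI) (auto simp: kaehler_matrix_def intro!: kaehler_form_skew)
  then have "char_poly (- 1 \<cdot>\<^sub>m ?\<psi>) = char_poly ?\<psi>"
    using char_poly_transpose_mat[OF kaehler_matrix_carrier, of G J] by simp
  then have c: "?c = - ?c"
    using coeff_char_poly_smult[OF kaehler_matrix_carrier, of "- 1" k G J] assms by simp
  have "2 * ?c = 2 * 0"
    using arg_cong[OF c, of "\<lambda>y. ?c + y"] by (simp only: mult_2 add.right_inverse add_0_left)
  then show ?thesis by (rule numeral_mult_even_form_cancel)
qed

text \<open>Homogeneity is read off from the homothety \<open>x \<mapsto> 2 x\<close>: pulling back
  multiplies \<open>\<psi>\<close> by 4, hence the coefficient of \<open>t^k\<close> by
  \<open>4^(9-k)\<close>, but a value on \<open>n\<close> vectors by \<open>2^n\<close>.\<close>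

lemma coeff_char_poly_degree:
  assumes "length vs + 2 * k \<noteq> 18"
  shows "Rep_even_form (coeff (char_poly (kaehler_matrix G J)) k) vs = 0"
proof -
  let ?\<psi> = "kaehler_matrix G J" and ?c = "coeff (char_poly (kaehler_matrix G J)) k"
  let ?D = "2 *\<^sub>R id_blinfun :: 'v \<Rightarrow>\<^sub>L 'v"
  interpret h: comm_ring_hom "pullback_form ?D" by (rule pullback_form_hom)
  have D: "blinfun_apply ?D = (\<lambda>x. 2 *\<^sub>R x)"
    by (rule ext) (simp add: blinfun.scaleR_left)
  have "map_mat (pullback_form ?D) ?\<psi> = 4 \<cdot>\<^sub>m ?\<psi>"
  proof (rule eq_matI)
    fix i j assume "i < dim_row (4 \<cdot>\<^sub>m ?\<psi>)" "j < dim_col (4 \<cdot>\<^sub>m ?\<psi>)"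
    then have ij: "i < 9" "j < 9" by (simp_all add: kaehler_matrix_def)
    then have ab: "Suc i \<in> {1..9}" "Suc j \<in> {1..9}" by auto
    have "pullback_form ?D (kaehler_form G J (Suc i) (Suc j)) = 4 * kaehler_form G J (Suc i) (Suc j)"
    proof (rule Rep_even_form_eqI)
      fix ws
      show "Rep_even_form (pullback_form ?D (kaehler_form G J (Suc i) (Suc j))) ws = Rep_even_form (4 * kaehler_form G J (Suc i) (Suc j)) ws"
        unfolding Rep_pullback_form Rep_numeral_mult D exterior_form_scale[OF Rep_even_form_exterior]
        by (simp add: Rep_kaehler_form[OF ab])
    qed
    then show "map_mat (pullback_form ?D) ?\<psi> $$ (i, j) = (4 \<cdot>\<^sub>m ?\<psi>) $$ (i, j)"
      using ij by (simp add: kaehler_matrix_def)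
  qed (simp_all add: kaehler_matrix_def)
  then have "map_poly (pullback_form ?D) (char_poly ?\<psi>) = char_poly (4 \<cdot>\<^sub>m ?\<psi>)"
    using h.char_poly_hom[OF kaehler_matrix_carrier, of G J] by simp
  from arg_cong[OF this, of "\<lambda>p. coeff p k"]
  have "coeff (char_poly (4 \<cdot>\<^sub>m ?\<psi>)) k = pullback_form ?D ?c"
    by (simp only: coeff_map_poly h.hom_zero)
  then have e: "4 ^ k * pullback_form ?D ?c = 4 ^ 9 * ?c"
    using coeff_char_poly_smult[OF kaehler_matrix_carrier, of 4 k G J] by simp
  have "4 ^ k * (2 ^ length vs * Rep_even_form ?c vs) = 4 ^ 9 * Rep_even_form ?c vs"
    using arg_cong[OF e, of "\<lambda>\<omega>. Rep_even_form \<omega> vs"]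
    unfolding Rep_numeral_power_mult Rep_pullback_form D exterior_form_scale[OF Rep_even_form_exterior] .
  moreover have "(2 :: real) ^ (length vs + 2 * k) = 4 ^ k * 2 ^ length vs"
    by (simp add: power_add power_mult)
  ultimately have "(2 :: real) ^ (length vs + 2 * k) * Rep_even_form ?c vs = 2 ^ 18 * Rep_even_form ?c vs"
    by (simp add: mult.assoc)
  moreover have "(2 :: real) ^ (length vs + 2 * k) \<noteq> 2 ^ 18"
    using assms power_inject_exp[of "2::real" "length vs + 2 * k" 18] by simp
  ultimately show ?thesis by (simp only: mult_cancel_right simp_thms)
qed

end

lemma std_coeff_zero:
  assumes "k = 7 \<or> k = 3"
  shows "coeff (char_poly (kaehler_matrix inner std_J)) k = 0"
proof (rule Rep_even_form_eqI)
  fix vs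
  show "Rep_even_form (coeff (char_poly (kaehler_matrix inner std_J)) k) vs = Rep_even_form 0 vs"
  proof (cases "length vs + 2 * k = 18")
    case True
    then have "length vs = 4 \<or> length vs = 12" using assms by auto
    then show ?thesis
      using std.spin_invariant_zero[OF Rep_even_form_exterior coeff_spin_invariant casimir_std]
      by (simp add: zero_even_form.rep_eq)
  next
    case False
    then show ?thesis
      using std_point.coeff_char_poly_degree by (simp add: zero_even_form.rep_eq)
  qed
qed

subsection \<open>The value of the fourth coefficient on the first octonionic line\<close>

text \<open>Polarisation of \<open>omul_ocnj_cancel\<close>: a Clifford relation for left
  multiplications.\<close>

lemma omul_polarized: "omul (ocnj x) (omul y s) + omul (ocnj y) (omul x s) = (2 * inner x y) *\<^sub>R s"
proof -
  have "omul (ocnj (x + y)) (omul (x + y) s) = inner (x + y) (x + y) *\<^sub>R s" by (rule omul_ocnj_cancel)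
  moreover have "omul (ocnj (x + y)) (omul (x + y) s)
      = (omul (ocnj x) (omul x s) + omul (ocnj y) (omul y s)) + (omul (ocnj x) (omul y s) + omul (ocnj y) (omul x s))"
    by (simp only: linear_add[OF linear_ocnj] linear_add[OF linear_omul_left] linear_add[OF linear_omul_right] add_ac)
  moreover have "inner (x + y) (x + y) = inner x x + inner y y + 2 * inner x y"
    by (simp add: inner_add_left inner_add_right inner_commute)
  ultimately show ?thesis
    by (simp add: omul_ocnj_cancel scaleR_add_left)
qed

lemma inner_omul_same: "inner a b = 0 \<Longrightarrow> inner (omul a s) (omul b s) = 0"
  using omul_polarized[of a b s] inner_omul_right[of a s "omul b s"] inner_omul_right[of b s "omul a s"]
    inner_add_right[of s "omul (ocnj a) (omul b s)" "omul (ocnj b) (omul a s)"]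
  by (simp only: inner_commute[of "omul b s"] mult_zero_right scaleR_zero_left inner_zero_right)

text \<open>On \<open>(x, 0)\<close> and \<open>(y, 0)\<close> a Kaehler form is an inner product of
  \<open>x u\<close> with \<open>y u'\<close>, and moving \<open>x\<close> to the other side
  conjugates it. Powers of \<open>\<psi>\<close> therefore lead to left multiplications by octonions
  and conjugates in turn, which cannot be merged into one product for lack of associativity.\<close>

fun alt_mult :: "bool \<Rightarrow> oct list \<Rightarrow> oct \<Rightarrow> oct" where
  "alt_mult c [] s = s"
| "alt_mult c (x # xs) s = omul (if c then ocnj x else x) (alt_mult (\<not> c) xs s)"

lemma alt_mult_append: "alt_mult c (xs @ ys) s = alt_mult c xs (alt_mult (c \<noteq> odd (length xs)) ys s)"
  by (induction xs arbitrary: c) auto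

lemma linear_alt_mult: "linear (alt_mult c xs)"
proof (induction xs arbitrary: c)
  case (Cons x xs)
  show ?case
    using linear_compose[OF Cons.IH linear_omul_right] by (simp add: o_def)
qed (auto intro: linearI)

lemma alt_mult_swap:
  assumes "inner x y = 0"
  shows "alt_mult c (ps @ x # y # qs) s = - alt_mult c (ps @ y # x # qs) s"
proof -
  have "omul (ocnj x) (omul y s) = - omul (ocnj y) (omul x s)" for s
    using omul_polarized[of x y s] assms by (simp add: eq_neg_iff_add_eq_0)
  moreover have "omul x (omul (ocnj y) s) = - omul y (omul (ocnj x) s)" for s
    using omul_polarized[of "ocnj x" "ocnj y" s] assms by (simp add: ocnj_ocnj ocnj_inner eq_neg_iff_add_eq_0)
  ultimately show ?thesis
    by (simp add: alt_mult_append linear_neg[OF linear_alt_mult])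
qed

text \<open>Antisymmetry is assumed only for distinct entries from \<open>B\<close>, because
  \<open>alt_mult_swap\<close> provides it for orthogonal neighbours.\<close>

lemma shuffle_sign:
  fixes F :: "'a list \<Rightarrow> real"
  assumes sw: "\<And>ps x y qs. distinct (ps @ x # y # qs) \<Longrightarrow> set (ps @ x # y # qs) \<subseteq> B \<Longrightarrow>
      F (ps @ x # y # qs) = - F (ps @ y # x # qs)"
    and "distinct (ps @ vs)" "set (ps @ vs) \<subseteq> B" "S \<subseteq> {..<length vs}"
  shows "F (ps @ nths vs S @ nths vs (- S)) = (- 1) ^ inversions S * F (ps @ vs)"
proof -
  have move: "F (ps @ xs @ y # qs) = (- 1) ^ length xs * F (ps @ y # xs @ qs)"
    if "distinct (ps @ xs @ y # qs)" "set (ps @ xs @ y # qs) \<subseteq> B" for ps xs y qs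
    using that
  proof (induction xs arbitrary: ps)
    case (Cons x xs)
    have "F (ps @ (x # xs) @ y # qs) = (- 1) ^ length xs * F (ps @ x # y # xs @ qs)"
      using Cons.IH[of "ps @ [x]"] Cons.prems by simp
    also have "F (ps @ x # y # xs @ qs) = - F (ps @ y # x # xs @ qs)"
      using Cons.prems by (intro sw) auto
    finally show ?case by simp
  qed simp
  show ?thesis
    using assms(2-4)
  proof (induction vs arbitrary: ps S)
    case Nil
    then show ?case by (simp add: inversions_def)
  next
    case (Cons v vs)
    define T where "T = {j. Suc j \<in> S}"
    have T: "T \<subseteq> {..<length vs}" using Cons.prems(3) by (auto simp: T_def)
    have T': "{j. Suc j \<notin> S} = - T" by (auto simp: T_def)
    show ?case
    proof (cases "0 \<in> S")
      case True
      have "S = insert 0 (Suc ` T)"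
      proof (rule Set.set_eqI)
        show "k \<in> S \<longleftrightarrow> k \<in> insert 0 (Suc ` T)" for k using True by (cases k) (auto simp: T_def)
      qed
      then have "inversions S = inversions T" by (simp only: inversions_insert_0)
      moreover have "F ((ps @ [v]) @ nths vs T @ nths vs (- T)) = (- 1) ^ inversions T * F ((ps @ [v]) @ vs)"
        using Cons.prems T by (intro Cons.IH) auto
      ultimately show ?thesis using True by (simp add: nths_Cons T' flip: T_def)
    next
      case False
      have "S = Suc ` T"
      proof (rule Set.set_eqI)
        show "k \<in> S \<longleftrightarrow> k \<in> Suc ` T" for k using False by (cases k) (auto simp: T_def)
      qed
      then have i: "inversions S = inversions T + card T"
        using finite_subset[OF T] by (simp add: inversions_Suc)
      have "{i. i < length vs \<and> i \<in> T} = T" using T by auto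
      then have l: "length (nths vs T) = card T" by (simp add: length_nths)
      have d: "distinct (nths vs T @ nths vs (- T))" "set (nths vs T @ nths vs (- T)) \<subseteq> set vs"
        using Cons.prems(1) by (auto simp: set_nths nth_eq_iff_index_eq)
      have "F (ps @ nths vs T @ v # nths vs (- T)) = (- 1) ^ card T * F (ps @ v # nths vs T @ nths vs (- T))"
        unfolding l[symmetric] using Cons.prems(1,2) d by (intro move) auto
      also have "F (ps @ v # nths vs T @ nths vs (- T)) = (- 1) ^ inversions T * F (ps @ v # vs)"
        using Cons.IH[of "ps @ [v]" T] Cons.prems T by simp
      finally show ?thesis using False by (simp add: nths_Cons T' i power_add flip: T_def)
    qed
  qed
qed

text \<open>The unit by which the generator \<open>\<alpha>\<close> maps the first summand to the
  second. The ninth generator preserves the summands; the default \<open>0\<close> encodes that the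
  ninth row and column of \<open>\<psi>\<close> vanish on the first.\<close>

definition unit9 :: "nat \<Rightarrow> oct" where
  "unit9 \<alpha> = (if \<alpha> = 9 then 0 else oct_basis ! (\<alpha> - 1))"

lemma unit9_simps: "unit9 1 = oct_basis ! 0" "unit9 2 = oct_basis ! 1" "unit9 3 = oct_basis ! 2"
  "unit9 4 = oct_basis ! 3" "unit9 5 = oct_basis ! 4" "unit9 6 = oct_basis ! 5" "unit9 7 = oct_basis ! 6"
  "unit9 8 = oct_basis ! 7" "unit9 9 = 0"
  by (simp_all add: unit9_def)

lemma oct_basis_nth: "oct_basis ! 0 = ((1, 0, 0, 0), 0)" "oct_basis ! 1 = ((0, 1, 0, 0), 0)"
  "oct_basis ! 2 = ((0, 0, 1, 0), 0)" "oct_basis ! 3 = ((0, 0, 0, 1), 0)"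
  "oct_basis ! 4 = (0, (1, 0, 0, 0))" "oct_basis ! 5 = (0, (0, 1, 0, 0))"
  "oct_basis ! 6 = (0, (0, 0, 1, 0))" "oct_basis ! 7 = (0, (0, 0, 0, 1))"
  by (simp_all add: oct_basis_def)

lemma omul_1: "omul x (oct_basis ! 0) = x"
  by (cases x rule: oct_cases) (simp add: oct_basis_nth zero_prod_def)

lemma std_I_first:
  assumes "\<alpha> \<in> {1..8}"
  shows "std_I \<alpha> (a, 0) = (0, omul a (unit9 \<alpha>))"
  using assms omul_1[of a] by (auto simp: std_I_def unit9_def linear_0[OF linear_omul_left])

lemma sum_1_9: "sum F {1..9 :: nat} = F 1 + F 2 + F 3 + F 4 + F 5 + F 6 + F 7 + F 8 + F 9"
  for F :: "nat \<Rightarrow> 'a::comm_monoid_add"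
  by (simp add: eval_nat_numeral add_ac)

lemma unit9_expansion: "(\<Sum>\<gamma>\<in>{1..9}. inner (unit9 \<gamma>) q *\<^sub>R unit9 \<gamma>) = q"
  unfolding sum_1_9 unit9_simps oct_basis_nth
  by (cases q rule: oct_cases) (simp add: inner_Pair zero_prod_def)

text \<open>On the diagonal the right side vanishes because multiplication by a common factor
  preserves the orthogonality of \<open>x\<close> and \<open>y\<close>; for the ninth index it
  vanishes through \<open>unit9\<close>.\<close>

lemma std_kaehler_first:
  assumes ab: "\<alpha> \<in> {1..9}" "\<beta> \<in> {1..9}" and xy: "inner x y = 0"
  shows "Rep_even_form (kaehler_form inner std_J \<alpha> \<beta>) [(x, 0), (y, 0)] = inner (unit9 \<alpha>) (alt_mult True [x, y] (unit9 \<beta>))"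
proof -
  have in8: "\<gamma> \<in> {1..8}" if "\<gamma> \<in> {1..9}" "\<gamma> \<noteq> 9" for \<gamma> :: nat using that by auto
  have m: "inner (unit9 \<alpha>) (alt_mult True [x, y] (unit9 \<beta>)) = inner (omul x (unit9 \<alpha>)) (omul y (unit9 \<beta>))"
    by (simp add: inner_omul_right)
  have i: "inner (x, 0) (std_I \<alpha> (std_I \<beta> (y, 0))) = inner (std_I \<alpha> (x, 0)) (std_I \<beta> (y, 0))"
    by (rule std_I_self_adjoint[OF ab(1), symmetric])
  have v: "Rep_even_form (kaehler_form inner std_J \<alpha> \<beta>) [(x, 0), (y, 0)]
      = (if \<alpha> = \<beta> then 0 else inner (std_I \<alpha> (x, 0)) (std_I \<beta> (y, 0)))"
    unfolding std_point.Rep_kaehler_form[OF ab] by (simp add: i)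
  have nine: "std_I 9 (a, 0) = (a, 0)" for a by (simp add: std_I_9)
  consider "\<alpha> = \<beta>" | "\<alpha> \<noteq> \<beta>" "\<alpha> = 9" | "\<alpha> \<noteq> \<beta>" "\<beta> = 9" | "\<alpha> \<noteq> \<beta>" "\<alpha> \<noteq> 9" "\<beta> \<noteq> 9" by blast
  then show ?thesis
  proof cases
    case 1
    then show ?thesis
      unfolding m v by (simp add: inner_omul_same[OF xy])
  next
    case 2
    then show ?thesis
      unfolding m v using in8[OF ab(2)] by (simp add: nine std_I_first unit9_def linear_0[OF linear_omul_right])
  next
    case 3
    then show ?thesis
      unfolding m v using in8[OF ab(1)] by (simp add: nine std_I_first unit9_def linear_0[OF linear_omul_right])
  next
    case 4
    then show ?thesis
      unfolding m v using in8[OF ab(1)] in8[OF ab(2)] by (simp add: std_I_first)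
  qed
qed

lemma length_nths_compl: "length (nths vs S) + length (nths vs (- S)) = length vs"
proof -
  have "{i. i < length vs \<and> i \<in> S} \<union> {i. i < length vs \<and> i \<in> - S} = {..<length vs}" by auto
  moreover have "{i. i < length vs \<and> i \<in> S} \<inter> {i. i < length vs \<and> i \<in> - S} = {}" by auto
  ultimately show ?thesis
    unfolding length_nths by (subst card_Un_disjoint[symmetric]) simp_all
qed

text \<open>Entries of the matrix power \<open>\<psi>^(k+1)\<close>, for frame indices starting at
  1.\<close>

primrec kaehler_power :: "nat \<Rightarrow> nat \<Rightarrow> nat \<Rightarrow> (oct \<times> oct) even_form" where
  "kaehler_power 0 \<alpha> \<beta> = kaehler_form inner std_J \<alpha> \<beta>"
| "kaehler_power (Suc k) \<alpha> \<beta> = (\<Sum>\<gamma>\<in>{1..9}. kaehler_form inner std_J \<alpha> \<gamma> * kaehler_power k \<gamma> \<beta>)"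

text \<open>All shuffles contribute equally, since the alternating product changes sign exactly as
  the shuffle does. Counting the splittings into ordered pairs gives
  \<open>(2 k + 2)! / 2^(k + 1)\<close>, and the sum over the inner index composes the factors by
  expansion in the units.\<close>

lemma kaehler_power_first:
  assumes "\<alpha> \<in> {1..9}" "\<beta> \<in> {1..9}" "distinct vs" "length vs = 2 * Suc k"
    and orth: "\<And>x y. x \<in> set vs \<Longrightarrow> y \<in> set vs \<Longrightarrow> x \<noteq> y \<Longrightarrow> inner x y = 0"
  shows "Rep_even_form (kaehler_power k \<alpha> \<beta>) (map (\<lambda>x. (x, 0)) vs)
    = fact (2 * Suc k) / 2 ^ Suc k * inner (unit9 \<alpha>) (alt_mult True vs (unit9 \<beta>))"
  using assms
proof (induction k arbitrary: \<alpha> \<beta> vs)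
  case 0
  then obtain x y where vs: "vs = [x, y]" by (auto simp: length_Suc_conv numeral_2_eq_2)
  with 0 have "inner x y = 0" by auto
  then show ?case using std_kaehler_first[OF 0(1,2)] by (simp add: vs)
next
  case (Suc k)
  let ?n = "length vs" and ?e = "map (\<lambda>x. (x, 0 :: oct))"
  let ?c = "fact (2 * Suc k) / 2 ^ Suc k :: real"
  let ?r = "inner (unit9 \<alpha>) (alt_mult True vs (unit9 \<beta>))"
  have S: "(\<Sum>\<gamma>\<in>{1..9}. (- 1) ^ inversions S * Rep_even_form (kaehler_form inner std_J \<alpha> \<gamma>) (nths (?e vs) S) *
      Rep_even_form (kaehler_power k \<gamma> \<beta>) (nths (?e vs) (- S))) = (if card S = 2 then ?c * ?r else 0)"
    if S: "S \<in> Pow {..<?n}" for S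
  proof -
    have Sn: "{i. i < ?n \<and> i \<in> S} = S" using S by auto
    then have lS: "length (nths vs S) = card S" by (simp add: length_nths)
    show ?thesis
    proof (cases "card S = 2")
      case False
      then show ?thesis
        using std_point.Rep_kaehler_form[OF Suc.prems(1)] by (simp add: nths_map lS)
    next
      case True
      have lc: "length (nths vs (- S)) = 2 * Suc k"
        using length_nths_compl[of vs S] True lS Suc.prems(4) by simp
      obtain x y where xy: "nths vs S = [x, y]"
        using True lS by (auto simp: length_Suc_conv numeral_2_eq_2)
      have sub: "set (nths vs T) \<subseteq> set vs" for T by (rule set_nths_subset)
      have d: "distinct (nths vs T)" for T by (rule distinct_nthsI[OF Suc.prems(3)])
      have ip: "inner x y = 0"
        using Suc.prems(5)[of x y] sub[of S] d[of S] by (simp add: xy)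
      have P: "Rep_even_form (kaehler_power k \<gamma> \<beta>) (?e (nths vs (- S)))
          = ?c * inner (unit9 \<gamma>) (alt_mult True (nths vs (- S)) (unit9 \<beta>))" if "\<gamma> \<in> {1..9}" for \<gamma>
        using sub Suc.prems(5) by (intro Suc.IH that Suc.prems(2) d lc) blast
      have K: "Rep_even_form (kaehler_form inner std_J \<alpha> \<gamma>) (?e (nths vs S))
          = inner (unit9 \<alpha>) (alt_mult True [x, y] (unit9 \<gamma>))" if "\<gamma> \<in> {1..9}" for \<gamma>
        using std_kaehler_first[OF Suc.prems(1) that ip] by (simp add: xy)
      let ?q = "alt_mult True (nths vs (- S)) (unit9 \<beta>)"
      have "(\<Sum>\<gamma>\<in>{1..9}. inner (unit9 \<alpha>) (alt_mult True [x, y] (unit9 \<gamma>)) * inner (unit9 \<gamma>) ?q)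
          = inner (unit9 \<alpha>) (alt_mult True [x, y] (\<Sum>\<gamma>\<in>{1..9}. inner (unit9 \<gamma>) ?q *\<^sub>R unit9 \<gamma>))"
        by (simp only: linear_sum[OF linear_alt_mult] linear_cmul[OF linear_alt_mult] inner_sum_right
            inner_scaleR_right mult.commute)
      also have "\<dots> = inner (unit9 \<alpha>) (alt_mult True (nths vs S @ nths vs (- S)) (unit9 \<beta>))"
        unfolding unit9_expansion alt_mult_append xy by simp
      also have "\<dots> = (- 1) ^ inversions S * ?r"
      proof -
        let ?F = "\<lambda>xs. inner (unit9 \<alpha>) (alt_mult True xs (unit9 \<beta>))"
        have sw: "?F (ps @ x # y # qs) = - ?F (ps @ y # x # qs)"
          if "distinct (ps @ x # y # qs)" "set (ps @ x # y # qs) \<subseteq> set vs" for ps x y qs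
        proof -
          have "inner x y = 0" using that Suc.prems(5)[of x y] by auto
          then show ?thesis by (simp only: alt_mult_swap[of x y] inner_minus_right)
        qed
        have "?F ([] @ nths vs S @ nths vs (- S)) = (- 1) ^ inversions S * ?F ([] @ vs)"
          by (rule shuffle_sign[of "set vs" ?F]) (use sw Suc.prems(3) S in auto)
        then show ?thesis by simp
      qed
      finally have "(\<Sum>\<gamma>\<in>{1..9}. inner (unit9 \<alpha>) (alt_mult True [x, y] (unit9 \<gamma>)) * inner (unit9 \<gamma>) ?q)
          = (- 1) ^ inversions S * ?r" .
      moreover have "(\<Sum>\<gamma>\<in>{1..9}. (- 1) ^ inversions S * Rep_even_form (kaehler_form inner std_J \<alpha> \<gamma>) (nths (?e vs) S) *
          Rep_even_form (kaehler_power k \<gamma> \<beta>) (nths (?e vs) (- S)))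
          = (- 1) ^ inversions S * ?c * (\<Sum>\<gamma>\<in>{1..9}. inner (unit9 \<alpha>) (alt_mult True [x, y] (unit9 \<gamma>)) * inner (unit9 \<gamma>) ?q)"
        unfolding sum_distrib_left nths_map by (intro sum.cong refl) (simp only: P K mult_ac)
      ultimately show ?thesis using True by (simp add: mult.assoc[symmetric] power_mult_distrib[symmetric])
    qed
  qed
  have "Rep_even_form (kaehler_power (Suc k) \<alpha> \<beta>) (?e vs)
      = (\<Sum>\<gamma>\<in>{1..9}. \<Sum>S\<in>Pow {..<?n}. (- 1) ^ inversions S * Rep_even_form (kaehler_form inner std_J \<alpha> \<gamma>) (nths (?e vs) S) *
          Rep_even_form (kaehler_power k \<gamma> \<beta>) (nths (?e vs) (- S)))"
    by (simp only: kaehler_power.simps Rep_even_form_sum times_even_form.rep_eq wedge_def length_map)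
  also have "\<dots> = (\<Sum>S\<in>Pow {..<?n}. if card S = 2 then ?c * ?r else 0)"
    by (subst sum.swap) (intro sum.cong refl S)
  also have "\<dots> = real (card {S \<in> Pow {..<?n}. card S = 2}) * (?c * ?r)"
    by (simp add: sum.If_cases Int_def)
  also have "{S \<in> Pow {..<?n}. card S = 2} = {S. S \<subseteq> {..<?n} \<and> card S = 2}" by auto
  also have "card \<dots> = ?n choose 2" using n_subsets[of "{..<?n}" 2] by simp
  also have "real (?n choose 2) * (?c * ?r) = fact (2 * Suc (Suc k)) / 2 ^ Suc (Suc k) * ?r"
  proof -
    have "real (?n choose 2) = real (2 * k + 4) * (2 * k + 3) / 2"
      using Suc.prems(4) by (simp add: choose_two real_of_nat_div algebra_simps)
    then have c: "(real (2 * k + 4) * (2 * k + 3)) = 2 * real (?n choose 2)" by simp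
    have "fact (2 * Suc (Suc k)) = (real (2 * k + 4) * (2 * k + 3)) * fact (2 * Suc k)"
      by (simp add: algebra_simps)
    then show ?thesis unfolding c by (simp del: fact_Suc)
  qed
  finally show ?case .
qed

text \<open>The sign that the order of the basis contributes to the trace of
  \<open>\<psi>^4\<close>; the opposite orientation would give \<open>- s\<close>.\<close>

lemma alt_mult_basis: "alt_mult True oct_basis s = s"
  by (cases s rule: oct_cases) (simp add: oct_basis_def zero_prod_def)

lemma std_tau_first:
  "Rep_even_form (coeff (char_poly (kaehler_matrix inner std_J)) 5) (map (\<lambda>u. (u, 0)) oct_basis) = - 5040"
proof -
  let ?\<psi> = "kaehler_matrix inner std_J" and ?e = "map (\<lambda>u. (u, 0 :: oct)) oct_basis"
  have sh: "(\<Sum>i<9. F (Suc i)) = sum F {1..9}" for F :: "nat \<Rightarrow> (oct \<times> oct) even_form"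
    by (rule sum.reindex_bij_witness[of _ "\<lambda>i. i - 1" Suc]) auto
  have \<psi>: "?\<psi> $$ (i, j) = kaehler_form inner std_J (Suc i) (Suc j)" if "i < 9" "j < 9" for i j
    using that by (simp add: kaehler_matrix_def)
  have "- 4 * coeff (char_poly ?\<psi>) 5
      = (\<Sum>a<9. \<Sum>b<9. ?\<psi> $$ (a, b) * (\<Sum>c<9. ?\<psi> $$ (b, c) * (\<Sum>d<9. ?\<psi> $$ (c, d) * ?\<psi> $$ (d, a))))"
    by (rule coeff_char_poly_trace[OF kaehler_matrix_carrier std_point.coeff_char_poly_even std_coeff_zero
          std_point.coeff_char_poly_even]) simp_all
  also have "\<dots> = (\<Sum>a<9. kaehler_power 3 (Suc a) (Suc a))"
  proof (rule sum.cong[OF refl])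
    fix a :: nat assume a: "a \<in> {..<9}"
    have 1: "(\<Sum>d<9. ?\<psi> $$ (c, d) * ?\<psi> $$ (d, a)) = kaehler_power 1 (Suc c) (Suc a)" if "c < 9" for c
      using that a sh[of "\<lambda>\<delta>. kaehler_form inner std_J (Suc c) \<delta> * kaehler_form inner std_J \<delta> (Suc a)"]
      by (simp add: \<psi>)
    have 2: "(\<Sum>c<9. ?\<psi> $$ (b, c) * (\<Sum>d<9. ?\<psi> $$ (c, d) * ?\<psi> $$ (d, a))) = kaehler_power 2 (Suc b) (Suc a)" if b: "b < 9" for b
    proof -
      have "(\<Sum>c<9. ?\<psi> $$ (b, c) * (\<Sum>d<9. ?\<psi> $$ (c, d) * ?\<psi> $$ (d, a)))
          = (\<Sum>c<9. kaehler_form inner std_J (Suc b) (Suc c) * kaehler_power 1 (Suc c) (Suc a))"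
        by (rule sum.cong[OF refl]) (use \<psi>[OF b] 1 in \<open>simp del: kaehler_power.simps\<close>)
      also have "\<dots> = kaehler_power 2 (Suc b) (Suc a)"
        unfolding sh[of "\<lambda>\<delta>. kaehler_form inner std_J (Suc b) \<delta> * kaehler_power 1 \<delta> (Suc a)"]
        by (simp only: numeral_2_eq_2 One_nat_def kaehler_power.simps)
      finally show ?thesis .
    qed
    have "(\<Sum>b<9. ?\<psi> $$ (a, b) * (\<Sum>c<9. ?\<psi> $$ (b, c) * (\<Sum>d<9. ?\<psi> $$ (c, d) * ?\<psi> $$ (d, a))))
        = (\<Sum>b<9. kaehler_form inner std_J (Suc a) (Suc b) * kaehler_power 2 (Suc b) (Suc a))"
      by (rule sum.cong[OF refl]) (use \<psi>[of a] a 2 in \<open>simp del: kaehler_power.simps\<close>)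
    also have "\<dots> = kaehler_power 3 (Suc a) (Suc a)"
      unfolding sh[of "\<lambda>\<delta>. kaehler_form inner std_J (Suc a) \<delta> * kaehler_power 2 \<delta> (Suc a)"]
      by (simp only: numeral_2_eq_2 numeral_3_eq_3 kaehler_power.simps)
    finally show "(\<Sum>b<9. ?\<psi> $$ (a, b) * (\<Sum>c<9. ?\<psi> $$ (b, c) * (\<Sum>d<9. ?\<psi> $$ (c, d) * ?\<psi> $$ (d, a)))) = kaehler_power 3 (Suc a) (Suc a)" .
  qed
  also have "\<dots> = (\<Sum>\<alpha>\<in>{1..9}. kaehler_power 3 \<alpha> \<alpha>)" by (rule sh)
  finally have e: "- 4 * coeff (char_poly ?\<psi>) 5 = (\<Sum>\<alpha>\<in>{1..9}. kaehler_power 3 \<alpha> \<alpha>)" .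
  have d: "distinct oct_basis" "length oct_basis = 8" by (simp_all add: oct_basis_def zero_prod_def)
  have orth: "inner x y = 0" if "x \<in> set oct_basis" "y \<in> set oct_basis" "x \<noteq> y" for x y
    using that by (auto simp: oct_basis_def inner_Pair zero_prod_def)
  have "Rep_even_form (kaehler_power 3 \<alpha> \<alpha>) ?e = 2520 * inner (unit9 \<alpha>) (unit9 \<alpha>)" if "\<alpha> \<in> {1..9}" for \<alpha>
    using kaehler_power_first[OF that that d(1) _ orth, of 3] by (simp add: d(2) alt_mult_basis fact_numeral)
  then have "Rep_even_form (- 4 * coeff (char_poly ?\<psi>) 5) ?e = 2520 * (\<Sum>\<alpha>\<in>{1..9}. inner (unit9 \<alpha>) (unit9 \<alpha>))"
    unfolding e Rep_even_form_sum sum_distrib_left by (intro sum.cong refl) blast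
  also have "(\<Sum>\<alpha>\<in>{1..9}. inner (unit9 \<alpha>) (unit9 \<alpha>)) = 8"
    unfolding sum_1_9 unit9_simps oct_basis_nth by (simp add: inner_Pair)
  finally show ?thesis
    by (simp add: uminus_even_form.rep_eq Rep_numeral_mult)
qed

subsection \<open>Integration by parts against powers of the density\<close>

lemma lborel_translate:
  fixes f :: "'a::euclidean_space \<Rightarrow> real"
  assumes [measurable]: "f \<in> borel_measurable borel"
  shows "(LINT x|lborel. f (x + c)) = (LINT x|lborel. f x)"
    and "integrable lborel f \<Longrightarrow> integrable lborel (\<lambda>x. f (x + c))"
proof -
  have "(LINT x|lborel. f x) = (LINT x|distr lborel borel ((+) c). f x)"
    by (simp only: lborel_distr_plus)
  also have "\<dots> = (LINT x|lborel. f (c + x))"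
    by (rule integral_distr) auto
  finally show "(LINT x|lborel. f (x + c)) = (LINT x|lborel. f x)" by (simp only: add.commute)
  assume "integrable lborel f"
  then have "integrable (distr lborel borel ((+) c)) f" by (simp only: lborel_distr_plus)
  then have "integrable lborel (\<lambda>x. f (c + x))"
    by (subst (asm) integrable_distr_eq) auto
  then show "integrable lborel (\<lambda>x. f (x + c))" by (simp only: add.commute)
qed

text \<open>Integrate \<open>g' (x + t a)\<close> over \<open>x\<close> and over \<open>t\<close> in
  \<open>{0..1}\<close> in both orders. One order gives the integral of \<open>g'\<close>, the other
  the integral of \<open>g (x + a) - g x\<close>, which is zero by translation invariance. No
  boundary terms have to be estimated.\<close>

lemma integral_directional_derivative:
  fixes g g' :: "'a::euclidean_space \<Rightarrow> real"
  assumes d: "\<And>x t. ((\<lambda>t. g (x + t *\<^sub>R a)) has_real_derivative g' (x + t *\<^sub>R a)) (at t)"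
    and c: "continuous_on UNIV g'" and m: "g \<in> borel_measurable borel"
    and i: "integrable lborel g" "integrable lborel g'"
  shows "(LINT x|lborel. g' x) = 0"
proof -
  have [measurable]: "g' \<in> borel_measurable borel" by (rule borel_measurable_continuous_onI[OF c])
  let ?f = "\<lambda>t x. indicator {0..1::real} t * g' (x + t *\<^sub>R a)"
  have "integrable (lborel \<Otimes>\<^sub>M lborel) (\<lambda>(t, x). ?f t x)"
  proof (rule lborel_pair.Fubini_integrable)
    show "(\<lambda>(t, x). ?f t x) \<in> borel_measurable (lborel \<Otimes>\<^sub>M (lborel :: 'a measure))" by measurable
    have "(LINT x|lborel. norm (case (t, x) of (t, x) \<Rightarrow> ?f t x)) = indicator {0..1} t * (LINT x|lborel. \<bar>g' x\<bar>)" for t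
      using lborel_translate(1)[of "\<lambda>x. \<bar>g' x\<bar>" "t *\<^sub>R a"] by (simp add: abs_mult)
    then show "integrable lborel (\<lambda>t. LINT x|lborel. norm (case (t, x) of (t, x) \<Rightarrow> ?f t x))"
      by (simp add: integrable_indicator_iff content_real)
    show "AE t in lborel. integrable lborel (\<lambda>x. case (t, x) of (t, x) \<Rightarrow> ?f t x)"
      using lborel_translate(2)[OF _ i(2)] by auto
  qed
  from lborel_pair.Fubini_integral[OF this]
  have "(LINT x|lborel. LINT t|lborel. ?f t x) = (LINT t|lborel. LINT x|lborel. ?f t x)" .
  also have "\<dots> = (LINT t|lborel. indicator {0..1::real} t * (LINT x|lborel. g' x))"
    using lborel_translate(1)[of g'] by simp
  also have "\<dots> = (LINT x|lborel. g' x)"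
    by (simp add: content_real)
  also have "(LINT t|lborel. ?f t x) = g (x + a) - g x" for x
  proof -
    have "(LINT t|lborel. indicator {0..1} t *\<^sub>R g' (x + t *\<^sub>R a)) = g (x + 1 *\<^sub>R a) - g (x + 0 *\<^sub>R a)"
    proof (rule integral_FTC_atLeastAtMost)
      show "((\<lambda>t. g (x + t *\<^sub>R a)) has_vector_derivative g' (x + t *\<^sub>R a)) (at t within {0..1})" for t
        using d[of x t] by (simp add: has_real_derivative_iff_has_vector_derivative has_vector_derivative_at_within)
      show "continuous_on {0..1} (\<lambda>t. g' (x + t *\<^sub>R a))"
        by (intro continuous_on_compose2[OF c] continuous_intros) auto
    qed simp
    then show ?thesis by simp
  qed
  then have "(LINT x|lborel. LINT t|lborel. ?f t x) = (LINT x|lborel. g (x + a)) - (LINT x|lborel. g x)"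
    using lborel_translate(2)[OF m i(1)] i(1) by simp
  finally show ?thesis using lborel_translate(1)[OF m] by simp
qed

text \<open>The density of the invariant measure is the case \<open>k = 8\<close>; the normalisation
  of the line frames raises the exponent to 12.\<close>

definition weight :: "nat \<Rightarrow> 'a::real_inner \<Rightarrow> real" where
  "weight k x = 1 / (1 + inner x x) ^ k"

definition lin_prod :: "('i \<Rightarrow> 'a::real_inner) \<Rightarrow> 'i set \<Rightarrow> 'a \<Rightarrow> real" where
  "lin_prod b S x = (\<Prod>j\<in>S. inner (b j) x)"

lemma weight_pos: "weight k x > 0"
  unfolding weight_def by (intro divide_pos_pos zero_less_power add_pos_nonneg) auto

lemma weight_Suc: "inner x x * weight (Suc k) x = weight k x - weight (Suc k) x"
proof -
  have "1 + inner x x > 0" by (rule add_pos_nonneg) auto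
  then have "weight k x = (1 + inner x x) * weight (Suc k) x" by (simp add: weight_def)
  then show ?thesis by (simp add: algebra_simps)
qed

lemma continuous_weight: "continuous_on UNIV (weight k)"
proof -
  have "(1 + inner x x) ^ k \<noteq> 0" for x :: 'a
    by (rule power_not_zero, rule order.strict_implies_not_eq[THEN not_sym], rule add_pos_nonneg) auto
  then show ?thesis unfolding weight_def by (intro continuous_intros) auto
qed

lemma borel_measurable_weight [measurable]: "(weight k :: 'a::euclidean_space \<Rightarrow> real) \<in> borel_measurable borel"
  by (rule borel_measurable_continuous_onI[OF continuous_weight])

lemma continuous_lin_prod: "continuous_on UNIV (lin_prod b S)"
  unfolding lin_prod_def by (intro continuous_intros)

lemma nn_integral_gaussian:
  assumes "s > 0"
  shows "(\<integral>\<^sup>+t. ennreal (exp (- s * t\<^sup>2)) \<partial>lborel) = ennreal (sqrt (pi / s))"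
proof -
  let ?\<sigma> = "sqrt (1 / (2 * s))"
  have \<sigma>: "?\<sigma> > 0" "?\<sigma>\<^sup>2 = 1 / (2 * s)" using assms by simp_all
  interpret prob_space "density lborel (normal_density 0 ?\<sigma>)"
    by (rule prob_space_normal_density[OF \<sigma>(1)])
  have "(\<integral>\<^sup>+t. ennreal (normal_density 0 ?\<sigma> t) \<partial>lborel) = 1"
    using emeasure_space_1 by (simp add: emeasure_density)
  moreover have e: "exp (- s * t\<^sup>2) = sqrt (pi / s) * normal_density 0 ?\<sigma> t" for t
    unfolding normal_density_def \<sigma>(2) using assms by (simp add: real_sqrt_divide)
  ultimately show ?thesis
    by (simp only: e ennreal_mult'[OF real_sqrt_ge_zero] nn_integral_cmult borel_measurable_normal_density)
      (use assms in \<open>simp add: ennreal_mult nn_integral_cmult normal_density_nonneg\<close>)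
qed

lemma nn_integral_power_exp:
  assumes "a > 0"
  shows "(\<integral>\<^sup>+s. ennreal (s ^ k * exp (- (a * s))) * indicator {0..} s \<partial>lborel) = ennreal (fact k / a ^ Suc k)"
proof -
  have "ennreal (fact k) = (\<integral>\<^sup>+x. ennreal (x ^ k * exp (- x)) * indicator {0..} x \<partial>lborel)"
    using nn_intergal_power_times_exp_Ici[of k] by simp
  also have "\<dots> = ennreal \<bar>a\<bar> * (\<integral>\<^sup>+s. ennreal ((0 + a * s) ^ k * exp (- (0 + a * s))) * indicator {0..} (0 + a * s) \<partial>lborel)"
    using assms by (intro nn_integral_real_affine) auto
  also have "(\<integral>\<^sup>+s. ennreal ((0 + a * s) ^ k * exp (- (0 + a * s))) * indicator {0..} (0 + a * s) \<partial>lborel)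
      = (\<integral>\<^sup>+s. ennreal (a ^ k) * (ennreal (s ^ k * exp (- (a * s))) * indicator {0..} s) \<partial>lborel)"
    using assms
    by (intro nn_integral_cong) (auto simp: indicator_def power_mult_distrib zero_le_mult_iff ennreal_mult'[symmetric] mult.assoc)
  also have "\<dots> = ennreal (a ^ k) * (\<integral>\<^sup>+s. ennreal (s ^ k * exp (- (a * s))) * indicator {0..} s \<partial>lborel)"
    by (rule nn_integral_cmult) measurable
  finally have "ennreal (fact k) = ennreal (a ^ Suc k) * (\<integral>\<^sup>+s. ennreal (s ^ k * exp (- (a * s))) * indicator {0..} s \<partial>lborel)"
    using assms by (simp add: mult.assoc[symmetric] ennreal_mult'[symmetric])
  then have "ennreal (1 / a ^ Suc k) * ennreal (fact k)
      = (\<integral>\<^sup>+s. ennreal (s ^ k * exp (- (a * s))) * indicator {0..} s \<partial>lborel)"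
    using assms by (simp add: mult.assoc[symmetric] ennreal_mult'[symmetric] del: power_Suc)
  then show ?thesis using assms by (simp add: ennreal_mult'[symmetric] del: power_Suc)
qed

text \<open>Write \<open>(k - 1)! (1 + |x|^2)^(-k)\<close> as the integral of
  \<open>s^(k-1) exp (- s (1 + |x|^2))\<close> over \<open>s \<ge> 0\<close> and exchange the
  integrals. The inner one is a product of eight Gaussian integrals, \<open>(pi / s)^4\<close>, the
  outer one a factorial. Convergence requires \<open>k > 4\<close>, half the dimension.\<close>

lemma nn_integral_weight:
  assumes "DIM('a::euclidean_space) = 8" "k \<ge> 5"
  shows "(\<integral>\<^sup>+x. ennreal (weight k (x :: 'a)) \<partial>lborel) = ennreal (pi ^ 4 * fact (k - 5) / fact (k - 1))"
proof -
  have pos: "1 + inner x x > 0" for x :: 'a by (rule add_pos_nonneg) auto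
  have k: "Suc (k - 1) = k" "Suc (k - 5) + 4 = k" "k - 1 = (k - 5) + 4" using assms(2) by auto
  have w: "ennreal (fact (k - 1)) * ennreal (weight k x)
      = (\<integral>\<^sup>+s. ennreal (s ^ (k - 1) * exp (- s)) * indicator {0..} s * ennreal (exp (- s * (inner x x))) \<partial>lborel)" for x :: 'a
  proof -
    have "ennreal (fact (k - 1)) * ennreal (weight k x) = ennreal (fact (k - 1) / (1 + inner x x) ^ Suc (k - 1))"
      unfolding k(1) by (simp add: weight_def ennreal_mult'[symmetric])
    also have "\<dots> = (\<integral>\<^sup>+s. ennreal (s ^ (k - 1) * exp (- ((1 + inner x x) * s))) * indicator {0..} s \<partial>lborel)"
      by (rule nn_integral_power_exp[OF pos, symmetric])
    also have "\<dots> = (\<integral>\<^sup>+s. ennreal (s ^ (k - 1) * exp (- s)) * indicator {0..} s * ennreal (exp (- s * (inner x x))) \<partial>lborel)"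
      by (intro nn_integral_cong) (auto simp: indicator_def ennreal_mult'[symmetric] exp_add[symmetric] algebra_simps mult_exp_exp)
    finally show ?thesis .
  qed
  have g: "(\<integral>\<^sup>+x. ennreal (exp (- s * (inner x x))) \<partial>(lborel :: 'a measure)) = ennreal ((pi / s) ^ 4)" if s: "s > 0" for s
  proof -
    have "exp (- s * (inner x x)) = (\<Prod>b\<in>Basis. exp (- s * (inner x b)\<^sup>2))" for x :: 'a
      by (simp add: euclidean_inner[of x x] power2_eq_square exp_sum sum_distrib_left sum_negf[symmetric])
    then have "(\<integral>\<^sup>+x. ennreal (exp (- s * (inner x x))) \<partial>(lborel :: 'a measure))
        = (\<integral>\<^sup>+x. (\<Prod>b\<in>Basis. ennreal (exp (- s * (inner x b)\<^sup>2))) \<partial>(lborel :: 'a measure))"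
      by (simp add: prod_ennreal)
    also have "\<dots> = (\<Prod>b\<in>(Basis :: 'a set). \<integral>\<^sup>+t. ennreal (exp (- s * t\<^sup>2)) \<partial>lborel)"
      by (rule nn_integral_lborel_prod) auto
    also have "\<dots> = ennreal (sqrt (pi / s)) ^ 8"
      by (simp only: nn_integral_gaussian[OF s] prod_constant assms(1))
    also have "\<dots> = ennreal ((pi / s) ^ 4)"
    proof -
      have "sqrt (pi / s) ^ 8 = ((sqrt (pi / s))\<^sup>2) ^ 4" by (simp only: power_mult[symmetric]) simp
      then show ?thesis using s by (simp add: ennreal_power)
    qed
    finally show ?thesis .
  qed
  have "ennreal (fact (k - 1)) * (\<integral>\<^sup>+x. ennreal (weight k (x :: 'a)) \<partial>lborel)
      = (\<integral>\<^sup>+x. ennreal (fact (k - 1)) * ennreal (weight k (x :: 'a)) \<partial>lborel)"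
    by (rule nn_integral_cmult[symmetric]) measurable
  also have "\<dots> = (\<integral>\<^sup>+x. (\<integral>\<^sup>+s. ennreal (s ^ (k - 1) * exp (- s)) * indicator {0..} s * ennreal (exp (- s * (inner x x))) \<partial>lborel) \<partial>(lborel :: 'a measure))"
    by (simp only: w)
  also have "\<dots> = (\<integral>\<^sup>+s. (\<integral>\<^sup>+x. ennreal (s ^ (k - 1) * exp (- s)) * indicator {0..} s * ennreal (exp (- s * (inner x x))) \<partial>(lborel :: 'a measure)) \<partial>lborel)"
    by (rule lborel_pair.Fubini'[symmetric]) measurable
  also have "\<dots> = (\<integral>\<^sup>+s. ennreal (pi ^ 4) * (ennreal (s ^ (k - 5) * exp (- (1 * s))) * indicator {0..} s) \<partial>lborel)"
  proof (rule nn_integral_cong_AE)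
    \<comment> \<open>The point \<open>s = 0\<close>, where the Gaussian integral diverges, is a
      null set.\<close>
    have "AE s in lborel. s \<noteq> (0 :: real)" by (rule AE_lborel_singleton)
    then show "AE s in lborel. (\<integral>\<^sup>+x. ennreal (s ^ (k - 1) * exp (- s)) * indicator {0..} s * ennreal (exp (- s * (inner x x))) \<partial>(lborel :: 'a measure))
        = ennreal (pi ^ 4) * (ennreal (s ^ (k - 5) * exp (- (1 * s))) * indicator {0..} s)"
    proof eventually_elim
      fix s :: real assume "s \<noteq> 0"
      show "(\<integral>\<^sup>+x. ennreal (s ^ (k - 1) * exp (- s)) * indicator {0..} s * ennreal (exp (- s * (inner x x))) \<partial>(lborel :: 'a measure))
        = ennreal (pi ^ 4) * (ennreal (s ^ (k - 5) * exp (- (1 * s))) * indicator {0..} s)"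
      proof (cases "s > 0")
        case True
        have "(\<integral>\<^sup>+x. ennreal (s ^ (k - 1) * exp (- s)) * indicator {0..} s * ennreal (exp (- s * (inner x x))) \<partial>(lborel :: 'a measure))
            = ennreal (s ^ (k - 1) * exp (- s)) * indicator {0..} s * ennreal ((pi / s) ^ 4)"
          by (subst nn_integral_cmult) (measurable, simp only: g[OF True])
        also have "\<dots> = ennreal (s ^ (k - 1) * exp (- s) * (pi / s) ^ 4)"
          using True by (simp add: ennreal_mult'[symmetric])
        also have "s ^ (k - 1) * exp (- s) * (pi / s) ^ 4 = pi ^ 4 * (s ^ (k - 5) * exp (- (1 * s)))"
          unfolding k(3) power_add power_divide using True by simp
        finally show ?thesis using True by (simp add: ennreal_mult'[symmetric])
      next
        case False
        then show ?thesis using \<open>s \<noteq> 0\<close> by (simp add: indicator_def)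
      qed
    qed
  qed
  also have "\<dots> = ennreal (pi ^ 4) * ennreal (fact (k - 5))"
    by (subst nn_integral_cmult) (measurable, simp add: nn_integral_power_exp[of 1 "k - 5", simplified])
  finally have "ennreal (fact (k - 1)) * (\<integral>\<^sup>+x. ennreal (weight k (x :: 'a)) \<partial>lborel) = ennreal (pi ^ 4 * fact (k - 5))"
    by (simp add: ennreal_mult'[symmetric])
  then have "ennreal (1 / fact (k - 1)) * (ennreal (fact (k - 1)) * (\<integral>\<^sup>+x. ennreal (weight k (x :: 'a)) \<partial>lborel))
      = ennreal (1 / fact (k - 1)) * ennreal (pi ^ 4 * fact (k - 5))" by simp
  moreover have "ennreal (1 / fact (k - 1)) * ennreal (fact (k - 1)) = 1"
    by (simp add: ennreal_mult'[symmetric])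
  ultimately show ?thesis by (simp add: mult.assoc[symmetric] ennreal_mult'[symmetric])
qed

lemma integral_weight:
  assumes "DIM('a::euclidean_space) = 8" "k \<ge> 5"
  shows "integrable lborel (weight k :: 'a \<Rightarrow> real)"
    and "(LINT x|lborel. weight k (x :: 'a)) = pi ^ 4 * fact (k - 5) / fact (k - 1)"
proof -
  have m: "(weight k :: 'a \<Rightarrow> real) \<in> borel_measurable borel"
    by (rule borel_measurable_continuous_onI[OF continuous_weight])
  have nn: "weight k x \<ge> 0" for x :: 'a using weight_pos[of k x] by simp
  show "integrable lborel (weight k :: 'a \<Rightarrow> real)"
    using m nn_integral_weight[OF assms] nn by (intro integrableI_nonneg) auto
  show "(LINT x|lborel. weight k (x :: 'a)) = pi ^ 4 * fact (k - 5) / fact (k - 1)"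
    using m nn by (subst integral_eq_nn_integral) (auto simp: nn_integral_weight[OF assms])
qed

subsection \<open>Moments of products of linear forms\<close>

lemma lin_prod_bound:
  assumes "finite S"
  shows "\<bar>lin_prod b S x\<bar> \<le> (\<Prod>j\<in>S. norm (b j)) * sqrt (1 + inner x x) ^ card S"
proof -
  have "norm x \<le> sqrt (1 + inner x x)"
    by (simp add: norm_eq_sqrt_inner)
  then have "\<bar>inner (b j) x\<bar> \<le> norm (b j) * sqrt (1 + inner x x)" for j
    by (meson Cauchy_Schwarz_ineq2 mult_left_mono norm_ge_zero order_trans)
  then have "(\<Prod>j\<in>S. \<bar>inner (b j) x\<bar>) \<le> (\<Prod>j\<in>S. norm (b j) * sqrt (1 + inner x x))"
    by (intro prod_mono) auto
  then show ?thesis by (simp add: lin_prod_def abs_prod prod.distrib)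
qed

lemma sqrt_weight: "sqrt (1 + inner x x) ^ (2 * k) * weight k x = 1"
proof -
  have p: "1 + inner x x > 0" by (rule add_pos_nonneg) auto
  then show ?thesis by (simp add: power_mult weight_def)
qed

text \<open>A product of linear forms is at most a constant times
  \<open>(1 + |x|^2)^(card S / 2)\<close>. The hypothesis leaves a weight of exponent at least 5,
  the first integrable one in dimension 8.\<close>

lemma integrable_lin_prod_weight:
  assumes D: "DIM('a::euclidean_space) = 8" and S: "finite S" "card S + 10 \<le> 2 * k"
  shows "integrable lborel (\<lambda>x. lin_prod b S (x :: 'a) * weight k x)"
proof (rule Bochner_Integration.integrable_bound)
  let ?C = "\<Prod>j\<in>S. norm (b j)"
  show "integrable lborel (\<lambda>x. ?C * weight 5 (x :: 'a))"
    using integral_weight(1)[OF D, of 5] by simp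
  show "(\<lambda>x. lin_prod b S (x :: 'a) * weight k x) \<in> borel_measurable lborel"
    using borel_measurable_continuous_onI[OF continuous_lin_prod] by measurable
  show "AE x in lborel. norm (lin_prod b S (x :: 'a) * weight k x) \<le> norm (?C * weight 5 x)"
  proof (rule AE_I2)
    fix x :: 'a
    let ?s = "sqrt (1 + inner x x)"
    have s: "?s \<ge> 1" by simp
    have C: "?C \<ge> 0" by (intro prod_nonneg) auto
    have "?s ^ card S * ?s ^ 10 \<le> ?s ^ (2 * k)"
      unfolding power_add[symmetric] by (rule power_increasing[OF S(2) s])
    then have "?s ^ card S * (?s ^ 10 * (weight k x * weight 5 x)) \<le> ?s ^ (2 * k) * (weight k x * weight 5 x)"
      using weight_pos[of k x] weight_pos[of 5 x] by (simp only: mult.assoc[symmetric]) (intro mult_right_mono; simp)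
    also have "\<dots> = weight 5 x" using sqrt_weight[of x k] by (simp add: mult.assoc[symmetric])
    also have "?s ^ card S * (?s ^ 10 * (weight k x * weight 5 x)) = ?s ^ card S * weight k x"
      using sqrt_weight[of x 5] by (simp add: mult.left_commute)
    finally have "?C * (?s ^ card S * weight k x) \<le> ?C * weight 5 x"
      using C by (rule mult_left_mono)
    moreover have "\<bar>lin_prod b S x * weight k x\<bar> \<le> ?C * ?s ^ card S * weight k x"
      using lin_prod_bound[OF S(1), of b x] weight_pos[of k x] by (simp add: abs_mult)
    ultimately show "norm (lin_prod b S x * weight k x) \<le> norm (?C * weight 5 x)"
      using C weight_pos[of 5 x] by (simp add: mult.assoc)
  qed
qed

lemma lin_prod_insert: "finite S \<Longrightarrow> j \<notin> S \<Longrightarrow> lin_prod b (insert j S) x = inner (b j) x * lin_prod b S x"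
  by (simp add: lin_prod_def)

lemma lin_prod_remove: "finite S \<Longrightarrow> j \<in> S \<Longrightarrow> lin_prod b S x = inner (b j) x * lin_prod b (S - {j}) x"
  by (simp add: lin_prod_def prod.remove)

lemma lin_prod_deriv:
  assumes "finite S"
  shows "((\<lambda>t. lin_prod b S (x + t *\<^sub>R a)) has_real_derivative
    (\<Sum>j\<in>S. inner (b j) a * lin_prod b (S - {j}) (x + t *\<^sub>R a))) (at t)"
  using assms
proof (induction S rule: finite_induct)
  case empty
  show ?case by (simp add: lin_prod_def)
next
  case (insert k S)
  have l: "((\<lambda>t. inner (b k) (x + t *\<^sub>R a)) has_real_derivative inner (b k) a) (at t)"
    by (auto intro!: derivative_eq_intros simp: inner_add_right)
  have "(\<Sum>j\<in>S. inner (b j) a * lin_prod b (insert k S - {j}) y)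
      = (\<Sum>j\<in>S. inner (b j) a * lin_prod b (S - {j}) y) * inner (b k) y" for y
    unfolding sum_distrib_right
  proof (intro sum.cong refl)
    fix j assume "j \<in> S"
    with insert.hyps have "insert k S - {j} = insert k (S - {j})" by auto
    then show "inner (b j) a * lin_prod b (insert k S - {j}) y = inner (b j) a * lin_prod b (S - {j}) y * inner (b k) y"
      using insert.hyps by (simp add: lin_prod_insert)
  qed
  moreover have "insert k S - {k} = S" using insert.hyps by auto
  ultimately show ?case
    using DERIV_mult[OF l insert.IH] insert.hyps by (simp add: lin_prod_insert add.commute)
qed

lemma weight_deriv:
  "((\<lambda>t. weight k (x + t *\<^sub>R a)) has_real_derivative
    - (2 * real k * inner a (x + t *\<^sub>R a) * weight (Suc k) (x + t *\<^sub>R a))) (at t)"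
proof -
  let ?u = "\<lambda>t. 1 + inner (x + t *\<^sub>R a) (x + t *\<^sub>R a)"
  have p: "?u t \<noteq> 0" for t
    by (rule order.strict_implies_not_eq[THEN not_sym], rule add_pos_nonneg) auto
  have "?u = (\<lambda>t. 1 + inner x x + 2 * t * inner a x + t\<^sup>2 * inner a a)"
    by (rule ext) (simp add: inner_add_left inner_add_right inner_commute power2_eq_square algebra_simps)
  moreover have "((\<lambda>t. 1 + inner x x + 2 * t * inner a x + t\<^sup>2 * inner a a) has_real_derivative
      2 * inner a (x + t *\<^sub>R a)) (at t)"
    by (auto intro!: derivative_eq_intros simp: inner_add_right algebra_simps)
  ultimately have u: "(?u has_real_derivative 2 * inner a (x + t *\<^sub>R a)) (at t)" by (simp only:)
  have "((\<lambda>t. inverse (?u t ^ k)) has_real_derivative - (2 * real k * inner a (x + t *\<^sub>R a) * weight (Suc k) (x + t *\<^sub>R a))) (at t)"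
  proof (cases k)
    case (Suc n)
    have "((\<lambda>t. ?u t ^ Suc n) has_real_derivative real (Suc n) * (2 * inner a (x + t *\<^sub>R a) * ?u t ^ (Suc n - Suc 0))) (at t)"
      by (rule DERIV_power[OF u])
    from DERIV_inverse_fun[OF this power_not_zero[OF p]]
    have "((\<lambda>t. inverse (?u t ^ Suc n)) has_real_derivative - (real (Suc n) * (2 * inner a (x + t *\<^sub>R a) *
        ?u t ^ (Suc n - Suc 0)) * inverse ((?u t ^ Suc n) ^ Suc (Suc 0)))) (at t)" .
    moreover have "- (real (Suc n) * (2 * c * U ^ (Suc n - Suc 0)) * inverse ((U ^ Suc n) ^ Suc (Suc 0)))
        = - (2 * real (Suc n) * c * (1 / U ^ Suc (Suc n)))" if "U \<noteq> 0" for U c :: real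
      using that by (simp add: field_simps)
    ultimately show ?thesis
      unfolding Suc weight_def using p[of t] by (simp only: not_False_eq_True)
  qed simp
  then show ?thesis by (simp add: weight_def inverse_eq_divide)
qed

text \<open>The derivative of \<open>lin_prod b S x * weight k x\<close> along \<open>a\<close>
  integrates to zero; on the weight it produces \<open>- 2 k\<close> times \<open>inner a x\<close>
  and raises the exponent.\<close>

lemma integral_by_parts:
  assumes D: "DIM('a::euclidean_space) = 8" and S: "finite S" "card S + 10 \<le> 2 * k"
  shows "2 * real k * (LINT x|lborel. inner a x * lin_prod b S (x :: 'a) * weight (Suc k) x)
    = (\<Sum>j\<in>S. inner (b j) a * (LINT x|lborel. lin_prod b (S - {j}) x * weight k x))"
    and "integrable lborel (\<lambda>x. inner a x * lin_prod b S (x :: 'a) * weight (Suc k) x)"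
proof -
  let ?g = "\<lambda>x :: 'a. lin_prod b S x * weight k x"
  let ?h = "\<lambda>x :: 'a. inner a x * lin_prod b S x * weight (Suc k) x"
  let ?d = "\<lambda>x :: 'a. \<Sum>j\<in>S. inner (b j) a * (lin_prod b (S - {j}) x * weight k x)"
  show h: "integrable lborel ?h"
  proof -
    \<comment> \<open>The factor \<open>inner a x\<close> joins the product as one more linear form,
      under the new index \<open>None\<close>.\<close>
    define b' where "b' = case_option a b"
    have "lin_prod b' (insert None (Some ` S)) x = inner a x * lin_prod b S x" for x
      using S(1) by (subst lin_prod_insert) (auto simp: lin_prod_def b'_def prod.reindex)
    moreover have "card (insert None (Some ` S)) = Suc (card S)"
      using S(1) by (simp add: card_image)
    ultimately show ?thesis
      using integrable_lin_prod_weight[OF D, of "insert None (Some ` S)" "Suc k" b'] S by simp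
  qed
  have d: "integrable lborel (\<lambda>x. lin_prod b (S - {j}) (x :: 'a) * weight k x)" if "j \<in> S" for j
    using S that by (intro integrable_lin_prod_weight[OF D]) auto
  have e: "?d y - 2 * real k * ?h y = (\<Sum>j\<in>S. inner (b j) a * lin_prod b (S - {j}) y) * weight k y
      + - (2 * real k * inner a y * weight (Suc k) y) * lin_prod b S y" for y
    by (simp add: sum_distrib_left mult_ac)
  have "(LINT x|lborel. ?d x - 2 * real k * ?h x) = 0"
  proof (rule integral_directional_derivative[where g = ?g and a = a])
    show "((\<lambda>t. ?g (x + t *\<^sub>R a)) has_real_derivative ?d (x + t *\<^sub>R a) - 2 * real k * ?h (x + t *\<^sub>R a)) (at t)" for x t
      unfolding e by (rule DERIV_mult[OF lin_prod_deriv[OF S(1), of b x a t] weight_deriv[of k x a t]])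
    show "continuous_on UNIV (\<lambda>x. ?d x - 2 * real k * ?h x)"
      by (intro continuous_intros continuous_lin_prod continuous_weight)
    show "?g \<in> borel_measurable borel"
      by (intro borel_measurable_continuous_onI continuous_intros continuous_lin_prod continuous_weight)
    show "integrable lborel ?g" by (rule integrable_lin_prod_weight[OF D S])
    show "integrable lborel (\<lambda>x. ?d x - 2 * real k * ?h x)"
      using d h by (intro Bochner_Integration.integrable_diff Bochner_Integration.integrable_sum integrable_mult_right) auto
  qed
  moreover have "(LINT x|lborel. ?d x - 2 * real k * ?h x)
      = (\<Sum>j\<in>S. inner (b j) a * (LINT x|lborel. lin_prod b (S - {j}) x * weight k x)) - 2 * real k * (LINT x|lborel. ?h x)"
    using d h by (subst Bochner_Integration.integral_diff) (auto intro!: Bochner_Integration.integrable_sum)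
  ultimately show "2 * real k * (LINT x|lborel. ?h x)
      = (\<Sum>j\<in>S. inner (b j) a * (LINT x|lborel. lin_prod b (S - {j}) x * weight k x))" by simp
qed

text \<open>Integration by parts for the radial field: insert \<open>inner e x\<close> for each
  basis vector \<open>e\<close> and add up. The derivatives give \<open>8 + card S\<close> copies of
  the integral by Euler's formula for homogeneous functions, and \<open>weight_Suc\<close> removes
  the factor \<open>|x|^2\<close>.\<close>

lemma integral_radial:
  assumes D: "DIM('a::euclidean_space) = 8" and S: "finite S" "card S + 11 \<le> 2 * k"
  shows "(2 * real k - 8 - real (card S)) * (LINT x|lborel. lin_prod b S (x :: 'a) * weight k x)
    = 2 * real k * (LINT x|lborel. lin_prod b S x * weight (Suc k) x)"
proof -
  let ?P = "lin_prod b S" and ?E = "\<lambda>k. LINT x|lborel. lin_prod b S (x :: 'a) * weight k x"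
  have i: "integrable lborel (\<lambda>x. ?P (x :: 'a) * weight k x)" "integrable lborel (\<lambda>x. ?P (x :: 'a) * weight (Suc k) x)"
    using S by (auto intro!: integrable_lin_prod_weight[OF D])
  have part: "2 * real k * (LINT x|lborel. inner e x * inner e x * ?P (x :: 'a) * weight (Suc k) x)
      = ?E k + (\<Sum>j\<in>S. (LINT x|lborel. inner (b j) e * inner e x * lin_prod b (S - {j}) x * weight k x))"
    and int: "integrable lborel (\<lambda>x. inner e x * inner e x * ?P (x :: 'a) * weight (Suc k) x)"
    and int': "j \<in> S \<Longrightarrow> integrable lborel (\<lambda>x. inner (b j) e * inner e x * lin_prod b (S - {j}) (x :: 'a) * weight k x)"
    if e: "e \<in> Basis" for e j
  proof -
    define b' where "b' = case_option e b"
    let ?S = "insert None (Some ` S)"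
    have c: "card ?S = Suc (card S)" using S(1) by (simp add: card_image)
    have 1: "lin_prod b' ?S x = inner e x * ?P x" for x
      using S(1) by (subst lin_prod_insert) (auto simp: lin_prod_def b'_def prod.reindex)
    have 2: "lin_prod b' (?S - {None}) x = ?P x" for x
      by (simp add: lin_prod_def b'_def prod.reindex)
    have 3: "lin_prod b' (?S - {Some j}) x = inner e x * lin_prod b (S - {j}) x" if "j \<in> S" for j x
    proof -
      have "?S - {Some j} = insert None (Some ` (S - {j}))" by auto
      then show ?thesis
        using S(1) by (simp add: lin_prod_def b'_def prod.reindex)
    qed
    have "2 * real k * (LINT x|lborel. inner e x * lin_prod b' ?S (x :: 'a) * weight (Suc k) x)
        = (\<Sum>j\<in>?S. inner (b' j) e * (LINT x|lborel. lin_prod b' (?S - {j}) x * weight k x))"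
      using S c by (intro integral_by_parts(1)[OF D]) auto
    also have "\<dots> = (LINT x|lborel. ?P x * weight k x)
        + (\<Sum>j\<in>S. inner (b j) e * (LINT x|lborel. inner e x * lin_prod b (S - {j}) x * weight k x))"
    proof -
      have b': "b' None = e" "\<And>j. b' (Some j) = b j" by (simp_all add: b'_def)
      have "(\<Sum>j\<in>?S. G j) = G None + (\<Sum>j\<in>S. G (Some j))" for G :: "'b option \<Rightarrow> real"
        using S(1) by (simp add: sum.reindex)
      then have "(\<Sum>j\<in>?S. inner (b' j) e * (LINT x|lborel. lin_prod b' (?S - {j}) x * weight k x))
          = inner (b' None) e * (LINT x|lborel. lin_prod b' (?S - {None}) x * weight k x)
          + (\<Sum>j\<in>S. inner (b' (Some j)) e * (LINT x|lborel. lin_prod b' (?S - {Some j}) x * weight k x))"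
        by (simp only:)
      also have "(\<Sum>j\<in>S. inner (b' (Some j)) e * (LINT x|lborel. lin_prod b' (?S - {Some j}) x * weight k x))
          = (\<Sum>j\<in>S. inner (b j) e * (LINT x|lborel. inner e x * lin_prod b (S - {j}) x * weight k x))"
        by (intro sum.cong refl) (simp only: 3 b')
      finally show ?thesis using e by (simp only: 2 b') simp
    qed
    finally show "2 * real k * (LINT x|lborel. inner e x * inner e x * ?P (x :: 'a) * weight (Suc k) x)
      = ?E k + (\<Sum>j\<in>S. (LINT x|lborel. inner (b j) e * inner e x * lin_prod b (S - {j}) x * weight k x))"
      by (simp add: 1 mult.assoc)
    show "integrable lborel (\<lambda>x. inner e x * inner e x * ?P (x :: 'a) * weight (Suc k) x)"
      using integral_by_parts(2)[OF D, of ?S k e b'] S c by (simp add: 1 mult.assoc)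
    assume j: "j \<in> S"
    have "card (?S - {Some j}) = card S"
      using S(1) j c by (simp add: card_Diff_singleton)
    then have "integrable lborel (\<lambda>x. lin_prod b' (?S - {Some j}) (x :: 'a) * weight k x)"
      using S by (intro integrable_lin_prod_weight[OF D]) auto
    then show "integrable lborel (\<lambda>x. inner (b j) e * inner e x * lin_prod b (S - {j}) (x :: 'a) * weight k x)"
      unfolding 3[OF j] by (simp only: mult.assoc integrable_mult_right)
  qed
  have "2 * real k * (\<Sum>e\<in>Basis. LINT x|lborel. inner e x * inner e x * ?P (x :: 'a) * weight (Suc k) x)
      = (\<Sum>e\<in>(Basis :: 'a set). ?E k + (\<Sum>j\<in>S. (LINT x|lborel. inner (b j) e * inner e x * lin_prod b (S - {j}) x * weight k x)))"
    unfolding sum_distrib_left by (intro sum.cong refl part)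
  also have "\<dots> = 8 * ?E k + (\<Sum>j\<in>S. \<Sum>e\<in>(Basis :: 'a set). LINT x|lborel. inner (b j) e * inner e x * lin_prod b (S - {j}) x * weight k x)"
    unfolding sum.distrib sum.swap[of _ S] by (simp add: D)
  also have "(\<Sum>j\<in>S. \<Sum>e\<in>(Basis :: 'a set). LINT x|lborel. inner (b j) e * inner e x * lin_prod b (S - {j}) x * weight k x)
      = (\<Sum>j\<in>S. ?E k)"
  proof (rule sum.cong[OF refl])
    fix j assume j: "j \<in> S"
    have "(\<Sum>e\<in>(Basis :: 'a set). LINT x|lborel. inner (b j) e * inner e x * lin_prod b (S - {j}) x * weight k x)
        = (LINT x|lborel. (\<Sum>e\<in>(Basis :: 'a set). inner (b j) e * inner e x * lin_prod b (S - {j}) x * weight k x))"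
      using int' j by (subst Bochner_Integration.integral_sum) auto
    also have "\<dots> = ?E k"
    proof (rule Bochner_Integration.integral_cong[OF refl])
      fix x :: 'a
      have "(\<Sum>e\<in>Basis. inner (b j) e * inner e x) = inner (b j) x"
        by (subst euclidean_inner[of "b j" x]) (simp add: inner_commute)
      then show "(\<Sum>e\<in>Basis. inner (b j) e * inner e x * lin_prod b (S - {j}) x * weight k x) = ?P x * weight k x"
        using lin_prod_remove[OF S(1) j, of b x] by (simp add: sum_distrib_right[symmetric])
    qed
    finally show "(\<Sum>e\<in>(Basis :: 'a set). LINT x|lborel. inner (b j) e * inner e x * lin_prod b (S - {j}) x * weight k x) = ?E k" .
  qed
  also have "(\<Sum>e\<in>Basis. LINT x|lborel. inner e x * inner e x * ?P (x :: 'a) * weight (Suc k) x) = ?E k - ?E (Suc k)"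
  proof -
    have "(\<Sum>e\<in>Basis. LINT x|lborel. inner e x * inner e x * ?P (x :: 'a) * weight (Suc k) x)
        = (LINT x|lborel. (\<Sum>e\<in>Basis. inner e x * inner e x * ?P (x :: 'a) * weight (Suc k) x))"
      using int by (subst Bochner_Integration.integral_sum) auto
    also have "\<dots> = (LINT x|lborel. ?P (x :: 'a) * weight k x - ?P x * weight (Suc k) x)"
    proof (rule Bochner_Integration.integral_cong[OF refl])
      fix x :: 'a
      have "(\<Sum>e\<in>Basis. inner e x * inner e x) = inner x x"
        by (subst euclidean_inner[of x x]) (simp add: inner_commute)
      then have "(\<Sum>e\<in>Basis. inner e x * inner e x * ?P x * weight (Suc k) x) = ?P x * (inner x x * weight (Suc k) x)"
        by (simp add: sum_distrib_right[symmetric])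
      then show "(\<Sum>e\<in>Basis. inner e x * inner e x * ?P x * weight (Suc k) x) = ?P x * weight k x - ?P x * weight (Suc k) x"
        by (simp add: weight_Suc right_diff_distrib)
    qed
    also have "\<dots> = ?E k - ?E (Suc k)" using i by simp
    finally show ?thesis .
  qed
  finally show ?thesis by (simp add: algebra_simps)
qed

text \<open>Integration by parts replaces two linear forms by their inner product and lowers the
  exponent to 11, with the factor 22. The radial identity for the remaining
  \<open>card S - 2\<close> forms restores 12, with the factor
  \<open>22 - 8 - (card S - 2)\<close>.\<close>

lemma integral_wick:
  assumes D: "DIM('a::euclidean_space) = 8" and S: "finite S" "card S \<le> 8"
  shows "(\<Sum>i\<in>S. \<Sum>j\<in>S - {i}. inner (b i) (b j) * (LINT x|lborel. lin_prod b (S - {i} - {j}) (x :: 'a) * weight 12 x))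
    = real (card S) * (16 - real (card S)) * (LINT x|lborel. lin_prod b S (x :: 'a) * weight 12 x)"
proof -
  let ?E = "\<lambda>k S. LINT x|lborel. lin_prod b S (x :: 'a) * weight k x"
  have 1: "22 * ?E 12 S = (\<Sum>j\<in>S - {i}. inner (b j) (b i) * ?E 11 (S - {i} - {j}))" if i: "i \<in> S" for i
    using integral_by_parts(1)[OF D, of "S - {i}" 11 "b i" b] S i
    by (simp add: lin_prod_remove[OF S(1) i])
  have 2: "(16 - real (card S)) * ?E 11 (S - {i} - {j}) = 22 * ?E 12 (S - {i} - {j})" if "i \<in> S" "j \<in> S - {i}" for i j
  proof -
    have c: "card S \<ge> 2"
      using that S(1) card_mono[of S "{i, j}"] by auto
    have "card (S - {i} - {j}) = card S - 2" using that S(1) by (simp add: card_Diff_singleton)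
    then show ?thesis
      using integral_radial[OF D, of "S - {i} - {j}" 11 b] S c by (simp add: of_nat_diff)
  qed
  have "22 * (real (card S) * (16 - real (card S)) * ?E 12 S) = (\<Sum>i\<in>S. (16 - real (card S)) * (22 * ?E 12 S))"
    by simp
  also have "\<dots> = (\<Sum>i\<in>S. \<Sum>j\<in>S - {i}. 22 * (inner (b i) (b j) * ?E 12 (S - {i} - {j})))"
  proof (rule sum.cong[OF refl])
    fix i assume i: "i \<in> S"
    show "(16 - real (card S)) * (22 * ?E 12 S) = (\<Sum>j\<in>S - {i}. 22 * (inner (b i) (b j) * ?E 12 (S - {i} - {j})))"
      unfolding 1[OF i] sum_distrib_left
    proof (rule sum.cong[OF refl])
      fix j assume "j \<in> S - {i}"
      from 2[OF i this] show "(16 - real (card S)) * (inner (b j) (b i) * ?E 11 (S - {i} - {j}))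
          = 22 * (inner (b i) (b j) * ?E 12 (S - {i} - {j}))"
        by (simp add: inner_commute mult.left_commute)
    qed
  qed
  also have "\<dots> = 22 * (\<Sum>i\<in>S. \<Sum>j\<in>S - {i}. inner (b i) (b j) * ?E 12 (S - {i} - {j}))"
    by (simp only: sum_distrib_left)
  finally show ?thesis by simp
qed

subsection \<open>The model form\<close>

lemma DIM_oct: "DIM(oct) = 8"
  by simp

text \<open>The determinant with its products taken over columns, so that each factor belongs to one
  argument of the form.\<close>

definition leibniz :: "(nat \<Rightarrow> nat \<Rightarrow> real) \<Rightarrow> real" where
  "leibniz A = (\<Sum>p | p permutes {0..<8}. of_int (sign p) * (\<Prod>j = 0..<8. A (p j) j))"

lemma leibniz_det: "Determinant.det (Matrix.mat 8 8 (\<lambda>(i, j). A i j)) = leibniz A"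
proof -
  let ?A = "Matrix.mat 8 8 (\<lambda>(i, j). A i j)"
  have "Determinant.det ?A = Determinant.det ?A\<^sup>T" by (rule det_transpose[symmetric]) auto
  also have "\<dots> = leibniz A"
    unfolding leibniz_def by (subst det_def'[of _ 8]) (auto intro!: sum.cong prod.cong dest: permutes_in_image)
  finally show ?thesis .
qed

lemma leibniz_identical_columns:
  assumes "k < 8" "l < 8" "k \<noteq> l" "\<And>i. A i k = A i l"
  shows "leibniz A = 0"
  unfolding leibniz_det[symmetric]
  by (rule det_identical_columns[of _ 8 k l]) (use assms in auto)

lemma leibniz_linear:
  assumes "k < 8" "\<And>i. linear (\<lambda>v. A v i k)" "\<And>i j v w. j \<noteq> k \<Longrightarrow> A v i j = A w i j"
  shows "linear (\<lambda>v. leibniz (A v))"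
  unfolding leibniz_def
proof (rule linear_compose_sum, rule ballI)
  fix p :: "nat \<Rightarrow> nat"
  let ?c = "of_int (sign p) * (\<Prod>j\<in>{0..<8} - {k}. A 0 (p j) j)"
  have 1: "(\<Prod>j = 0..<8. A v (p j) j) = A v (p k) k * (\<Prod>j\<in>{0..<8} - {k}. A v (p j) j)" for v
    using assms(1) by (simp add: prod.remove)
  have 2: "(\<Prod>j\<in>{0..<8} - {k}. A v (p j) j) = (\<Prod>j\<in>{0..<8} - {k}. A 0 (p j) j)" for v
    by (intro prod.cong refl assms(3)) auto
  have "of_int (sign p) * (\<Prod>j = 0..<8. A v (p j) j) = ?c *\<^sub>R A v (p k) k" for v
    unfolding 1 2[of v] by simp
  then show "linear (\<lambda>v. of_int (sign p) * (\<Prod>j = 0..<8. A v (p j) j))"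
    using linear_compose_scale_right[OF assms(2)[of "p k"], of ?c] by (simp only:)
qed

text \<open>Expand one affine factor at a time: its constant part is a scalar, its linear part moves
  the index from \<open>A\<close> to \<open>S\<close>.\<close>

lemma integrable_affine_prod_weight:
  fixes d :: "'i \<Rightarrow> 'a::euclidean_space"
  assumes D: "DIM('a) = 8" and "finite A" "finite S" "A \<inter> S = {}" "card A + card S + 10 \<le> 2 * k"
  shows "integrable lborel (\<lambda>m. (\<Prod>j\<in>A. c j + inner (d j) m) * (lin_prod d S m * weight k m))"
  using assms(2-)
proof (induction A arbitrary: S rule: finite_induct)
  case empty
  then show ?case using integrable_lin_prod_weight[OF D] by simp
next
  case (insert j A)
  let ?P = "\<lambda>m. \<Prod>j\<in>A. c j + inner (d j) m"
  have 1: "integrable lborel (\<lambda>m. c j * (?P m * (lin_prod d S m * weight k m)))"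
    using insert by (intro integrable_mult_right insert.IH) auto
  have "integrable lborel (\<lambda>m. ?P m * (lin_prod d (insert j S) m * weight k m))"
    using insert by (intro insert.IH) auto
  moreover have "lin_prod d (insert j S) m = inner (d j) m * lin_prod d S m" for m
    using insert by (intro lin_prod_insert) auto
  ultimately have 2: "integrable lborel (\<lambda>m. ?P m * (inner (d j) m * lin_prod d S m * weight k m))" by simp
  have "(\<Prod>j\<in>insert j A. c j + inner (d j) m) * (lin_prod d S m * weight k m)
      = c j * (?P m * (lin_prod d S m * weight k m)) + ?P m * (inner (d j) m * lin_prod d S m * weight k m)" for m
    using insert.hyps by (simp add: algebra_simps)
  then show ?case using Bochner_Integration.integrable_add[OF 1 2] by simp
qed

text \<open>The coordinate without the normalising factor of \<open>line_frame\<close>; in this form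
  it is affine in \<open>m\<close>.\<close>

definition line_coord :: "oct \<Rightarrow> nat \<Rightarrow> oct \<times> oct \<Rightarrow> real" where
  "line_coord m i w = inner (oct_basis ! i, omul m (oct_basis ! i)) w"

lemma linear_line_coord: "linear (line_coord m i)"
  unfolding line_coord_def by (rule bounded_linear.linear[OF bounded_linear_inner_right])

lemma line_coord_affine:
  "line_coord m i w = inner (oct_basis ! i) (fst w) + inner (omul (snd w) (ocnj (oct_basis ! i))) m"
  unfolding line_coord_def
  by (cases w) (simp add: inner_Pair inner_omul_left inner_commute)

definition line_integral :: "(oct \<times> oct) list \<Rightarrow> real" where
  "line_integral ws = (LINT m|lborel. leibniz (\<lambda>i j. line_coord m i (ws ! j)) * weight 12 m)"

lemma integrable_line:
  "integrable lborel (\<lambda>m. leibniz (\<lambda>i j. line_coord m i (ws ! j)) * weight 12 m)"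
proof -
  have "integrable lborel (\<lambda>m. (\<Prod>j = 0..<8. line_coord m (p j) (ws ! j)) * weight 12 m)" for p
    using integrable_affine_prod_weight[OF DIM_oct, of "{0..<8 :: nat}" "{}" 12
        "\<lambda>j. inner (oct_basis ! p j) (fst (ws ! j))" "\<lambda>j. omul (snd (ws ! j)) (ocnj (oct_basis ! p j))"]
    by (simp add: line_coord_affine lin_prod_def)
  then show ?thesis
    unfolding leibniz_def sum_distrib_right mult.assoc
    by (intro Bochner_Integration.integrable_sum integrable_mult_right)
qed

text \<open>The frame lies in the line, so the orthogonal projection drops out of the inner
  products. The eight normalising factors multiply to \<open>(1 + |m|^2)^(-4)\<close>.\<close>

lemma line_volume_closest_point:
  assumes "length ws = 8"
  shows "line_volume m (map (closest_point (oct_line m)) ws) / (1 + (norm m)\<^sup>2) ^ 8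
    = leibniz (\<lambda>i j. line_coord m i (ws ! j)) * weight 12 m"
proof -
  let ?s = "1 / sqrt (1 + (norm m)\<^sup>2)"
  have lin: "linear (\<lambda>x. (x, omul m x))"
    by (rule linearI) (simp_all add: linear_add[OF linear_omul_right] linear_cmul[OF linear_omul_right])
  have sub: "subspace (oct_line m)"
    unfolding oct_line_def by (rule linear_subspace_image[OF lin subspace_UNIV])
  have orth: "inner f (closest_point (oct_line m) w) = inner f w" if f: "f \<in> oct_line m" for f w
  proof -
    let ?c = "closest_point (oct_line m) w"
    have c: "?c \<in> oct_line m"
      by (rule closest_point_in_set[OF closed_subspace[OF sub]]) (use f in blast)
    have "inner (w - ?c) (x - ?c) \<le> 0" if "x \<in> oct_line m" for x
      by (rule closest_point_dot[OF subspace_imp_convex[OF sub] closed_subspace[OF sub] that])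
    \<comment> \<open>Testing with \<open>?c + f\<close> and \<open>?c - f\<close> turns the
      inequality into an equation.\<close>
    from this[OF subspace_add[OF sub c f]] this[OF subspace_diff[OF sub c f]]
    have "inner (w - ?c) f = 0" by (simp add: inner_diff_right)
    then show ?thesis by (simp add: inner_commute[of _ f] inner_diff_right)
  qed
  have len: "length oct_basis = 8" by (simp add: oct_basis_def)
  have "inner (line_frame m ! i) (map (closest_point (oct_line m)) ws ! j) = ?s * line_coord m i (ws ! j)"
    if "i < 8" "j < 8" for i j
  proof -
    have "(oct_basis ! i, omul m (oct_basis ! i)) \<in> oct_line m" by (auto simp: oct_line_def)
    moreover have "line_frame m ! i = ?s *\<^sub>R (oct_basis ! i, omul m (oct_basis ! i))"
      using that len by (simp add: line_frame_def divide_inverse)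
    ultimately show ?thesis
      using that assms orth by (simp only: nth_map inner_scaleR_left line_coord_def)
  qed
  then have "Matrix.mat 8 8 (\<lambda>(i, j). inner (line_frame m ! i) (map (closest_point (oct_line m)) ws ! j))
      = ?s \<cdot>\<^sub>m Matrix.mat 8 8 (\<lambda>(i, j). line_coord m i (ws ! j))"
    by (intro eq_matI) auto
  then have "line_volume m (map (closest_point (oct_line m)) ws) = ?s ^ 8 * leibniz (\<lambda>i j. line_coord m i (ws ! j))"
    by (simp add: line_volume_def leibniz_det)
  moreover have "?s ^ 8 = 1 / (1 + inner m m) ^ 4"
  proof -
    have "sqrt (1 + (norm m)\<^sup>2) ^ 8 = ((sqrt (1 + (norm m)\<^sup>2))\<^sup>2) ^ 4" by (simp only: power_mult[symmetric]) simp
    then show ?thesis by (simp add: power_one_over power2_norm_eq_inner)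
  qed
  moreover have "weight 12 m = 1 / (1 + inner m m) ^ 4 / (1 + inner m m) ^ 8"
    by (simp add: weight_def power_add[symmetric])
  ultimately show ?thesis by (simp add: power2_norm_eq_inner)
qed

text \<open>\<open>Abs_even_form\<close> is meaningful only on even exterior forms. Multilinearity
  passes from the determinant to the integral because every integrand is integrable.\<close>

lemma Rep_spin9_model_form:
  "Rep_even_form spin9_model_form ws = (if length ws = 8 then 110880 / pi ^ 4 * line_integral ws else 0)"
proof -
  define f where "f ws = (if length ws = 8 then 110880 / pi ^ 4 * line_integral ws else 0)" for ws
  have f: "exterior_form f"
  proof (rule exterior_form_adjacentI)
    fix xs ys :: "(oct \<times> oct) list"
    show "linear (\<lambda>v. f (xs @ v # ys))"
    proof (cases "length (xs @ ys) = 7")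
      case True
      let ?A = "\<lambda>m v i j. line_coord m i ((xs @ v # ys) ! j)"
      have l: "linear (\<lambda>v. leibniz (?A m v))" for m
        by (rule leibniz_linear[of "length xs"]) (use True in \<open>auto simp: nth_append linear_line_coord nth_Cons'\<close>)
      have "linear (\<lambda>v. line_integral (xs @ v # ys))"
      proof (rule linearI)
        fix v w and r :: real
        have "line_integral (xs @ (v + w) # ys)
            = (LINT m|lborel. leibniz (?A m v) * weight 12 m + leibniz (?A m w) * weight 12 m)"
          unfolding line_integral_def by (simp only: linear_add[OF l] distrib_right)
        also have "\<dots> = line_integral (xs @ v # ys) + line_integral (xs @ w # ys)"
          unfolding line_integral_def by (rule Bochner_Integration.integral_add; rule integrable_line)
        finally show "line_integral (xs @ (v + w) # ys) = line_integral (xs @ v # ys) + line_integral (xs @ w # ys)" .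
        have "line_integral (xs @ (r *\<^sub>R v) # ys) = (LINT m|lborel. r * (leibniz (?A m v) * weight 12 m))"
          unfolding line_integral_def by (simp only: linear_cmul[OF l] real_scaleR_def mult.assoc)
        then show "line_integral (xs @ (r *\<^sub>R v) # ys) = r *\<^sub>R line_integral (xs @ v # ys)"
          unfolding line_integral_def by simp
      qed
      from linear_compose_scale_right[OF this, of "110880 / pi ^ 4"] show ?thesis
        using True by (simp add: f_def)
    next
      case False
      then show ?thesis by (simp add: f_def linear_zero)
    qed
  next
    fix xs ys and v :: "oct \<times> oct"
    show "f (xs @ v # v # ys) = 0"
    proof (cases "length (xs @ v # v # ys) = 8")
      case True
      have "leibniz (\<lambda>i j. line_coord m i ((xs @ v # v # ys) ! j)) = 0" for m
        by (rule leibniz_identical_columns[of "length xs" "Suc (length xs)"]) (use True in \<open>auto simp: nth_append\<close>)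
      then show ?thesis by (simp add: f_def line_integral_def)
    qed (simp add: f_def)
  qed
  have "spin9_model_form = Abs_even_form f"
    unfolding spin9_model_form_def f_def line_integral_def
    by (rule arg_cong[of _ _ Abs_even_form], rule ext) (auto simp: line_volume_closest_point)
  moreover have "Rep_even_form (Abs_even_form f) = f"
    by (rule Rep_Abs_even_form[OF f]) (auto simp: f_def)
  ultimately show ?thesis by (simp add: f_def)
qed

section \<open>The model form in conjugate coordinates\<close>

definition conj_pair :: "oct \<times> oct \<Rightarrow> oct \<times> oct" where
  "conj_pair = map_prod ocnj ocnj"

lemma conj_pair_simps: "fst (conj_pair v) = ocnj (fst v)" "snd (conj_pair v) = ocnj (snd v)"
  by (simp_all add: conj_pair_def)

lemma conj_pair_conj_pair: "conj_pair (conj_pair v) = v"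
  by (simp add: prod_eq_iff conj_pair_simps ocnj_ocnj)

lemma linear_conj_pair: "linear conj_pair"
  by (rule linearI) (simp_all add: prod_eq_iff conj_pair_simps linear_add[OF linear_ocnj] linear_cmul[OF linear_ocnj])

lemma conj_pair_inner: "inner (conj_pair v) (conj_pair w) = inner v w"
  by (simp add: inner_prod_def[of "conj_pair v"] inner_prod_def[of v w] conj_pair_simps ocnj_inner del: inner_real_def)

definition conj_coeff :: "nat \<Rightarrow> oct \<times> oct \<Rightarrow> oct" where
  "conj_coeff i v = omul (ocnj (snd v)) (ocnj (oct_basis ! i))"

lemma line_coord_conj_pair:
  "line_coord m i (conj_pair v) = inner (ocnj (oct_basis ! i)) (fst v) + inner (conj_coeff i v) m"
  using ocnj_inner[of "ocnj (oct_basis ! i)" "fst v"]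
  by (simp add: line_coord_affine conj_pair_simps conj_coeff_def ocnj_ocnj)

text \<open>Vectors of the first summand have coordinates constant in \<open>m\<close>, those of the
  second have coordinates linear in \<open>m\<close>. Each term of the determinant is thus a
  constant times a moment.\<close>

lemma line_integral_graded:
  assumes l: "length v = 8" and M: "M \<subseteq> {0..<8}"
    and v: "\<And>j. j \<in> M \<Longrightarrow> fst (v ! j) = 0" "\<And>j. j \<in> {0..<8} - M \<Longrightarrow> snd (v ! j) = 0"
  shows "line_integral (map conj_pair v) = (\<Sum>p | p permutes {0..<8}. of_int (sign p) *
    (\<Prod>j\<in>{0..<8} - M. inner (ocnj (oct_basis ! p j)) (fst (v ! j))) *
    (LINT m|lborel. lin_prod (\<lambda>j. conj_coeff (p j) (v ! j)) M m * weight 12 m))"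
proof -
  have fin: "finite M" using M finite_subset by blast
  have card: "card M \<le> 8" using card_mono[OF _ M] by simp
  have "(\<Prod>j = 0..<8. line_coord m (p j) (map conj_pair v ! j))
      = (\<Prod>j\<in>{0..<8} - M. inner (ocnj (oct_basis ! p j)) (fst (v ! j))) * lin_prod (\<lambda>j. conj_coeff (p j) (v ! j)) M m"
    for p m
  proof -
    have "(\<Prod>j = 0..<8. line_coord m (p j) (map conj_pair v ! j))
        = (\<Prod>j\<in>{0..<8} - M. line_coord m (p j) (map conj_pair v ! j)) * (\<Prod>j\<in>M. line_coord m (p j) (map conj_pair v ! j))"
      by (rule prod.subset_diff[OF M]) simp
    also have "(\<Prod>j\<in>{0..<8} - M. line_coord m (p j) (map conj_pair v ! j))
        = (\<Prod>j\<in>{0..<8} - M. inner (ocnj (oct_basis ! p j)) (fst (v ! j)))"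
    proof (rule prod.cong[OF refl])
      fix j assume j: "j \<in> {0..<8} - M"
      have "conj_coeff (p j) (v ! j) = 0"
        by (simp add: conj_coeff_def v(2)[OF j] linear_0[OF linear_ocnj] linear_0[OF linear_omul_left])
      then show "line_coord m (p j) (map conj_pair v ! j) = inner (ocnj (oct_basis ! p j)) (fst (v ! j))"
        using j l by (simp add: line_coord_conj_pair)
    qed
    also have "(\<Prod>j\<in>M. line_coord m (p j) (map conj_pair v ! j)) = lin_prod (\<lambda>j. conj_coeff (p j) (v ! j)) M m"
      unfolding lin_prod_def
    proof (rule prod.cong[OF refl])
      fix j assume j: "j \<in> M"
      then have "j < length v" using M l by auto
      then show "line_coord m (p j) (map conj_pair v ! j) = inner (conj_coeff (p j) (v ! j)) m"
        by (simp add: line_coord_conj_pair v(1)[OF j])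
    qed
    finally show ?thesis .
  qed
  then have "line_integral (map conj_pair v) = (LINT m|lborel. (\<Sum>p | p permutes {0..<8}. of_int (sign p) *
    (\<Prod>j\<in>{0..<8} - M. inner (ocnj (oct_basis ! p j)) (fst (v ! j))) *
    (lin_prod (\<lambda>j. conj_coeff (p j) (v ! j)) M m * weight 12 m)))"
    unfolding line_integral_def leibniz_def by (simp add: sum_distrib_right mult.assoc)
  also have "\<dots> = (\<Sum>p | p permutes {0..<8}. (LINT m|lborel. of_int (sign p) *
    (\<Prod>j\<in>{0..<8} - M. inner (ocnj (oct_basis ! p j)) (fst (v ! j))) *
    (lin_prod (\<lambda>j. conj_coeff (p j) (v ! j)) M m * weight 12 m)))"
    using fin card by (intro Bochner_Integration.integral_sum integrable_mult_right integrable_lin_prod_weight[OF DIM_oct]) auto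
  finally show ?thesis by (simp only: integral_mult_right_zero)
qed

lemma std_I_second:
  assumes "\<alpha> \<in> {1..8}" "fst v = 0"
  shows "std_I \<alpha> v = ((if \<alpha> = 1 then 1 else - 1) *\<^sub>R omul (snd v) (unit9 \<alpha>), 0)"
proof -
  obtain y where "v = (0, y)" using assms(2) by (cases v) auto
  then show ?thesis
    using assms(1) omul_1[of y] by (auto simp: std_I_def unit9_def linear_0[OF linear_omul_left])
qed

lemma inner_unit9_expansion: "(\<Sum>\<alpha>\<in>{1..8}. inner a (unit9 \<alpha>) * inner b (unit9 \<alpha>)) = inner a b"
proof -
  have "inner a b = inner a (\<Sum>\<gamma>\<in>{1..9}. inner (unit9 \<gamma>) b *\<^sub>R unit9 \<gamma>)" by (simp only: unit9_expansion)
  also have "\<dots> = (\<Sum>\<gamma>\<in>{1..9}. inner a (unit9 \<gamma>) * inner b (unit9 \<gamma>))"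
    by (simp only: inner_sum_right inner_scaleR_right inner_commute[of b] mult.commute)
  also have "{1..9} = insert 9 {1..8 :: nat}" by auto
  finally show ?thesis by (simp add: unit9_simps(9))
qed

text \<open>Applying \<open>std_I \<alpha>\<close> to a vector of the second summand turns its
  linear coordinate into a constant, the value of the linear form at the unit of
  \<open>\<alpha>\<close>, up to sign. Summing over \<open>\<alpha>\<close> joins two such constants
  into the inner product of the forms, and \<open>integral_wick\<close> applies to each
  permutation.\<close>

lemma line_integral_recursion:
  assumes l: "length v = 8"
    and s: "\<And>i. i < 8 \<Longrightarrow> std_I 9 (v ! i) = s i *\<^sub>R v ! i" "\<And>i. s i = 1 \<or> s i = (- 1 :: real)"
  shows "(\<Sum>\<alpha>\<in>{1..8}. pair_sum (std_I \<alpha>) {i. i < 8 \<and> s i = - 1} (\<lambda>ws. line_integral (map conj_pair ws)) v)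
    = real (card {i. i < 8 \<and> s i = - 1}) * (16 - real (card {i. i < 8 \<and> s i = - 1})) * line_integral (map conj_pair v)"
proof -
  let ?M = "{i. i < 8 \<and> s i = - 1}"
  have M: "?M \<subseteq> {0..<8}" "finite ?M" by auto
  have v0: "fst (v ! j) = 0" if "j \<in> ?M" for j
    using s(1)[of j] that by (cases "v ! j") (auto simp: std_I_9 zero_prod_def)
  have v1: "snd (v ! j) = 0" if "j \<in> {0..<8} - ?M" for j
    using s(1)[of j] s(2)[of j] that by (cases "v ! j") (auto simp: std_I_9 zero_prod_def)
  let ?b = "\<lambda>p j. conj_coeff (p j) (v ! j)"
  let ?c = "\<lambda>p. of_int (sign p) * (\<Prod>j\<in>{0..<8} - ?M. inner (ocnj (oct_basis ! p j)) (fst (v ! j))) :: real"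
  let ?E = "\<lambda>p S. LINT m|lborel. lin_prod (?b p) S m * weight 12 m"
  have upd: "line_integral (map conj_pair (v[i := std_I \<alpha> (v ! i), j := std_I \<alpha> (v ! j)]))
      = (\<Sum>p | p permutes {0..<8}. ?c p * ((inner (?b p i) (unit9 \<alpha>) * inner (?b p j) (unit9 \<alpha>)) * ?E p (?M - {i} - {j})))"
    if ij: "i \<in> ?M" "j \<in> ?M - {i}" and \<alpha>: "\<alpha> \<in> {1..8}" for i j \<alpha>
  proof -
    let ?v = "v[i := std_I \<alpha> (v ! i), j := std_I \<alpha> (v ! j)]" and ?N = "?M - {i} - {j}"
    \<comment> \<open>The upper block of \<open>std_I 1\<close> has the opposite sign to that of the
      other off-diagonal generators. The sign occurs once for each of the two entries and
      cancels.\<close>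
    define \<epsilon> where "\<epsilon> = (if \<alpha> = 1 then 1 else - 1 :: real)"
    have \<epsilon>: "\<epsilon> * \<epsilon> = 1" by (simp add: \<epsilon>_def)
    have vi: "?v ! i = std_I \<alpha> (v ! i)" "?v ! j = std_I \<alpha> (v ! j)" using ij l by auto
    have vk: "?v ! k = v ! k" if "k \<noteq> i" "k \<noteq> j" for k using that by simp
    have I: "std_I \<alpha> (v ! k) = (\<epsilon> *\<^sub>R omul (snd (v ! k)) (unit9 \<alpha>), 0)" if "k \<in> ?M" for k
      unfolding \<epsilon>_def by (rule std_I_second[OF \<alpha> v0[OF that]])
    \<comment> \<open>Here conjugate coordinates matter: the octonion paired with \<open>m\<close>
      in the coordinate of the line is also the one paired with the unit of the right
      multiplication.\<close>
    have c: "inner (ocnj (oct_basis ! p k)) (fst (std_I \<alpha> (v ! k))) = \<epsilon> * inner (?b p k) (unit9 \<alpha>)"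
      if "k \<in> ?M" for p k
      using inner_omul_right[of "snd (v ! k)" "unit9 \<alpha>" "ocnj (oct_basis ! p k)"]
      by (simp add: I[OF that] conj_coeff_def inner_commute)
    have "line_integral (map conj_pair ?v) = (\<Sum>p | p permutes {0..<8}. of_int (sign p) *
        (\<Prod>k\<in>{0..<8} - ?N. inner (ocnj (oct_basis ! p k)) (fst (?v ! k))) *
        (LINT m|lborel. lin_prod (\<lambda>k. conj_coeff (p k) (?v ! k)) ?N m * weight 12 m))"
    proof (rule line_integral_graded)
      show "length ?v = 8" using l by simp
      show "?N \<subseteq> {0..<8}" by auto
      show "fst (?v ! k) = 0" if "k \<in> ?N" for k using that v0[of k] vk[of k] by auto
      show "snd (?v ! k) = 0" if "k \<in> {0..<8} - ?N" for k
      proof (cases "k = i \<or> k = j")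
        case True
        then show ?thesis using vi I ij by auto
      next
        case False
        then show ?thesis using that v1[of k] vk[of k] by auto
      qed
    qed
    also have "\<dots> = (\<Sum>p | p permutes {0..<8}. ?c p * ((inner (?b p i) (unit9 \<alpha>) * inner (?b p j) (unit9 \<alpha>)) * ?E p ?N))"
    proof (rule sum.cong[OF refl])
      fix p :: "nat \<Rightarrow> nat"
      have "{0..<8} - ?N = insert i (insert j ({0..<8} - ?M))" using ij by auto
      then have "(\<Prod>k\<in>{0..<8} - ?N. inner (ocnj (oct_basis ! p k)) (fst (?v ! k)))
          = (inner (ocnj (oct_basis ! p i)) (fst (?v ! i)) * inner (ocnj (oct_basis ! p j)) (fst (?v ! j)))
            * (\<Prod>k\<in>{0..<8} - ?M. inner (ocnj (oct_basis ! p k)) (fst (?v ! k)))"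
        using ij by simp
      also have "(\<Prod>k\<in>{0..<8} - ?M. inner (ocnj (oct_basis ! p k)) (fst (?v ! k)))
          = (\<Prod>k\<in>{0..<8} - ?M. inner (ocnj (oct_basis ! p k)) (fst (v ! k)))"
      proof (rule prod.cong[OF refl])
        fix k assume "k \<in> {0..<8} - ?M"
        then have "k \<noteq> i" "k \<noteq> j" using ij by auto
        then show "inner (ocnj (oct_basis ! p k)) (fst (?v ! k)) = inner (ocnj (oct_basis ! p k)) (fst (v ! k))"
          by simp
      qed
      also have "inner (ocnj (oct_basis ! p i)) (fst (?v ! i)) * inner (ocnj (oct_basis ! p j)) (fst (?v ! j))
          = (\<epsilon> * \<epsilon>) * (inner (?b p i) (unit9 \<alpha>) * inner (?b p j) (unit9 \<alpha>))"
        unfolding vi using c ij by simp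
      finally have 1: "(\<Prod>k\<in>{0..<8} - ?N. inner (ocnj (oct_basis ! p k)) (fst (?v ! k)))
          = inner (?b p i) (unit9 \<alpha>) * inner (?b p j) (unit9 \<alpha>)
            * (\<Prod>k\<in>{0..<8} - ?M. inner (ocnj (oct_basis ! p k)) (fst (v ! k)))" by (simp only: \<epsilon> mult_1)
      have "lin_prod (\<lambda>k. conj_coeff (p k) (?v ! k)) ?N m = lin_prod (?b p) ?N m" for m
        unfolding lin_prod_def using vk by (intro prod.cong refl) auto
      then show "of_int (sign p) * (\<Prod>k\<in>{0..<8} - ?N. inner (ocnj (oct_basis ! p k)) (fst (?v ! k))) *
          (LINT m|lborel. lin_prod (\<lambda>k. conj_coeff (p k) (?v ! k)) ?N m * weight 12 m)
          = ?c p * ((inner (?b p i) (unit9 \<alpha>) * inner (?b p j) (unit9 \<alpha>)) * ?E p ?N)"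
        unfolding 1 by (simp only: mult_ac)
    qed
    finally show ?thesis .
  qed
  have "(\<Sum>\<alpha>\<in>{1..8}. pair_sum (std_I \<alpha>) ?M (\<lambda>ws. line_integral (map conj_pair ws)) v)
      = (\<Sum>\<alpha>\<in>{1..8}. \<Sum>i\<in>?M. \<Sum>j\<in>?M - {i}. \<Sum>p | p permutes {0..<8}.
          ?c p * ((inner (?b p i) (unit9 \<alpha>) * inner (?b p j) (unit9 \<alpha>)) * ?E p (?M - {i} - {j})))"
    unfolding pair_sum_def by (intro sum.cong refl upd)
  also have "\<dots> = (\<Sum>i\<in>?M. \<Sum>j\<in>?M - {i}. \<Sum>p | p permutes {0..<8}. \<Sum>\<alpha>\<in>{1..8}.
          ?c p * ((inner (?b p i) (unit9 \<alpha>) * inner (?b p j) (unit9 \<alpha>)) * ?E p (?M - {i} - {j})))"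
    by (simp only: sum.swap[of _ _ "{1..8}"])
  also have "\<dots> = (\<Sum>i\<in>?M. \<Sum>j\<in>?M - {i}. \<Sum>p | p permutes {0..<8}. ?c p * (inner (?b p i) (?b p j) * ?E p (?M - {i} - {j})))"
    by (simp only: sum_distrib_left[symmetric] sum_distrib_right[symmetric] inner_unit9_expansion)
  also have "\<dots> = (\<Sum>p | p permutes {0..<8}. ?c p * (\<Sum>i\<in>?M. \<Sum>j\<in>?M - {i}. inner (?b p i) (?b p j) * ?E p (?M - {i} - {j})))"
    by (simp only: sum.swap[of _ _ "{p. p permutes {0..<8}}"] sum_distrib_left)
  also have "\<dots> = (\<Sum>p | p permutes {0..<8}. ?c p * (real (card ?M) * (16 - real (card ?M)) * ?E p ?M))"
  proof (rule sum.cong[OF refl])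
    fix p :: "nat \<Rightarrow> nat"
    have "card ?M \<le> 8" using card_mono[OF _ M(1)] by simp
    from integral_wick[OF DIM_oct M(2) this, of "?b p"]
    show "?c p * (\<Sum>i\<in>?M. \<Sum>j\<in>?M - {i}. inner (?b p i) (?b p j) * ?E p (?M - {i} - {j}))
        = ?c p * (real (card ?M) * (16 - real (card ?M)) * ?E p ?M)" by (simp only:)
  qed
  also have "\<dots> = real (card ?M) * (16 - real (card ?M)) * (\<Sum>p | p permutes {0..<8}. ?c p * ?E p ?M)"
    by (simp only: sum_distrib_left mult_ac)
  also have "(\<Sum>p | p permutes {0..<8}. ?c p * ?E p ?M) = line_integral (map conj_pair v)"
    by (rule line_integral_graded[OF l M(1) v0 v1, symmetric])
  finally show ?thesis .
qed

text \<open>The coordinates are constant in \<open>m\<close>, so the determinant of octonion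
  conjugation, with seven diagonal entries \<open>-1\<close>, splits off.\<close>

lemma line_integral_first: "line_integral (map conj_pair (map (\<lambda>u. (u, 0)) oct_basis)) = - (pi ^ 4 / 7920)"
proof -
  let ?v = "map (\<lambda>u. (u, 0 :: oct)) oct_basis"
  have l: "length oct_basis = 8" by (simp add: oct_basis_def)
  let ?A = "\<lambda>i j. inner (ocnj (oct_basis ! i)) (oct_basis ! j)"
  let ?D = "Matrix.mat 8 8 (\<lambda>(i, j). ?A i j)"
  have "line_integral (map conj_pair ?v) = (\<Sum>p | p permutes {0..<8}. of_int (sign p) *
    (\<Prod>j\<in>{0..<8} - {}. inner (ocnj (oct_basis ! p j)) (fst (?v ! j))) *
    (LINT m|lborel. lin_prod (\<lambda>j. conj_coeff (p j) (?v ! j)) {} m * weight 12 m))"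
    using l by (intro line_integral_graded) auto
  also have "\<dots> = leibniz ?A * (LINT m|lborel. weight 12 (m :: oct))"
    unfolding leibniz_def sum_distrib_right using l by (intro sum.cong refl) (simp add: lin_prod_def)
  also have "(LINT m|lborel. weight 12 (m :: oct)) = pi ^ 4 / 7920"
    using integral_weight(2)[OF DIM_oct, of 12] by (simp add: fact_numeral)
  also have "leibniz ?A = - 1"
  proof -
    have small: "i \<in> {0, 1, 2, 3, 4, 5, 6, 7}" if "i < 8" for i :: nat using that by auto
    have off: "?A i j = 0" if "i < 8" "j < 8" "i \<noteq> j" for i j
      using small[OF that(1)] small[OF that(2)] that(3)
      by (elim insertE emptyE; simp add: oct_basis_def inner_Pair zero_prod_def)
    have "upper_triangular ?D" using off by (auto simp: upper_triangular_def)
    then have "Determinant.det ?D = prod_list (diag_mat ?D)" by (rule det_upper_triangular) auto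
    also have "diag_mat ?D = map (\<lambda>i. ?A i i) [0, 1, 2, 3, 4, 5, 6, 7]"
    proof -
      have "[0..<8] = [0, 1, 2, 3, 4, 5, 6, 7 :: nat]" by (simp add: upt_rec)
      then show ?thesis by (simp add: diag_mat_def)
    qed
    also have "prod_list \<dots> = - 1" by (simp add: oct_basis_def inner_Pair zero_prod_def)
    finally show ?thesis by (simp only: leibniz_det)
  qed
  finally show ?thesis by simp
qed

subsection \<open>Comparison of the two forms for the standard system\<close>

lemma bounded_linear_conj_pair: "bounded_linear conj_pair"
  using linear_conj_pair linear_conv_bounded_linear by blast

lemma conj_pair_apply [simp]: "blinfun_apply (Blinfun conj_pair) = conj_pair"
  by (rule bounded_linear_Blinfun_apply[OF bounded_linear_conj_pair])

lemma span_oct_basis: "span (set oct_basis) = UNIV"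
proof -
  have "x \<in> span (set oct_basis)" for x
  proof -
    have "unit9 \<gamma> \<in> span (set oct_basis)" if "\<gamma> \<in> {1..9}" for \<gamma>
    proof (cases "\<gamma> = 9")
      case False
      then have "oct_basis ! (\<gamma> - 1) \<in> set oct_basis" using that by (intro nth_mem) (auto simp: oct_basis_def)
      then show ?thesis using False by (simp add: unit9_def span_base)
    qed (simp add: unit9_def span_zero)
    then have "(\<Sum>\<gamma>\<in>{1..9}. inner (unit9 \<gamma>) x *\<^sub>R unit9 \<gamma>) \<in> span (set oct_basis)"
      by (intro span_sum span_scale)
    then show ?thesis by (simp only: unit9_expansion)
  qed
  then show ?thesis by blast
qed

lemma pair_sum_diff: "pair_sum T K (\<lambda>w. f w - c * g w) v = pair_sum T K f v - c * pair_sum T K g v"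
  by (simp add: pair_sum_def sum_subtractf sum_distrib_left)

text \<open>By linearity the difference of the two sides satisfies the common recursion, so
  \<open>graded_zero\<close> applies to it; on the first line
  \<open>- 5040 + 360 * 14 = 0\<close>.\<close>

lemma std_tau_eq:
  "coeff (char_poly (kaehler_matrix inner std_J)) 5 = 360 * pullback_form (Blinfun conj_pair) spin9_model_form"
proof -
  let ?c = "coeff (char_poly (kaehler_matrix inner std_J)) 5"
  let ?\<omega> = "?c - 360 * pullback_form (Blinfun conj_pair) spin9_model_form"
  define f where "f = Rep_even_form ?\<omega>"
  have f: "exterior_form f" unfolding f_def by (rule Rep_even_form_exterior)
  have fv: "f w = Rep_even_form ?c w - 360 * (if length w = 8 then 110880 / pi ^ 4 * line_integral (map conj_pair w) else 0)" for w
    unfolding f_def minus_even_form.rep_eq Rep_numeral_mult Rep_pullback_form conj_pair_apply Rep_spin9_model_form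
    by simp
  have "f v = 0" for v
  proof (cases "length v = 8")
    case False
    then show ?thesis using std_point.coeff_char_poly_degree[of v 5] by (simp add: fv)
  next
    case True
    show ?thesis
    proof (rule std.graded_zero[OF f, of 8 "\<lambda>q. real q * (16 - real q)", OF _ _ _ True])
      fix w :: "(oct \<times> oct) list" and s :: "nat \<Rightarrow> real"
      assume w: "length w = 8" "\<And>i. i < 8 \<Longrightarrow> std_I 9 (w ! i) = s i *\<^sub>R w ! i" "\<And>i. s i = 1 \<or> s i = - 1"
      let ?M = "{i. i < 8 \<and> s i = - 1}" and ?K = "360 * (110880 / pi ^ 4) :: real"
      have fw: "f w = Rep_even_form ?c w - ?K * line_integral (map conj_pair w)"
        using w(1) by (simp add: fv)
      have len: "length (w[i := x, j := y]) = 8" for i j x y using w(1) by simp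
      have "pair_sum (std_I \<alpha>) ?M f w = pair_sum (std_I \<alpha>) ?M (Rep_even_form ?c) w
          - ?K * pair_sum (std_I \<alpha>) ?M (\<lambda>ws. line_integral (map conj_pair ws)) w" for \<alpha>
        unfolding pair_sum_diff[symmetric] unfolding pair_sum_def fv len by simp
      then have "(\<Sum>\<alpha>\<in>{1..8}. pair_sum (std_I \<alpha>) ?M f w) = (\<Sum>\<alpha>\<in>{1..8}. pair_sum (std_I \<alpha>) ?M (Rep_even_form ?c) w)
          - ?K * (\<Sum>\<alpha>\<in>{1..8}. pair_sum (std_I \<alpha>) ?M (\<lambda>ws. line_integral (map conj_pair ws)) w)"
        by (simp only: sum_subtractf sum_distrib_left)
      also have "(\<Sum>\<alpha>\<in>{1..8}. pair_sum (std_I \<alpha>) ?M (\<lambda>ws. line_integral (map conj_pair ws)) w)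
          = real (card ?M) * (16 - real (card ?M)) * line_integral (map conj_pair w)"
        by (rule line_integral_recursion[OF w])
      also have "(\<Sum>\<alpha>\<in>{1..8}. pair_sum (std_I \<alpha>) ?M (Rep_even_form ?c) w)
          = real (card ?M) * (16 - real (card ?M)) * Rep_even_form ?c w"
        using std.graded_recursion[OF Rep_even_form_exterior coeff_spin_invariant casimir_std, of w s 8 "real (card ?M)" 5] w
        by (simp add: algebra_simps power2_eq_square)
      finally show "(\<Sum>\<alpha>\<in>{1..8}. pair_sum (std_I \<alpha>) ?M f w) = real (card ?M) * (16 - real (card ?M)) * f w"
        by (simp only: fw) (simp only: right_diff_distrib mult_ac)
    next
      fix q :: nat assume "0 < q" "q \<le> 8"
      then show "real q * (16 - real q) \<noteq> 0" by simp
    next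
      fix w :: "(oct \<times> oct) list"
      assume w: "length w = 8" "\<And>i. i < 8 \<Longrightarrow> std_I 9 (w ! i) = w ! i"
      \<comment> \<open>Restricted to the first summand the form has top degree, hence is determined
        by its value on one basis.\<close>
      define \<iota> :: "oct \<Rightarrow>\<^sub>L (oct \<times> oct)" where "\<iota> = Blinfun (\<lambda>x. (x, 0))"
      have "linear (\<lambda>x :: oct. (x, 0 :: oct))" by (rule linearI) simp_all
      then have "bounded_linear (\<lambda>x :: oct. (x, 0 :: oct))" using linear_conv_bounded_linear by blast
      then have \<iota>: "blinfun_apply \<iota> = (\<lambda>x. (x, 0))"
        unfolding \<iota>_def by (rule bounded_linear_Blinfun_apply)
      have "w ! i = (fst (w ! i), 0)" if "i < 8" for i
        using w(2)[OF that] by (cases "w ! i") (auto simp: std_I_9 zero_prod_def)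
      then have w': "w = map \<iota> (map fst w)"
        using w(1) by (intro nth_equalityI) (auto simp: \<iota>)
      have len: "length oct_basis = 8" "distinct oct_basis" by (simp_all add: oct_basis_def zero_prod_def)
      have "Rep_even_form (pullback_form \<iota> ?\<omega>) (map fst w) = 0"
      proof (rule exterior_form_top_zero[OF Rep_even_form_exterior span_oct_basis len(2)])
        have "f (map (\<lambda>u. (u, 0)) oct_basis) = 0"
          unfolding fv std_tau_first line_integral_first by (simp add: len)
        then show "Rep_even_form (pullback_form \<iota> ?\<omega>) oct_basis = 0"
          by (simp add: Rep_pullback_form \<iota> f_def)
      qed (simp add: w(1) len)
      then show "f w = 0" unfolding Rep_pullback_form w'[symmetric] f_def .
    qed
  qed
  then have "?\<omega> = 0"
    by (intro Rep_even_form_eqI) (simp add: f_def zero_even_form.rep_eq)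
  then show ?thesis by simp
qed

subsection \<open>Transport to an arbitrary point\<close>

lemma span_image_sum:
  assumes "finite A" "x \<in> span (f ` A)"
  shows "\<exists>u. x = (\<Sum>a\<in>A. u a *\<^sub>R f a)"
  using assms(2)
proof (induction rule: span_induct_alt)
  case base
  show ?case by (rule exI[of _ "\<lambda>_. 0"]) simp
next
  case (step c x y)
  then obtain a u where a: "a \<in> A" "x = f a" and u: "y = (\<Sum>a\<in>A. u a *\<^sub>R f a)" by blast
  have "(\<Sum>b\<in>A. (u b + (if b = a then c else 0)) *\<^sub>R f b) = y + (\<Sum>b\<in>A. (if b = a then c *\<^sub>R f b else 0))"
    unfolding u scaleR_add_left sum.distrib by (intro arg_cong2[of _ _ _ _ "(+)"] sum.cong) auto
  also have "\<dots> = c *\<^sub>R x + y" using a assms(1) by simp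
  finally show ?case by (intro exI[of _ "\<lambda>b. u b + (if b = a then c else 0)"]) (rule sym)
qed

context spin9_point
begin

text \<open>An adapted frame followed by conjugation carries the fibre to \<open>std_spin9\<close>;
  expanding the images of the \<open>J \<alpha>\<close> in the standard generators gives the matrix
  of the frame change.\<close>

lemma adapted_frame_char_poly:
  assumes L: "adapted_frame G (span (J ` {1..9})) L" and G: "G x0 x0 \<noteq> 0"
  shows "char_poly (kaehler_matrix G J)
    = map_poly (pullback_form (Blinfun conj_pair o\<^sub>L L)) (char_poly (kaehler_matrix inner std_J))"
proof -
  let ?M = "Blinfun conj_pair o\<^sub>L L"
  have M: "?M v = conj_pair (L v)" for v by simp
  have iso: "inner (?M v) (?M w) = G v w" for v w
    using L by (simp add: conj_pair_inner adapted_frame_def)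
  have "?M x0 \<noteq> 0" using iso[of x0 x0] G by auto
  have "\<exists>u. \<forall>x. ?M (J \<alpha> x) = (\<Sum>\<beta>\<in>{1..9}. u \<beta> *\<^sub>R std_J \<beta> (?M x))" if "\<alpha> \<in> {1..9}" for \<alpha>
  proof -
    have "J \<alpha> \<in> span (J ` {1..9})" using that by (intro span_base) auto
    then obtain S where S: "S \<in> std_spin9" "\<And>x. ?M (J \<alpha> x) = S (?M x)"
      using L unfolding adapted_frame_def conj_pair_def[symmetric] M by blast
    obtain u where "S = (\<Sum>\<beta>\<in>{1..9}. u \<beta> *\<^sub>R std_J \<beta>)"
      using span_image_sum[OF _ S(1)[unfolded std_spin9_def]] by blast
    then show ?thesis
      using S(2) by (intro exI[of _ u]) (simp add: blinfun.sum_left blinfun.scaleR_left)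
  qed
  then have "\<forall>\<alpha>\<in>{1..9}. \<exists>u. \<forall>x. ?M (J \<alpha> x) = (\<Sum>\<beta>\<in>{1..9}. u \<beta> *\<^sub>R std_J \<beta> (?M x))" ..
  from bchoice[OF this] obtain A where A: "\<And>\<alpha> x. \<alpha> \<in> {1..9} \<Longrightarrow> ?M (J \<alpha> x) = (\<Sum>\<beta>\<in>{1..9}. A \<alpha> \<beta> *\<^sub>R std_J \<beta> (?M x))"
    by blast
  show ?thesis
    by (rule char_poly_frame_change[OF spin9_point_axioms std_point.spin9_point_axioms iso \<open>?M x0 \<noteq> 0\<close> A])
qed

lemma tau_adapted_frame:
  assumes L: "adapted_frame G (span (J ` {1..9})) L" and G: "G x0 x0 \<noteq> 0"
  shows "360 * pullback_form L spin9_model_form = coeff (char_poly (kaehler_matrix G J)) 5"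
    and "coeff (char_poly (kaehler_matrix G J)) 7 = 0" "coeff (char_poly (kaehler_matrix G J)) 3 = 0"
proof -
  let ?M = "Blinfun conj_pair o\<^sub>L L"
  interpret h: comm_ring_hom "pullback_form ?M" by (rule pullback_form_hom)
  note c = coeff_char_poly_frame_change[OF adapted_frame_char_poly[OF L G]]
  show "coeff (char_poly (kaehler_matrix G J)) 7 = 0" "coeff (char_poly (kaehler_matrix G J)) 3 = 0"
    unfolding c by (simp_all add: std_coeff_zero)
  have "pullback_form ?M (360 * pullback_form (Blinfun conj_pair) spin9_model_form)
      = 360 * pullback_form L spin9_model_form"
  proof (rule Rep_even_form_eqI)
    fix vs :: "'v list"
    \<comment> \<open>The conjugation after \<open>L\<close> cancels against the one in the
      comparison for the standard system.\<close>
    have "map conj_pair (map ?M vs) = map L vs" by (simp add: conj_pair_conj_pair)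
    then show "Rep_even_form (pullback_form ?M (360 * pullback_form (Blinfun conj_pair) spin9_model_form)) vs
        = Rep_even_form (360 * pullback_form L spin9_model_form) vs"
      unfolding Rep_pullback_form Rep_numeral_mult conj_pair_apply by (simp only:)
  qed
  then show "360 * pullback_form L spin9_model_form = coeff (char_poly (kaehler_matrix G J)) 5"
    unfolding c std_tau_eq by simp
qed

end

subsection \<open>Adapted frames\<close>

context spin9_point
begin

lemma J_neg: "J \<alpha> (- x) = - J \<alpha> x"
  by (rule blinfun.minus_right)

lemma J_sq': "1 \<le> \<alpha> \<Longrightarrow> \<alpha> \<le> 9 \<Longrightarrow> J \<alpha> (J \<alpha> x) = x"
  by (simp add: J_sq)

lemma J_order: "\<beta> < \<alpha> \<Longrightarrow> 1 \<le> \<beta> \<Longrightarrow> \<alpha> \<le> 9 \<Longrightarrow> J \<alpha> (J \<beta> x) = - J \<beta> (J \<alpha> x)"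
  by (rule J_anticommute) auto

text \<open>Rewriting brings words to increasing order and removes squares; the numeric side
  conditions orient the anticommutation rule.\<close>

lemmas J_word_simps = J_sq' J_order J_neg minus_minus

primrec J_word :: "nat list \<Rightarrow> 'v \<Rightarrow> 'v" where
  "J_word [] x = x"
| "J_word (\<alpha> # w) x = J \<alpha> (J_word w x)"

lemma J_word_linear: "J_word w (x + y) = J_word w x + J_word w y" "J_word w (c *\<^sub>R x) = c *\<^sub>R J_word w x"
  by (induction w) (simp_all add: blinfun.add_right blinfun.scaleR_right)

lemma J_word_eq_0: "set w \<subseteq> {1..9} \<Longrightarrow> J_word w x = 0 \<Longrightarrow> x = 0"
proof (induction w)
  case (Cons \<alpha> w)
  have "J_word w x = J \<alpha> (J_word (\<alpha> # w) x)" using Cons.prems(1) by (simp add: J_sq)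
  then have "J_word w x = 0" by (simp only: Cons.prems blinfun.zero_right)
  then show ?case using Cons by simp
qed simp

text \<open>Symmetrising \<open>x\<close> under the involution \<open>t\<close> gives the eigenvalue
  \<open>r\<close>, unless \<open>t\<close> acts on \<open>x\<close> as \<open>- r\<close>. In that
  case \<open>k\<close>, which commutes with the words of \<open>C\<close> and anticommutes with
  \<open>t\<close>, reverses the eigenvalue.\<close>

lemma joint_eigenvector_step:
  assumes x: "x \<noteq> 0" "\<And>w s. (w, s) \<in> C \<Longrightarrow> J_word w x = s *\<^sub>R x"
    and t: "\<And>w s y. (w, s) \<in> C \<Longrightarrow> J_word w (J_word t y) = J_word t (J_word w y)" "\<And>y. J_word t (J_word t y) = y"
    and k: "\<And>w s y. (w, s) \<in> C \<Longrightarrow> J_word w (J_word k y) = J_word k (J_word w y)"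
      "\<And>y. J_word t (J_word k y) = - J_word k (J_word t y)" "set k \<subseteq> {1..9}"
    and r: "r * r = (1 :: real)"
  shows "\<exists>x. x \<noteq> 0 \<and> (\<forall>(w, s)\<in>insert (t, r) C. J_word w x = s *\<^sub>R x)"
proof (cases "x + r *\<^sub>R J_word t x = 0")
  case False
  let ?y = "x + r *\<^sub>R J_word t x"
  have "J_word t ?y = r *\<^sub>R ?y"
    by (simp add: J_word_linear t(2) scaleR_add_right r)
  moreover have "J_word w ?y = s *\<^sub>R ?y" if "(w, s) \<in> C" for w s
    using that by (simp add: J_word_linear t(1)[OF that] x(2)[OF that] scaleR_add_right mult.commute)
  ultimately show ?thesis using False by (intro exI[of _ ?y]) auto
next
  case True
  have "r *\<^sub>R (x + r *\<^sub>R J_word t x) = 0" using True by simp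
  then have "r *\<^sub>R x + J_word t x = 0" by (simp add: scaleR_add_right r)
  then have "J_word t x = (- r) *\<^sub>R x" by (simp add: eq_neg_iff_add_eq_0 add.commute)
  then have "J_word t (J_word k x) = r *\<^sub>R J_word k x"
    by (simp only: k(2) J_word_linear) simp
  moreover have "J_word w (J_word k x) = s *\<^sub>R J_word k x" if "(w, s) \<in> C" for w s
    by (simp add: k(1)[OF that] x(2)[OF that] J_word_linear)
  moreover have "J_word k x \<noteq> 0" using J_word_eq_0[OF k(3)] x(1) by blast
  ultimately show ?thesis by (intro exI[of _ "J_word k x"]) auto
qed

text \<open>The product of all nine generators is central, so \<open>[1]\<close> serves to correct
  \<open>[9]\<close>. A word of even length without repetitions commutes with another exactly if
  they share an even number of letters; \<open>[1, 5]\<close>, \<open>[1, 3]\<close> and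
  \<open>[1, 2]\<close> share one letter with the new word and an even number with each earlier
  one.\<close>

lemma joint_eigenvector:
  assumes x: "x \<noteq> 0" "J 1 (J 2 (J 3 (J 4 (J 5 (J 6 (J 7 (J 8 (J 9 x)))))))) = - x"
  shows "\<exists>x. x \<noteq> 0 \<and> J 9 x = x \<and> J 1 (J 2 (J 3 (J 4 (J 5 (J 6 (J 7 (J 8 (J 9 x)))))))) = - x \<and>
    J 1 (J 2 (J 3 (J 4 x))) = - x \<and> J 1 (J 2 (J 5 (J 6 x))) = - x \<and> J 1 (J 3 (J 5 (J 7 x))) = - x"
proof -
  let ?z = "([1,2,3,4,5,6,7,8,9], - 1 :: real)" and ?j = "([9], 1 :: real)" and ?a = "([1,2,3,4], - 1 :: real)"
    and ?b = "([1,2,5,6], - 1 :: real)" and ?c = "([1,3,5,7], - 1 :: real)"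
  note ws = J_word_simps
  have "\<exists>x. x \<noteq> 0 \<and> (\<forall>(w, s)\<in>{?j, ?z}. J_word w x = s *\<^sub>R x)"
    by (rule joint_eigenvector_step[of x _ _ "[1]"]) (use x in \<open>auto simp: ws\<close>)
  then obtain x1 where "x1 \<noteq> 0" "\<And>w s. (w, s) \<in> {?j, ?z} \<Longrightarrow> J_word w x1 = s *\<^sub>R x1" by blast
  then have "\<exists>x. x \<noteq> 0 \<and> (\<forall>(w, s)\<in>{?a, ?j, ?z}. J_word w x = s *\<^sub>R x)"
    by (rule joint_eigenvector_step[of x1 _ _ "[1, 5]"]) (auto simp: ws)
  then obtain x2 where "x2 \<noteq> 0" "\<And>w s. (w, s) \<in> {?a, ?j, ?z} \<Longrightarrow> J_word w x2 = s *\<^sub>R x2" by blast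
  then have "\<exists>x. x \<noteq> 0 \<and> (\<forall>(w, s)\<in>{?b, ?a, ?j, ?z}. J_word w x = s *\<^sub>R x)"
    by (rule joint_eigenvector_step[of x2 _ _ "[1, 3]"]) (auto simp: ws)
  then obtain x3 where "x3 \<noteq> 0" "\<And>w s. (w, s) \<in> {?b, ?a, ?j, ?z} \<Longrightarrow> J_word w x3 = s *\<^sub>R x3" by blast
  then have "\<exists>x. x \<noteq> 0 \<and> (\<forall>(w, s)\<in>{?c, ?b, ?a, ?j, ?z}. J_word w x = s *\<^sub>R x)"
    by (rule joint_eigenvector_step[of x3 _ _ "[1, 2]"]) (auto simp: ws)
  then obtain x4 where x4: "x4 \<noteq> 0" "\<And>w s. (w, s) \<in> {?c, ?b, ?a, ?j, ?z} \<Longrightarrow> J_word w x4 = s *\<^sub>R x4" by blast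
  then show ?thesis
    using x4(2)[of "[9]" 1] x4(2)[of "[1,2,3,4,5,6,7,8,9]" "- 1"] x4(2)[of "[1,2,3,4]" "- 1"]
      x4(2)[of "[1,2,5,6]" "- 1"] x4(2)[of "[1,3,5,7]" "- 1"]
    by (intro exI[of _ x4]) simp
qed

end

lemma inj_on_bas: "inj_on bas {0..15}"
proof (rule eq_card_imp_inj_on)
  have "DIM(oct \<times> oct) = 16" by simp
  then show "card (bas ` {0..15}) = card {0..15 :: int}" by (simp add: bas_eq_Basis)
qed simp

lemma inner_bas: "i \<in> {0..15} \<Longrightarrow> j \<in> {0..15} \<Longrightarrow> inner (bas i) (bas j) = (if j = i then 1 else 0)"
  using bas_eq_Basis inj_on_bas by (subst inner_Basis) (auto simp: inj_on_def)

text \<open>Relations that \<open>bas 0\<close> satisfies for the standard system; with the Clifford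
  relations they determine how the generators act on all words applied to \<open>x0\<close>.\<close>

locale spin9_vector = spin9_point G J
  for G :: "'v::real_normed_vector \<Rightarrow> 'v \<Rightarrow> real" and J +
  fixes x0
  assumes J9: "J 9 x0 = x0"
    and J18: "J 1 (J 2 (J 3 (J 4 (J 5 (J 6 (J 7 (J 8 x0))))))) = - x0"
    and J1234: "J 1 (J 2 (J 3 (J 4 x0))) = - x0"
    and J1256: "J 1 (J 2 (J 5 (J 6 x0))) = - x0"
    and J1357: "J 1 (J 3 (J 5 (J 7 x0))) = - x0"
    and norm_x0: "G x0 x0 = 1"
begin

lemma J_triple:
  assumes abc: "1 < a" "a < b" "b < c" "c \<le> 9" and e: "J 1 (J a (J b (J c x0))) = s *\<^sub>R x0"
  shows "J b (J c x0) = - s *\<^sub>R J 1 (J a x0)" "J a (J b x0) = - s *\<^sub>R J 1 (J c x0)"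
    "J a (J c x0) = s *\<^sub>R J 1 (J b x0)"
proof -
  have t: "J a (J b (J c x0)) = s *\<^sub>R J 1 x0"
    using arg_cong[OF e, of "J 1"] by (simp add: J_sq' blinfun.scaleR_right)
  show "J b (J c x0) = - s *\<^sub>R J 1 (J a x0)"
    using arg_cong[OF t, of "J a"] abc by (simp add: J_word_simps blinfun.scaleR_right)
  show "J a (J b x0) = - s *\<^sub>R J 1 (J c x0)"
    using arg_cong[OF t, of "J c"] abc by (simp add: J_word_simps blinfun.scaleR_right)
  show "J a (J c x0) = s *\<^sub>R J 1 (J b x0)"
    using arg_cong[OF t, of "J b"] abc by (simp add: J_word_simps blinfun.scaleR_right)
qed

text \<open>Multiplying relations forms the symmetric difference of their index sets, up to sign.
  This and the next three relations complete the list of quadruples through the index 1.\<close>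

lemma J1467: "J 1 (J 4 (J 6 (J 7 x0))) = x0"
proof -
  have "J 1 (J 2 (J 3 (J 4 (J 1 (J 2 (J 5 (J 6 (J 1 (J 3 (J 5 (J 7 x0))))))))))) = - x0"
    by (simp only: J1357 J1256 J1234 J_neg minus_minus)
  then show ?thesis by (simp add: J_word_simps)
qed

lemma J1278: "J 1 (J 2 (J 7 (J 8 x0))) = x0"
proof -
  have "J 1 (J 2 (J 3 (J 4 (J 1 (J 2 (J 5 (J 6 (J 1 (J 2 (J 3 (J 4 (J 5 (J 6 (J 7 (J 8 x0))))))))))))))) = - x0"
    by (simp only: J18 J1256 J1234 J_neg minus_minus)
  then show ?thesis by (simp add: J_word_simps)
qed

lemma J1368: "J 1 (J 3 (J 6 (J 8 x0))) = - x0"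
proof -
  have "J 1 (J 2 (J 3 (J 4 (J 1 (J 3 (J 5 (J 7 (J 1 (J 2 (J 3 (J 4 (J 5 (J 6 (J 7 (J 8 x0))))))))))))))) = - x0"
    by (simp only: J18 J1357 J1234 J_neg minus_minus)
  then show ?thesis by (simp add: J_word_simps minus_equation_iff)
qed

lemma J1458: "J 1 (J 4 (J 5 (J 8 x0))) = - x0"
proof -
  have "J 1 (J 2 (J 5 (J 6 (J 1 (J 3 (J 5 (J 7 (J 1 (J 2 (J 3 (J 4 (J 5 (J 6 (J 7 (J 8 x0))))))))))))))) = - x0"
    by (simp only: J18 J1357 J1256 J_neg minus_minus)
  then show ?thesis by (simp add: J_word_simps minus_equation_iff)
qed

text \<open>The seven triples completing 1 to a relation are the lines of a Fano plane on the points
  2 to 8. Any two points lie on a line, so each product of two of these generators acts on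
  \<open>x0\<close> as \<open>J 1 J c\<close> up to sign, with \<open>c\<close> the third
  point.\<close>

lemma J_pairs:
  "J 3 (J 4 x0) = J 1 (J 2 x0)" "J 2 (J 3 x0) = J 1 (J 4 x0)" "J 2 (J 4 x0) = - J 1 (J 3 x0)"
  "J 5 (J 6 x0) = J 1 (J 2 x0)" "J 2 (J 5 x0) = J 1 (J 6 x0)" "J 2 (J 6 x0) = - J 1 (J 5 x0)"
  "J 5 (J 7 x0) = J 1 (J 3 x0)" "J 3 (J 5 x0) = J 1 (J 7 x0)" "J 3 (J 7 x0) = - J 1 (J 5 x0)"
  "J 6 (J 7 x0) = - J 1 (J 4 x0)" "J 4 (J 6 x0) = - J 1 (J 7 x0)" "J 4 (J 7 x0) = J 1 (J 6 x0)"
  "J 7 (J 8 x0) = - J 1 (J 2 x0)" "J 2 (J 7 x0) = - J 1 (J 8 x0)" "J 2 (J 8 x0) = J 1 (J 7 x0)"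
  "J 6 (J 8 x0) = J 1 (J 3 x0)" "J 3 (J 6 x0) = J 1 (J 8 x0)" "J 3 (J 8 x0) = - J 1 (J 6 x0)"
  "J 5 (J 8 x0) = J 1 (J 4 x0)" "J 4 (J 5 x0) = J 1 (J 8 x0)" "J 4 (J 8 x0) = - J 1 (J 5 x0)"
proof -
  have "J 1 (J 2 (J 3 (J 4 x0))) = (- 1) *\<^sub>R x0" "J 1 (J 2 (J 5 (J 6 x0))) = (- 1) *\<^sub>R x0"
    "J 1 (J 3 (J 5 (J 7 x0))) = (- 1) *\<^sub>R x0" "J 1 (J 4 (J 6 (J 7 x0))) = 1 *\<^sub>R x0"
    "J 1 (J 2 (J 7 (J 8 x0))) = 1 *\<^sub>R x0" "J 1 (J 3 (J 6 (J 8 x0))) = (- 1) *\<^sub>R x0"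
    "J 1 (J 4 (J 5 (J 8 x0))) = (- 1) *\<^sub>R x0"
    by (simp_all only: J1234 J1256 J1357 J1467 J1278 J1368 J1458 scaleR_minus1_left scaleR_one)
  note t = this[THEN J_triple(1)[rotated 4]] this[THEN J_triple(2)[rotated 4]] this[THEN J_triple(3)[rotated 4]]
  show
  "J 3 (J 4 x0) = J 1 (J 2 x0)" "J 2 (J 3 x0) = J 1 (J 4 x0)" "J 2 (J 4 x0) = - J 1 (J 3 x0)"
  "J 5 (J 6 x0) = J 1 (J 2 x0)" "J 2 (J 5 x0) = J 1 (J 6 x0)" "J 2 (J 6 x0) = - J 1 (J 5 x0)"
  "J 5 (J 7 x0) = J 1 (J 3 x0)" "J 3 (J 5 x0) = J 1 (J 7 x0)" "J 3 (J 7 x0) = - J 1 (J 5 x0)"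
  "J 6 (J 7 x0) = - J 1 (J 4 x0)" "J 4 (J 6 x0) = - J 1 (J 7 x0)" "J 4 (J 7 x0) = J 1 (J 6 x0)"
  "J 7 (J 8 x0) = - J 1 (J 2 x0)" "J 2 (J 7 x0) = - J 1 (J 8 x0)" "J 2 (J 8 x0) = J 1 (J 7 x0)"
  "J 6 (J 8 x0) = J 1 (J 3 x0)" "J 3 (J 6 x0) = J 1 (J 8 x0)" "J 3 (J 8 x0) = - J 1 (J 6 x0)"
  "J 5 (J 8 x0) = J 1 (J 4 x0)" "J 4 (J 5 x0) = J 1 (J 8 x0)" "J 4 (J 8 x0) = - J 1 (J 5 x0)"
    by (simp_all add: t del: One_nat_def)
qed

text \<open>The words of \<open>bas_reach\<close> applied to \<open>x0\<close>; the shifts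
  \<open>i + 1\<close> and \<open>i - 7\<close> follow the numbering of \<open>bas\<close>.\<close>

definition frame :: "int \<Rightarrow> 'v" where
  "frame i = (if i = 0 then x0 else if i < 8 then J 1 (J (nat (i + 1)) x0) else J (nat (i - 7)) x0)"

lemma frame_simps:
  "frame 0 = x0" "frame 1 = J 1 (J 2 x0)" "frame 2 = J 1 (J 3 x0)" "frame 3 = J 1 (J 4 x0)" "frame 4 = J 1 (J 5 x0)"
  "frame 5 = J 1 (J 6 x0)" "frame 6 = J 1 (J 7 x0)" "frame 7 = J 1 (J 8 x0)" "frame 8 = J 1 x0" "frame 9 = J 2 x0"
  "frame 10 = J 3 x0" "frame 11 = J 4 x0" "frame 12 = J 5 x0" "frame 13 = J 6 x0" "frame 14 = J 7 x0" "frame 15 = J 8 x0"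
  by (simp_all add: frame_def)

lemma G_zero:
  assumes "a \<in> {2..8}"
  shows "G x0 (J 1 (J a x0)) = 0"
  using J_skew[of 1 a x0 x0] assms by simp

lemma G_zero':
  assumes "a \<in> {1..8}"
  shows "G x0 (J a x0) = 0"
proof -
  have "G x0 (J a x0) = G (J 9 x0) (J a x0)" by (simp only: J9)
  also have "\<dots> = G x0 (J 9 (J a x0))" by (simp add: J_self_adjoint)
  also have "J 9 (J a x0) = - J a x0" using assms J_anticommute[of 9 a x0] by (simp add: J9)
  finally show ?thesis by (simp add: bilinear_rneg[OF bilinear_G])
qed

lemma G_zeros:
  "G x0 (J 1 x0) = 0" "G x0 (J 2 x0) = 0" "G x0 (J 3 x0) = 0" "G x0 (J 4 x0) = 0" "G x0 (J 5 x0) = 0"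
  "G x0 (J 6 x0) = 0" "G x0 (J 7 x0) = 0" "G x0 (J 8 x0) = 0"
  "G x0 (J 1 (J 2 x0)) = 0" "G x0 (J 1 (J 3 x0)) = 0" "G x0 (J 1 (J 4 x0)) = 0" "G x0 (J 1 (J 5 x0)) = 0"
  "G x0 (J 1 (J 6 x0)) = 0" "G x0 (J 1 (J 7 x0)) = 0" "G x0 (J 1 (J 8 x0)) = 0"
  by (simp_all add: G_zero G_zero' del: One_nat_def)

definition intertwiner :: "oct \<times> oct \<Rightarrow> 'v" where
  "intertwiner w = (\<Sum>i\<in>{0..15}. inner w (bas i) *\<^sub>R frame i)"

lemma linear_intertwiner: "linear intertwiner"
  by (rule linearI) (simp_all add: intertwiner_def inner_add_left scaleR_add_left sum.distrib scaleR_sum_right)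

lemma intertwiner_bas: "i \<in> {0..15} \<Longrightarrow> intertwiner (bas i) = frame i"
proof -
  assume i: "i \<in> {0..15}"
  have "intertwiner (bas i) = (\<Sum>j\<in>{0..15}. if j = i then frame j else 0)"
    unfolding intertwiner_def by (intro sum.cong refl) (use i in \<open>simp add: inner_bas\<close>)
  then show "intertwiner (bas i) = frame i" using i by simp
qed

lemma intertwiner_bas_simps:
  "intertwiner (bas 0) = frame 0" "intertwiner (bas 1) = frame 1" "intertwiner (bas 2) = frame 2" "intertwiner (bas 3) = frame 3" "intertwiner (bas 4) = frame 4"
  "intertwiner (bas 5) = frame 5" "intertwiner (bas 6) = frame 6" "intertwiner (bas 7) = frame 7" "intertwiner (bas 8) = frame 8" "intertwiner (bas 9) = frame 9"
  "intertwiner (bas 10) = frame 10" "intertwiner (bas 11) = frame 11" "intertwiner (bas 12) = frame 12" "intertwiner (bas 13) = frame 13"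
  "intertwiner (bas 14) = frame 14" "intertwiner (bas 15) = frame 15"
  by (simp_all add: intertwiner_bas)

lemma J_intertwiner:
  assumes "\<alpha> \<in> {1..9}"
  shows "J \<alpha> (intertwiner w) = intertwiner (std_I \<alpha> w)"
proof -
  have "blinfun_apply (J \<alpha>) \<circ> intertwiner = intertwiner \<circ> std_I \<alpha>"
  proof (rule linear_eq_stdbasis)
    show "(blinfun_apply (J \<alpha>) \<circ> intertwiner) v = (intertwiner \<circ> std_I \<alpha>) v" if "v \<in> Basis" for v
      using assms that unfolding bas_eq_Basis[symmetric] indices_16 indices_9
      by (elim insertE emptyE imageE;
          simp only: o_apply std_I_bas linear_neg[OF linear_intertwiner] intertwiner_bas_simps frame_simps;
          simp add: J_word_simps J_pairs J9 del: One_nat_def)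
  qed (intro linear_compose linear_intertwiner linear_std_I bounded_linear.linear blinfun.bounded_linear_right)+
  from fun_cong[OF this, of w] show ?thesis by (simp only: o_apply)
qed

text \<open>Self-adjointness moves all generators into the second argument, where the relations
  shorten the word to a frame vector up to sign; \<open>G_zeros\<close> and \<open>norm_x0\<close>
  evaluate the rest.\<close>

lemma G_frame:
  assumes "i \<in> {0..15}" "j \<in> {0..15}"
  shows "G (frame i) (frame j) = (if i = j then 1 else 0)"
  using assms unfolding indices_16
  by (elim insertE emptyE; simp only: frame_simps;
      simp add: J_self_adjoint J_word_simps J_pairs J9 G_zeros norm_x0 bilinear_rneg[OF bilinear_G] del: One_nat_def)

lemma intertwiner_isometry: "G (intertwiner v) (intertwiner w) = inner v w"
proof -
  have l: "linear (\<lambda>x. G x y)" "linear (G y)" for y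
    using bilinear_G by (simp_all add: bilinear_def)
  have 1: "G (intertwiner v) y = (\<Sum>i\<in>{0..15}. inner v (bas i) * G (frame i) y)" for y
    unfolding intertwiner_def by (simp add: linear_sum[OF l(1)] linear_cmul[OF l(1)])
  have 2: "G y (intertwiner w) = (\<Sum>j\<in>{0..15}. inner w (bas j) * G y (frame j))" for y
    unfolding intertwiner_def by (simp add: linear_sum[OF l(2)] linear_cmul[OF l(2)])
  have "G (intertwiner v) (intertwiner w) = (\<Sum>i\<in>{0..15}. inner v (bas i) * G (frame i) (intertwiner w))" by (rule 1)
  also have "\<dots> = (\<Sum>i\<in>{0..15}. \<Sum>j\<in>{0..15}. inner v (bas i) * inner w (bas j) * G (frame i) (frame j))"
    by (simp only: 2 sum_distrib_left mult.assoc)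
  also have "\<dots> = (\<Sum>i\<in>{0..15}. \<Sum>j\<in>{0..15}. if i = j then inner v (bas i) * inner w (bas j) else 0)"
    by (intro sum.cong refl) (simp add: G_frame)
  also have "\<dots> = (\<Sum>i\<in>{0..15}. inner v (bas i) * inner w (bas i))" by simp
  also have "\<dots> = (\<Sum>b\<in>Basis. inner v b * inner w b)"
    unfolding bas_eq_Basis[symmetric] by (simp add: sum.reindex[OF inj_on_bas])
  also have "\<dots> = inner v w" by (rule euclidean_inner[symmetric])
  finally show ?thesis .
qed

end

text \<open>The intertwiner is isometric, hence injective, hence bijective in dimension 16. Its
  inverse is followed by conjugation because \<open>adapted_frame\<close> conjugates once
  more.\<close>

lemma spin9_vector_adapted_frame:
  fixes G :: "'v::euclidean_space \<Rightarrow> 'v \<Rightarrow> real"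
  assumes "spin9_vector G J x0" and dim: "DIM('v) = 16"
  shows "\<exists>L. adapted_frame G (span (J ` {1..9})) L"
proof -
  interpret spin9_vector G J x0 by fact
  have "inj intertwiner"
  proof (rule linear_injective_0[THEN iffD2, OF linear_intertwiner], intro allI impI)
    fix w assume "intertwiner w = 0"
    then have "inner w w = 0" using intertwiner_isometry[of w w] bilinear_lzero[OF bilinear_G] by simp
    then show "w = 0" by simp
  qed
  have "surj intertwiner"
  proof -
    have "dim (range intertwiner) = DIM(oct \<times> oct)"
      using dim_image_eq[OF linear_intertwiner, of UNIV] \<open>inj intertwiner\<close> by (simp only: span_UNIV dim_UNIV)
    also have "\<dots> = DIM('v)" by (simp add: dim)
    finally have "span (range intertwiner) = UNIV" by (simp only: dim_eq_full)
    then show ?thesis using subspace_UNIV linear_subspace_image[OF linear_intertwiner] span_eq_iff by metis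
  qed
  then obtain M where M: "linear M" "intertwiner \<circ> M = id" using linear_surjective_right_inverse[OF linear_intertwiner] by blast
  have NM: "intertwiner (M v) = v" for v using fun_cong[OF M(2), of v] by simp
  have MN: "M (intertwiner w) = w" for w using NM[of "intertwiner w"] \<open>inj intertwiner\<close> by (simp add: inj_eq)
  define N' where "N' = Blinfun intertwiner"
  have N': "blinfun_apply N' = intertwiner"
    unfolding N'_def using linear_intertwiner linear_conv_bounded_linear by (intro bounded_linear_Blinfun_apply) blast
  define M' where "M' = Blinfun M"
  have M': "blinfun_apply M' = M"
    unfolding M'_def using M(1) linear_conv_bounded_linear by (intro bounded_linear_Blinfun_apply) blast
  define f where "f = (\<lambda>S. N' o\<^sub>L S o\<^sub>L M')"
  have fv: "f S v = intertwiner (S (M v))" for S v by (simp add: f_def N' M')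
  have "linear f"
    by (rule linearI; rule blinfun_eqI)
      (simp_all add: fv blinfun.add_left blinfun.scaleR_left linear_add[OF linear_intertwiner] linear_cmul[OF linear_intertwiner])
  have fJ: "f (std_J \<alpha>) = J \<alpha>" if "\<alpha> \<in> {1..9}" for \<alpha>
    by (rule blinfun_eqI) (simp add: fv NM J_intertwiner[OF that, symmetric])
  have "span (J ` {1..9}) = span (f ` std_J ` {1..9})"
    unfolding image_image using fJ by (intro arg_cong[of _ _ span] image_cong) auto
  also have "\<dots> = f ` std_spin9"
    unfolding std_spin9_def by (rule linear_span_image[OF \<open>linear f\<close>])
  also have "\<dots> = {T :: 'v \<Rightarrow>\<^sub>L 'v. \<exists>S\<in>std_spin9. \<forall>v. M (T v) = S (M v)}"
  proof (intro Set.set_eqI iffI)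
    fix T assume "T \<in> f ` std_spin9"
    then obtain S where S: "S \<in> std_spin9" "T = f S" by blast
    have "\<forall>v. M (T v) = S (M v)" by (simp add: S(2) fv MN)
    then show "T \<in> {T :: 'v \<Rightarrow>\<^sub>L 'v. \<exists>S\<in>std_spin9. \<forall>v. M (T v) = S (M v)}" using S(1) by blast
  next
    fix T assume "T \<in> {T :: 'v \<Rightarrow>\<^sub>L 'v. \<exists>S\<in>std_spin9. \<forall>v. M (T v) = S (M v)}"
    then obtain S where S: "S \<in> std_spin9" "\<And>v. M (T v) = S (M v)" by blast
    have "T = f S" by (rule blinfun_eqI) (simp add: fv S(2)[symmetric] NM)
    then show "T \<in> f ` std_spin9" using S(1) by blast
  qed
  finally have V: "span (J ` {1..9}) = {T :: 'v \<Rightarrow>\<^sub>L 'v. \<exists>S\<in>std_spin9. \<forall>v. M (T v) = S (M v)}" .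
  define L where "L = Blinfun conj_pair o\<^sub>L M'"
  have L: "L v = conj_pair (M v)" "map_prod ocnj ocnj (L v) = M v" for v
    by (simp_all add: L_def M' conj_pair_def[symmetric] conj_pair_conj_pair)
  have "inner (L v) (L w) = G v w" for v w
    using intertwiner_isometry[of "M v" "M w"] by (simp add: L(1) conj_pair_inner NM)
  then have "adapted_frame G (span (J ` {1..9})) L"
    unfolding adapted_frame_def V L(2) by blast
  then show ?thesis by blast
qed

lemma (in spin9_point) spin9_vector_exists:
  assumes pos: "\<And>v. v \<noteq> 0 \<Longrightarrow> G v v > 0"
    and x: "x \<noteq> 0" "J 1 (J 2 (J 3 (J 4 (J 5 (J 6 (J 7 (J 8 (J 9 x)))))))) = - x"
  shows "\<exists>x0. spin9_vector G J x0"
proof -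
  obtain y where y: "y \<noteq> 0" "J 9 y = y" "J 1 (J 2 (J 3 (J 4 (J 5 (J 6 (J 7 (J 8 (J 9 y)))))))) = - y"
    "J 1 (J 2 (J 3 (J 4 y))) = - y" "J 1 (J 2 (J 5 (J 6 y))) = - y" "J 1 (J 3 (J 5 (J 7 y))) = - y"
    using joint_eigenvector[OF x] by blast
  let ?x = "y /\<^sub>R sqrt (G y y)"
  have "G ?x ?x = 1"
    using pos[OF y(1)] by (simp add: bilinear_lmul[OF bilinear_G] bilinear_rmul[OF bilinear_G])
      (simp add: field_simps)
  then have "spin9_vector G J ?x"
    using y by unfold_locales (simp_all only: blinfun.scaleR_right scaleR_minus_right)
  then show ?thesis by blast
qed

text \<open>The product of the nine generators is a central involution, equal to \<open>-1\<close>
  for the standard system. The relations of \<open>bas 0\<close> can hold only on its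
  \<open>-1\<close>-eigenspace, hence the case distinction.\<close>

lemma adapted_frame_exists:
  fixes G :: "'v::euclidean_space \<Rightarrow> 'v \<Rightarrow> real"
  assumes "spin9_point G J" and pos: "\<And>v. v \<noteq> 0 \<Longrightarrow> G v v > 0" and dim: "DIM('v) = 16"
  shows "\<exists>L. adapted_frame G (span (J ` {1..9})) L"
proof -
  interpret spin9_point G J by fact
  obtain x :: 'v where x: "x \<noteq> 0" using nonzero_Basis SOME_Basis by blast
  let ?z = "\<lambda>x. J 1 (J 2 (J 3 (J 4 (J 5 (J 6 (J 7 (J 8 (J 9 x))))))))"
  have zz: "?z (?z x) = x" by (simp add: J_word_simps)
  show ?thesis
  proof (cases "x + ?z x = 0")
    case True
    then have "?z x = - x" by (simp add: eq_neg_iff_add_eq_0 add.commute)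
    then show ?thesis
      using spin9_vector_exists[OF pos x] spin9_vector_adapted_frame[OF _ dim] by blast
  next
    case False
    \<comment> \<open>The product acts as the identity on \<open>x + ?z x\<close>. Reversing
      \<open>J 8\<close> makes it \<open>-1\<close> there and keeps the span of the frame.\<close>
    define K where "K = J(8 := - J 8)"
    have K: "K 8 = - J 8" "\<alpha> \<noteq> 8 \<Longrightarrow> K \<alpha> = J \<alpha>" for \<alpha> by (simp_all add: K_def)
    have sgn: "\<exists>c. c * c = (1 :: real) \<and> K \<alpha> = c *\<^sub>R J \<alpha>" for \<alpha>
      using K by (cases "\<alpha> = 8") (auto intro: exI[of _ "- 1"] exI[of _ 1])
    have span: "span (K ` {1..9}) = span (J ` {1..9})"
    proof (rule span_eq[THEN iffD2], intro conjI image_subsetI)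
      fix \<alpha> :: nat assume a: "\<alpha> \<in> {1..9}"
      obtain c where c: "c * c = (1 :: real)" "K \<alpha> = c *\<^sub>R J \<alpha>" using sgn by blast
      then have "J \<alpha> = c *\<^sub>R K \<alpha>" by simp
      then show "J \<alpha> \<in> span (K ` {1..9})" using a by (simp only:) (intro span_scale span_base imageI)
      show "K \<alpha> \<in> span (J ` {1..9})" unfolding c(2) using a by (intro span_scale span_base imageI)
    qed
    interpret K: spin9_point G K
    proof
      show "spin9_system G K"
        unfolding spin9_system_def
      proof (intro ballI conjI allI impI)
        fix \<alpha> :: nat assume a: "\<alpha> \<in> {1..9}"
        obtain c where c: "c * c = (1 :: real)" "K \<alpha> = c *\<^sub>R J \<alpha>" using sgn by blast
        show "K \<alpha> o\<^sub>L K \<alpha> = id_blinfun"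
          by (rule blinfun_eqI) (simp add: c blinfun.scaleR_left blinfun.scaleR_right J_sq[OF a])
        show "G (K \<alpha> v) w = G v (K \<alpha> w)" for v w
          by (simp add: c(2) blinfun.scaleR_left bilinear_lmul[OF bilinear_G] bilinear_rmul[OF bilinear_G] J_self_adjoint[OF a])
        fix \<beta> :: nat assume b: "\<beta> \<in> {1..9}" "\<alpha> \<noteq> \<beta>"
        obtain d where d: "K \<beta> = d *\<^sub>R J \<beta>" using sgn by blast
        show "K \<alpha> o\<^sub>L K \<beta> = - (K \<beta> o\<^sub>L K \<alpha>)"
          by (rule blinfun_eqI)
            (simp add: c(2) d blinfun.scaleR_left blinfun.scaleR_right uminus_blinfun.rep_eq J_anticommute[OF a b] mult.commute)
      qed
    qed (rule bilinear_G, rule G_sym)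
    let ?y = "x + ?z x"
    have "?z ?y = ?y" using zz by (simp only: blinfun.add_right) (simp only: add.commute)
    then have "K 1 (K 2 (K 3 (K 4 (K 5 (K 6 (K 7 (K 8 (K 9 ?y)))))))) = - ?y"
      by (simp add: K uminus_blinfun.rep_eq J_neg)
    then obtain x0 where "spin9_vector G K x0" using K.spin9_vector_exists[OF pos False] by blast
    then show ?thesis using spin9_vector_adapted_frame[OF _ dim] span by metis
  qed
qed

text \<open>For every adapted frame, 360 times the pullback of the model form is one and the same
  coefficient, so the pullbacks agree and the definite description in \<open>Phi_spin9\<close>
  denotes.\<close>

lemma Phi_spin9_eq:
  fixes G :: "'v::euclidean_space \<Rightarrow> 'v \<Rightarrow> real"
  assumes S: "spin9_point G J" and pos: "\<And>v. v \<noteq> 0 \<Longrightarrow> G v v > 0" and dim: "DIM('v) = 16"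
  shows "360 * Phi_spin9 G (span (J ` {1..9})) = coeff (char_poly (kaehler_matrix G J)) 5"
    and "coeff (char_poly (kaehler_matrix G J)) 7 = 0" "coeff (char_poly (kaehler_matrix G J)) 3 = 0"
proof -
  interpret spin9_point G J by fact
  let ?V = "span (J ` {1..9})"
  obtain x0 :: 'v where "x0 \<noteq> 0" using nonzero_Basis SOME_Basis by blast
  then have G: "G x0 x0 \<noteq> 0" using pos[of x0] by simp
  obtain L where L: "adapted_frame G ?V L" using adapted_frame_exists[OF S pos dim] by blast
  show "coeff (char_poly (kaehler_matrix G J)) 7 = 0" "coeff (char_poly (kaehler_matrix G J)) 3 = 0"
    by (rule tau_adapted_frame[OF L G])+
  have u: "pullback_form L' spin9_model_form = pullback_form L spin9_model_form" if "adapted_frame G ?V L'" for L'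
  proof (rule numeral_mult_even_form_cancel)
    show "360 * pullback_form L' spin9_model_form = 360 * pullback_form L spin9_model_form"
      by (simp only: tau_adapted_frame(1)[OF that G] tau_adapted_frame(1)[OF L G])
  qed
  have "Phi_spin9 G ?V = pullback_form L spin9_model_form"
    unfolding Phi_spin9_def
  proof (rule the_equality)
    show "(\<exists>L. adapted_frame G ?V L) \<and> (\<forall>L'. adapted_frame G ?V L' \<longrightarrow> pullback_form L spin9_model_form = pullback_form L' spin9_model_form)"
      using L by (intro conjI exI allI impI u[symmetric])
    show "\<Phi> = pullback_form L spin9_model_form"
      if "(\<exists>L. adapted_frame G ?V L) \<and> (\<forall>L. adapted_frame G ?V L \<longrightarrow> \<Phi> = pullback_form L spin9_model_form)" for \<Phi>
      using that L by blast
  qed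
  then show "360 * Phi_spin9 G ?V = coeff (char_poly (kaehler_matrix G J)) 5"
    using tau_adapted_frame(1)[OF L G] by (simp only:)
qed

theorem theorem7p1:
  fixes X :: "'m topology" and A :: "'m chart set"
    and g :: "'m bilinear_field" and V :: "'m endo_set_field"
    and W :: "'m set" and I :: "nat \<Rightarrow> 'm endo_field"
    and c :: "'m chart" and p :: 'm and \<psi> :: "R16 even_form Matrix.mat"
  assumes "riemannian_manifold X A g"
    and "spin9_structure X A g V"
    and "spin9_frame_on X A g V W I"
    and "c \<in> A" and "p \<in> fst c" and "p \<in> W"
    and "\<psi> = kaehler_matrix (g c p) (\<lambda>\<alpha>. I \<alpha> c p)"
  shows "char_poly \<psi> = monom 1 9 + monom (tau 4 \<psi>) 5 + monom (tau 8 \<psi>) 1 \<and>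
    360 * Phi_spin9 (g c p) (V c p) = tau 4 \<psi>"
proof -
  let ?J = "\<lambda>\<alpha>. I \<alpha> c p"
  have met: "bilinear (g c p)" "\<And>v w. g c p v w = g c p w v" "\<And>v. v \<noteq> 0 \<Longrightarrow> g c p v v > 0"
    using assms(1,4,5) unfolding riemannian_manifold_def riemannian_metric_def by blast+
  have sys: "spin9_system (g c p) ?J" and V: "V c p = span (?J ` {1..9})"
    using assms(3-6) unfolding spin9_frame_on_def by blast+
  interpret spin9_point "g c p" ?J
    by unfold_locales (use met sys in auto)
  note \<tau> = Phi_spin9_eq[OF spin9_point_axioms met(3), folded assms(7)]
  have dim: "DIM(R16) = 16" by simp
  have C: "\<psi> \<in> carrier_mat 9 9" using kaehler_matrix_carrier by (simp add: assms(7))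
  have deg: "degree (char_poly \<psi>) = 9" and monic: "lead_coeff (char_poly \<psi>) = 1"
    using degree_monic_char_poly[OF C] by auto
  have "coeff (char_poly \<psi>) n = coeff (monom 1 9 + monom (tau 4 \<psi>) 5 + monom (tau 8 \<psi>) 1) n" for n
  proof -
    \<comment> \<open>Even coefficients vanish by skewness, those of index 3 and 7 by invariance;
      \<open>tau 4\<close> and \<open>tau 8\<close> sit at 5 and 1 because \<open>tau k\<close>
      counts down from 9.\<close>
    have "n > 9 \<or> even n \<and> n \<le> 9 \<or> n = 1 \<or> n = 3 \<or> n = 5 \<or> n = 7 \<or> n = 9" by presburger
    then consider "n > 9" | "even n" "n \<le> 9" | "n \<in> {1, 3, 5, 7, 9}" by blast
    then show ?thesis
    proof cases
      case 1
      then show ?thesis using deg by (simp add: coeff_eq_0)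
    next
      case 2
      then have "n \<noteq> 9" "n \<noteq> 5" "n \<noteq> 1" by auto
      then show ?thesis using 2 coeff_char_poly_even by (simp add: assms(7))
    next
      case 3
      then show ?thesis
        using deg monic \<tau>(2,3)[OF _ dim] by (elim insertE emptyE) (simp_all add: tau_def)
    qed
  qed
  moreover have "360 * Phi_spin9 (g c p) (V c p) = tau 4 \<psi>"
    using \<tau>(1)[OF _ dim] by (simp add: V tau_def)
  ultimately show ?thesis by (simp add: poly_eq_iff)
qed

end
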